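(* Let $(X,g,\mu_g)$ be a complete non-compact (Riemannian) pseudomanifold (with $\partial X=\emptyset$). Let $f\in W^{1,2}_{\mathrm{loc}}(X)$ be continuous and weakly subharmonic such that $\|\nabla f\|_{L^1}$ is finite. Then $f$ is a harmonic function.
   Context: Riemannian polyhedra. A polyhedron is a connected locally compact separable Hausdorff space $X$ homeomorphic, via some $\theta:|K|\to X$, to the space $|K|$ of a countable, locally finite simplicial complex $K$ of finite dimension; $(K,\theta)$ is a triangulation. $|K|$ carries the barycentric distance $\rho(\alpha,\beta)=(\sum_v(\alpha(v)-\beta(v))^2)^{1/2}$ and is affinely Lipschitz-homeomorphically embedded as a closed subset of a Euclidean space. $X$ is a Lipschitz polyhedron if it is a metric space and $\theta$ is a Lipschitz homeomorphism. A Riemannian polyhedron is a Lipschitz polyhedron $X$ such that, for some triangulation, each maximal simplex $s$ (viewed in the Euclidean space) carries a measurable Riemannian metric $g^s=g_{ij}dx^idx^j$ with $\Lambda^{-2}\|\xi\|^2\le g_{ij}(x)\xi^i\xi^j\le\Lambda^2\|\xi\|^2$ for a.e. $x\in s$, with $\Lambda$ independent of $s$. $d_X=d_X^g$ is the associated intrinsic distance: $d_X^g(x,y)$ is the supremum, over null sets $Z$, of the infimum of $g$-lengths of Lipschitz paths from $x$ to $y$ meeting $Z$ only on a parameter set of measure zero. Complete means $(X,d_X^g)$ is complete. The volume measure $\mu_g$ is given simplexwise by $d\mu_g=\sqrt{\det(g_{ij})}\,dx_1\cdots dx_n$. $X^{k}$ denotes the $k$-skeleton. Admissible: in some (hence any)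 triangulation, all maximal simplexes have the same dimension $n=\dim X$, and for every connected open $U\subset X$ the set $U\setminus X^{n-2}$ is connected. $\partial X$ is the union of all non-maximal simplexes contained in only one maximal simplex; it is always assumed that $\partial X=\emptyset$. An $n$-circuit is a polyhedron of homogeneous dimension $n$ such that every $(n-1)$-simplex is a face of at most two $n$-simplexes (exactly two if $\partial X=\emptyset$) and $X\setminus X^{n-2}$ is connected. A pseudomanifold is an admissible circuit. Sobolev spaces. $W^{1,2}(X)$ is the completion of the space of Lipschitz functions $u:(X,d_X)\to\mathbb R$ with finite norm $\|u\|_{1,2}^2=\int_X(u^2+|\nabla u|^2)\,d\mu_g$, where $\nabla u$ is the Riemannian gradient, defined a.e. on each $n$-simplex. $\mathrm{Lip}_c(X)$: Lipschitz functions with compact support. $W^{1,2}_{\mathrm{loc}}(X)$: all $u\in L^2_{\mathrm{loc}}(X)$ with $u\in W^{1,2}(U)$ for all relatively compact subdomains $U\subset X$. $\|\nabla f\|_{L^1}=\int_X|\nabla f|\,d\mu_g$. $f\in W^{1,2}_{\mathrm{loc}}(X)$ is weakly subharmonic if $\int_X\langle\nabla f,\nabla\rho\rangle\,d\mu_g\le 0$ for every non-negative $\rho\in\mathrm{Lip}_c(X)$, and weakly harmonic if $\int_X\langle\nabla f,\nabla\rho\rangle\,d\mu_g=0$ for every $\rho\in\mathrm{Lip}_c(X)$. A harmonic function is a continuous weakly harmonic function. *)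

theory Defs
  imports "HOL-Analysis.Analysis"
begin

section \<open>Simplicial complexes and their realization\<close>

text \<open>The library's \<open>simplicial_complex\<close> is finite and geometric; an abstract, countable, locally
  finite, finite-dimensional complex is needed here.\<close>

definition abstract_complex :: "'v set set \<Rightarrow> bool" where
  "abstract_complex K \<longleftrightarrow>
     countable K \<and>
     (\<forall>s\<in>K. finite s \<and> s \<noteq> {}) \<and>
     (\<forall>s\<in>K. \<forall>t. t \<subseteq> s \<and> t \<noteq> {} \<longrightarrow> t \<in> K) \<and>
     (\<forall>v. finite {s\<in>K. v \<in> s}) \<and>
     (\<exists>d. \<forall>s\<in>K. card s \<le> d)"

definition support :: "('v \<Rightarrow> real) \<Rightarrow> 'v set" where
  "support \<alpha> = {v. \<alpha> v \<noteq> 0}"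

definition realization :: "'v set set \<Rightarrow> ('v \<Rightarrow> real) set" where
  "realization K = {\<alpha>. (\<forall>v. 0 \<le> \<alpha> v) \<and> support \<alpha> \<in> K \<and> sum \<alpha> (support \<alpha>) = 1}"

definition bary_dist :: "('v \<Rightarrow> real) \<Rightarrow> ('v \<Rightarrow> real) \<Rightarrow> real" where
  "bary_dist \<alpha> \<beta> = sqrt (\<Sum>v\<in>support \<alpha> \<union> support \<beta>. (\<alpha> v - \<beta> v)\<^sup>2)"

text \<open>Lipschitz homeomorphisms are understood locally: each point has a neighbourhood with a
  Lipschitz constant. The bounded distance \<open>bary_dist\<close> on an infinite complex could
  not be globally bi-Lipschitz equivalent to a closed subset of a Euclidean space.\<close>

definition locally_lipschitz ::
  "'a set \<Rightarrow> ('a \<Rightarrow> 'a \<Rightarrow> real) \<Rightarrow> ('b \<Rightarrow> 'b \<Rightarrow> real) \<Rightarrow> ('a \<Rightarrow> 'b) \<Rightarrow> bool" where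
  "locally_lipschitz S d d' h \<longleftrightarrow>
     (\<forall>x\<in>S. \<exists>r>0. \<exists>C. \<forall>y\<in>S. \<forall>z\<in>S. d x y < r \<and> d x z < r \<longrightarrow> d' (h y) (h z) \<le> C * d y z)"

definition lipschitz_homeo ::
  "'a set \<Rightarrow> ('a \<Rightarrow> 'a \<Rightarrow> real) \<Rightarrow> 'b set \<Rightarrow> ('b \<Rightarrow> 'b \<Rightarrow> real) \<Rightarrow> ('a \<Rightarrow> 'b) \<Rightarrow> bool" where
  "lipschitz_homeo S d T d' h \<longleftrightarrow>
     bij_betw h S T \<and> locally_lipschitz S d d' h \<and> locally_lipschitz T d' d (inv_into S h)"


section \<open>Riemannian polyhedra\<close>

text \<open>The underlying space \<open>X\<close> is the type \<open>'x\<close>, and \<open>n\<close> is \<open>CARD('n)\<close>. The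
  components are the abstract complex \<open>K\<close>, the homeomorphism \<open>\<theta>\<close> from its realization
  to \<open>X\<close>, the images in the Euclidean space \<open>'e\<close> of the vertices (these determine the
  affine embedding of the realization), Euclidean coordinates on the affine hull of each
  embedded maximal simplex, and the matrix \<open>g_ij\<close> of the Riemannian metric of each maximal
  simplex in these coordinates.\<close>

record ('v, 'x, 'e, 'n::finite) triangulated =
  simplexes :: "'v set set"
  theta :: "('v \<Rightarrow> real) \<Rightarrow> 'x"
  position :: "'v \<Rightarrow> 'e"
  chart :: "'v set \<Rightarrow> real^'n \<Rightarrow> 'e"
  metric_coeff :: "'v set \<Rightarrow> real^'n \<Rightarrow> real^'n^'n"

definition embedding ::
  "('v, 'x, 'e::euclidean_space, 'n::finite) triangulated \<Rightarrow> ('v \<Rightarrow> real) \<Rightarrow> 'e" where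
  "embedding P \<alpha> = (\<Sum>v\<in>support \<alpha>. \<alpha> v *\<^sub>R position P v)"

definition lipschitz_polyhedron ::
  "('v, 'x::metric_space, 'e::euclidean_space, 'n::finite) triangulated \<Rightarrow> bool" where
  "lipschitz_polyhedron P \<longleftrightarrow>
     connected (UNIV :: 'x set) \<and>
     locally compact (UNIV :: 'x set) \<and>
     separable_space (euclidean :: 'x topology) \<and>
     abstract_complex (simplexes P) \<and>
     lipschitz_homeo (realization (simplexes P)) bary_dist (UNIV :: 'x set) dist (theta P) \<and>
     closed (embedding P ` realization (simplexes P)) \<and>
     lipschitz_homeo (realization (simplexes P)) bary_dist
       (embedding P ` realization (simplexes P)) dist (embedding P)"

definition maximal_simplexes :: "('v, 'x, 'e, 'n::finite) triangulated \<Rightarrow> 'v set set" where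
  "maximal_simplexes P = {s \<in> simplexes P. \<forall>t\<in>simplexes P. \<not> s \<subset> t}"

definition closed_simplex :: "('v, 'x, 'e, 'n::finite) triangulated \<Rightarrow> 'v set \<Rightarrow> 'x set" where
  "closed_simplex P s = theta P ` {\<alpha> \<in> realization (simplexes P). support \<alpha> \<subseteq> s}"

text \<open>The part of the coordinate space \<open>real^'n\<close> occupied by the embedded simplex.\<close>

definition chart_domain ::
  "('v, 'x, 'e::euclidean_space, 'n::finite) triangulated \<Rightarrow> 'v set \<Rightarrow> (real^'n) set" where
  "chart_domain P s = chart P s -` (convex hull (position P ` s))"

text \<open>An isometry of \<open>real^'n\<close> onto the affine hull of a simplex exists only if the simplex
  has dimension \<open>n\<close>, so this definition is meant for homogeneous polyhedra.\<close>

definition riemannian_polyhedron ::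
  "('v, 'x::metric_space, 'e::euclidean_space, 'n::finite) triangulated \<Rightarrow> bool" where
  "riemannian_polyhedron P \<longleftrightarrow>
     lipschitz_polyhedron P \<and>
     (\<forall>s\<in>maximal_simplexes P.
        (\<forall>x y. dist (chart P s x) (chart P s y) = dist x y) \<and>
        range (chart P s) = affine hull (position P ` s) \<and>
        metric_coeff P s \<in> borel_measurable (lebesgue_on (chart_domain P s)) \<and>
        (AE x in lebesgue_on (chart_domain P s).
           transpose (metric_coeff P s x) = metric_coeff P s x)) \<and>
     (\<exists>\<Lambda>>0. \<forall>s\<in>maximal_simplexes P. AE x in lebesgue_on (chart_domain P s).
        \<forall>\<xi>. (norm \<xi>)\<^sup>2 / \<Lambda>\<^sup>2 \<le> \<xi> \<bullet> (metric_coeff P s x *v \<xi>) \<and>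
             \<xi> \<bullet> (metric_coeff P s x *v \<xi>) \<le> \<Lambda>\<^sup>2 * (norm \<xi>)\<^sup>2)"

text \<open>\<open>from_coord P s\<close> maps \<open>chart_domain P s\<close> onto the closed simplex \<open>s\<close> of \<open>X\<close>, and
  \<open>to_coord P s\<close> is its inverse there.\<close>

definition from_coord ::
  "('v, 'x, 'e::euclidean_space, 'n::finite) triangulated \<Rightarrow> 'v set \<Rightarrow> real^'n \<Rightarrow> 'x" where
  "from_coord P s x =
     theta P (inv_into (realization (simplexes P)) (embedding P) (chart P s x))"

definition to_coord ::
  "('v, 'x, 'e::euclidean_space, 'n::finite) triangulated \<Rightarrow> 'v set \<Rightarrow> 'x \<Rightarrow> real^'n" where
  "to_coord P s p =
     inv (chart P s) (embedding P (inv_into (realization (simplexes P)) (theta P) p))"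

text \<open>The unique simplex whose open simplex contains \<open>p\<close>.\<close>

definition carrier_simplex :: "('v, 'x, 'e, 'n::finite) triangulated \<Rightarrow> 'x \<Rightarrow> 'v set" where
  "carrier_simplex P p = support (inv_into (realization (simplexes P)) (theta P) p)"

text \<open>Only meaningful if \<open>p\<close> lies in an open maximal simplex, i.e. off a null set.\<close>

definition metric_at ::
  "('v, 'x, 'e::euclidean_space, 'n::finite) triangulated \<Rightarrow> 'x \<Rightarrow> real^'n^'n" where
  "metric_at P p = metric_coeff P (carrier_simplex P p) (to_coord P (carrier_simplex P p) p)"

definition g_inner ::
  "('v, 'x, 'e::euclidean_space, 'n::finite) triangulated \<Rightarrow> 'x \<Rightarrow> real^'n \<Rightarrow> real^'n \<Rightarrow> real" where
  "g_inner P p \<xi> \<eta> = \<xi> \<bullet> (metric_at P p *v \<eta>)"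

definition g_norm ::
  "('v, 'x, 'e::euclidean_space, 'n::finite) triangulated \<Rightarrow> 'x \<Rightarrow> real^'n \<Rightarrow> real" where
  "g_norm P p \<xi> = sqrt (g_inner P p \<xi> \<xi>)"

definition volume ::
  "('v, 'x, 'e::euclidean_space, 'n::finite) triangulated \<Rightarrow> 'x measure" where
  "volume P = measure_of UNIV
     {A. \<forall>s\<in>maximal_simplexes P. from_coord P s -` A \<inter> chart_domain P s
           \<in> sets (lebesgue_on (chart_domain P s))}
     (\<lambda>A. \<integral>\<^sup>+s. emeasure (density (lebesgue_on (chart_domain P s))
                        (\<lambda>x. ennreal (sqrt (det (metric_coeff P s x)))))
                   (from_coord P s -` A \<inter> chart_domain P s)
          \<partial>count_space (maximal_simplexes P))"

lemma volume_measure_space: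
  fixes P :: "('v, 'x, 'e::euclidean_space, 'n::finite) triangulated"
  defines "\<M> \<equiv> {A. \<forall>s\<in>maximal_simplexes P. from_coord P s -` A \<inter> chart_domain P s
                    \<in> sets (lebesgue_on (chart_domain P s))}"
  defines "\<mu> \<equiv> \<lambda>A. \<integral>\<^sup>+s. emeasure (density (lebesgue_on (chart_domain P s))
                        (\<lambda>x. ennreal (sqrt (det (metric_coeff P s x)))))
                   (from_coord P s -` A \<inter> chart_domain P s)
          \<partial>count_space (maximal_simplexes P)"
  shows sets_volume: "sets (volume P) = \<M>"
    and emeasure_volume: "A \<in> \<M> \<Longrightarrow> emeasure (volume P) A = \<mu> A"
proof -
  let ?L = "\<lambda>s. lebesgue_on (chart_domain P s)"
  let ?D = "\<lambda>s. density (?L s) (\<lambda>x. ennreal (sqrt (det (metric_coeff P s x))))"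
  have sa: "sigma_algebra UNIV \<M>"
  proof (subst sigma_algebra_iff2, intro conjI ballI allI impI)
    show "\<M> \<subseteq> Pow UNIV" by simp
    show "{} \<in> \<M>" by (simp add: \<M>_def)
  next
    fix A assume "A \<in> \<M>"
    have "from_coord P s -` (UNIV - A) \<inter> chart_domain P s
            = space (?L s) - (from_coord P s -` A \<inter> chart_domain P s)" for s
      by (auto simp: space_restrict_space)
    then show "UNIV - A \<in> \<M>"
      using \<open>A \<in> \<M>\<close> unfolding \<M>_def by (auto intro!: sets.compl_sets simp del: space_lebesgue_on)
  next
    fix A :: "nat \<Rightarrow> 'x set" assume "range A \<subseteq> \<M>"
    then have A: "from_coord P s -` A i \<inter> chart_domain P s \<in> sets (?L s)"
      if "s \<in> maximal_simplexes P" for s i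
      using that unfolding \<M>_def by blast
    have "from_coord P s -` (\<Union>i. A i) \<inter> chart_domain P s
            = (\<Union>i. from_coord P s -` A i \<inter> chart_domain P s)" for s
      by auto
    then show "(\<Union>i. A i) \<in> \<M>"
      unfolding \<M>_def using A by (simp only: mem_Collect_eq) (blast intro: sets.countable_UN)
  qed
  then interpret sigma_algebra UNIV \<M> .
  have ca: "countably_additive \<M> \<mu>"
    unfolding countably_additive_def
  proof (intro allI impI)
    fix A :: "nat \<Rightarrow> 'x set"
    assume A: "range A \<subseteq> \<M>" "disjoint_family A"
    have "(\<Sum>i. emeasure (?D s) (from_coord P s -` A i \<inter> chart_domain P s))
            = emeasure (?D s) (from_coord P s -` (\<Union>i. A i) \<inter> chart_domain P s)"
      if "s \<in> maximal_simplexes P" for s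
    proof -
      have "(\<Sum>i. emeasure (?D s) (from_coord P s -` A i \<inter> chart_domain P s))
              = emeasure (?D s) (\<Union>i. from_coord P s -` A i \<inter> chart_domain P s)"
      proof (rule suminf_emeasure)
        show "range (\<lambda>i. from_coord P s -` A i \<inter> chart_domain P s) \<subseteq> sets (?D s)"
          using A(1) that unfolding \<M>_def by auto
        show "disjoint_family (\<lambda>i. from_coord P s -` A i \<inter> chart_domain P s)"
          using A(2) unfolding disjoint_family_on_def by blast
      qed
      then show ?thesis by (simp add: vimage_UN)
    qed
    then show "(\<Sum>i. \<mu> (A i)) = \<mu> (\<Union>i. A i)"
      unfolding \<mu>_def by (subst nn_integral_suminf[symmetric]) (auto intro!: nn_integral_cong)
  qed
  have pos: "positive \<M> \<mu>"
    by (simp add: positive_def \<mu>_def)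
  have vol: "volume P = measure_of UNIV \<M> \<mu>"
    by (simp add: volume_def \<M>_def \<mu>_def)
  show "sets (volume P) = \<M>"
    by (simp add: vol sigma_sets_eq)
  show "emeasure (volume P) A = \<mu> A" if "A \<in> \<M>"
    unfolding vol by (rule emeasure_measure_of_sigma[OF sa pos ca that])
qed


section \<open>The intrinsic distance\<close>

definition g_length ::
  "('v, 'x, 'e::euclidean_space, 'n::finite) triangulated \<Rightarrow> (real \<Rightarrow> 'x) \<Rightarrow> ennreal" where
  "g_length P \<gamma> =
     (\<integral>\<^sup>+t\<in>{t\<in>{0..1}. carrier_simplex P (\<gamma> t) \<in> maximal_simplexes P}.
        ennreal (g_norm P (\<gamma> t)
          (vector_derivative (\<lambda>\<tau>. to_coord P (carrier_simplex P (\<gamma> t)) (\<gamma> \<tau>)) (at t)))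
      \<partial>lebesgue)"

definition transversal_paths :: "'x::metric_space set \<Rightarrow> 'x \<Rightarrow> 'x \<Rightarrow> (real \<Rightarrow> 'x) set" where
  "transversal_paths Z x y =
     {\<gamma>. (\<exists>C. C-lipschitz_on {0..1} \<gamma>) \<and> \<gamma> 0 = x \<and> \<gamma> 1 = y \<and> negligible {t\<in>{0..1}. \<gamma> t \<in> Z}}"

text \<open>The extended-valued distance is finite on a Riemannian polyhedron. As the
  supremum is monotone in the null set \<open>Z\<close>, only those \<open>Z\<close> matter that contain the
  lower-dimensional skeleton and the exceptional points of the measurable metric.\<close>

definition intrinsic_edist ::
  "('v, 'x::metric_space, 'e::euclidean_space, 'n::finite) triangulated \<Rightarrow> 'x \<Rightarrow> 'x \<Rightarrow> ennreal" where
  "intrinsic_edist P x y =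
     (SUP Z\<in>null_sets (volume P). INF \<gamma>\<in>transversal_paths Z x y. g_length P \<gamma>)"

definition intrinsic_dist ::
  "('v, 'x::metric_space, 'e::euclidean_space, 'n::finite) triangulated \<Rightarrow> 'x \<Rightarrow> 'x \<Rightarrow> real" where
  "intrinsic_dist P x y = enn2real (intrinsic_edist P x y)"

definition complete_polyhedron ::
  "('v, 'x::metric_space, 'e::euclidean_space, 'n::finite) triangulated \<Rightarrow> bool" where
  "complete_polyhedron P \<longleftrightarrow> Metric_space.mcomplete UNIV (intrinsic_dist P)"


section \<open>Pseudomanifolds\<close>

definition homogeneous :: "('v, 'x, 'e, 'n::finite) triangulated \<Rightarrow> bool" where
  "homogeneous P \<longleftrightarrow> (\<forall>s\<in>maximal_simplexes P. card s = CARD('n) + 1)"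

definition skeleton :: "('v, 'x, 'e, 'n::finite) triangulated \<Rightarrow> int \<Rightarrow> 'x set" where
  "skeleton P k = (\<Union>s\<in>{s\<in>simplexes P. int (card s) \<le> k + 1}. closed_simplex P s)"

definition boundary :: "('v, 'x, 'e, 'n::finite) triangulated \<Rightarrow> 'x set" where
  "boundary P =
     (\<Union>t\<in>{t\<in>simplexes P - maximal_simplexes P. \<exists>!s. s \<in> maximal_simplexes P \<and> t \<subseteq> s}.
        closed_simplex P t)"

definition admissible ::
  "('v, 'x::metric_space, 'e::euclidean_space, 'n::finite) triangulated \<Rightarrow> bool" where
  "admissible P \<longleftrightarrow>
     homogeneous P \<and>
     (\<forall>U. open U \<and> connected U \<longrightarrow> connected (U - skeleton P (int CARD('n) - 2)))"

definition circuit ::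
  "('v, 'x::metric_space, 'e::euclidean_space, 'n::finite) triangulated \<Rightarrow> bool" where
  "circuit P \<longleftrightarrow>
     homogeneous P \<and>
     (\<forall>t\<in>simplexes P. card t = CARD('n) \<longrightarrow>
        card {s\<in>simplexes P. card s = CARD('n) + 1 \<and> t \<subseteq> s} \<le> 2) \<and>
     connected (UNIV - skeleton P (int CARD('n) - 2))"

definition pseudomanifold ::
  "('v, 'x::metric_space, 'e::euclidean_space, 'n::finite) triangulated \<Rightarrow> bool" where
  "pseudomanifold P \<longleftrightarrow> admissible P \<and> circuit P"


section \<open>Sobolev functions\<close>

text \<open>Lipschitz functions on a subset of \<open>X\<close> with respect to the intrinsic distance.\<close>

definition lipschitz_fun ::
  "('v, 'x::metric_space, 'e::euclidean_space, 'n::finite) triangulated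
     \<Rightarrow> 'x set \<Rightarrow> ('x \<Rightarrow> real) \<Rightarrow> bool" where
  "lipschitz_fun P U u \<longleftrightarrow> (\<exists>C. \<forall>x\<in>U. \<forall>y\<in>U. \<bar>u x - u y\<bar> \<le> C * intrinsic_dist P x y)"

definition lipschitz_compact ::
  "('v, 'x::metric_space, 'e::euclidean_space, 'n::finite) triangulated \<Rightarrow> ('x \<Rightarrow> real) set" where
  "lipschitz_compact P = {u. lipschitz_fun P UNIV u \<and> compact (closure {x. u x \<noteq> 0})}"

text \<open>The gradient \<open>g^ij \<partial>_j u\<close> of a function in the coordinates of the maximal simplex
  containing \<open>p\<close>; for Lipschitz \<open>u\<close> the default value \<open>0\<close> occurs on a null set only.\<close>

definition gradient ::
  "('v, 'x, 'e::euclidean_space, 'n::finite) triangulated \<Rightarrow> ('x \<Rightarrow> real) \<Rightarrow> 'x \<Rightarrow> real^'n" where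
  "gradient P u p =
     (let s = carrier_simplex P p; w = (\<lambda>x. u (from_coord P s x)); x = to_coord P s p
      in if s \<in> maximal_simplexes P \<and> w differentiable (at x)
         then matrix_inv (metric_coeff P s x) *v (\<chi> i. frechet_derivative w (at x) (axis i 1))
         else 0)"

definition sobolev_norm_sq ::
  "('v, 'x, 'e::euclidean_space, 'n::finite) triangulated
     \<Rightarrow> 'x set \<Rightarrow> ('x \<Rightarrow> real) \<Rightarrow> ('x \<Rightarrow> real^'n) \<Rightarrow> ennreal" where
  "sobolev_norm_sq P U u G =
     (\<integral>\<^sup>+p\<in>U. ennreal ((u p)\<^sup>2 + (g_norm P p (G p))\<^sup>2) \<partial>volume P)"

text \<open>The completion of the Lipschitz functions on \<open>U\<close> of finite norm is realized concretely:
  its elements are the limits \<open>(f, G)\<close>, in square mean, of sequences \<open>(u_k, \<nabla>u_k)\<close>, and \<open>G\<close>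
  (unique up to null sets) is the gradient of \<open>f\<close>.\<close>

definition sobolev_gradient_on ::
  "('v, 'x::metric_space, 'e::euclidean_space, 'n::finite) triangulated
     \<Rightarrow> 'x set \<Rightarrow> ('x \<Rightarrow> real) \<Rightarrow> ('x \<Rightarrow> real^'n) \<Rightarrow> bool" where
  "sobolev_gradient_on P U f G \<longleftrightarrow>
     set_borel_measurable (volume P) U f \<and>
     set_borel_measurable (volume P) U G \<and>
     (\<exists>u :: nat \<Rightarrow> 'x \<Rightarrow> real.
        (\<forall>k. lipschitz_fun P U (u k) \<and> sobolev_norm_sq P U (u k) (gradient P (u k)) < \<infinity>) \<and>
        (\<lambda>k. sobolev_norm_sq P U (\<lambda>p. u k p - f p) (\<lambda>p. gradient P (u k) p - G p))
          \<longlonglongrightarrow> 0)"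

definition W12 ::
  "('v, 'x::metric_space, 'e::euclidean_space, 'n::finite) triangulated
     \<Rightarrow> 'x set \<Rightarrow> ('x \<Rightarrow> real) set" where
  "W12 P U = {f. \<exists>G. sobolev_gradient_on P U f G}"

definition relatively_compact_subdomain :: "'x::metric_space set \<Rightarrow> bool" where
  "relatively_compact_subdomain U \<longleftrightarrow> open U \<and> connected U \<and> compact (closure U)"

definition L2_loc ::
  "('v, 'x::metric_space, 'e::euclidean_space, 'n::finite) triangulated \<Rightarrow> ('x \<Rightarrow> real) set" where
  "L2_loc P = {f \<in> borel_measurable (volume P).
     \<forall>C. compact C \<longrightarrow> (\<integral>\<^sup>+p\<in>C. ennreal ((f p)\<^sup>2) \<partial>volume P) < \<infinity>}"

definition W12_loc ::
  "('v, 'x::metric_space, 'e::euclidean_space, 'n::finite) triangulated \<Rightarrow> ('x \<Rightarrow> real) set" where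
  "W12_loc P = {f \<in> L2_loc P. \<forall>U. relatively_compact_subdomain U \<longrightarrow> f \<in> W12 P U}"

text \<open>The gradients of \<open>f \<in> W12_loc P\<close> on the relatively compact subdomains agree almost
  everywhere on overlaps, hence come from one vector field, determined up to null sets.\<close>

definition sobolev_gradient ::
  "('v, 'x::metric_space, 'e::euclidean_space, 'n::finite) triangulated
     \<Rightarrow> ('x \<Rightarrow> real) \<Rightarrow> 'x \<Rightarrow> real^'n" where
  "sobolev_gradient P f =
     (SOME G. \<forall>U. relatively_compact_subdomain U \<longrightarrow> sobolev_gradient_on P U f G)"

definition grad_L1_norm ::
  "('v, 'x::metric_space, 'e::euclidean_space, 'n::finite) triangulated
     \<Rightarrow> ('x \<Rightarrow> real) \<Rightarrow> ennreal" where
  "grad_L1_norm P f = (\<integral>\<^sup>+p. ennreal (g_norm P p (sobolev_gradient P f p)) \<partial>volume P)"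

definition weakly_subharmonic ::
  "('v, 'x::metric_space, 'e::euclidean_space, 'n::finite) triangulated
     \<Rightarrow> ('x \<Rightarrow> real) \<Rightarrow> bool" where
  "weakly_subharmonic P f \<longleftrightarrow> f \<in> W12_loc P \<and>
     (\<forall>\<rho>\<in>lipschitz_compact P. (\<forall>p. 0 \<le> \<rho> p) \<longrightarrow>
        (\<integral>p. g_inner P p (sobolev_gradient P f p) (gradient P \<rho> p) \<partial>volume P) \<le> 0)"

definition weakly_harmonic ::
  "('v, 'x::metric_space, 'e::euclidean_space, 'n::finite) triangulated
     \<Rightarrow> ('x \<Rightarrow> real) \<Rightarrow> bool" where
  "weakly_harmonic P f \<longleftrightarrow> f \<in> W12_loc P \<and>
     (\<forall>\<rho>\<in>lipschitz_compact P.
        (\<integral>p. g_inner P p (sobolev_gradient P f p) (gradient P \<rho> p) \<partial>volume P) = 0)"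

definition harmonic ::
  "('v, 'x::metric_space, 'e::euclidean_space, 'n::finite) triangulated
     \<Rightarrow> ('x \<Rightarrow> real) \<Rightarrow> bool" where
  "harmonic P f \<longleftrightarrow> continuous_on UNIV f \<and> weakly_harmonic P f"

end

theory Submission
  imports Defs
begin

text \<open>The barycentric embedding \<open>emb\<close> of the polyhedron into Euclidean space is closed, and by
  ellipticity \<open>dist (emb x) (emb y) \<le> \<Lambda> * d x y\<close> for the intrinsic distance \<open>d\<close>. Hence
  truncating the Euclidean distance from a point gives compactly supported cutoff functions
  \<open>\<phi>\<^sub>r\<close> with Lipschitz constant \<open>\<Lambda> / r\<close> that exhaust the space. If a
  Lipschitz function \<open>\<rho>\<close> of compact support satisfies \<open>\<bar>\<rho>\<bar> \<le> M\<close>, then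
  \<open>M \<phi>\<^sub>r + \<rho> \<ge> 0\<close> for large \<open>r\<close>, so subharmonicity yields
  \<open>\<integral>\<langle>\<nabla>f, \<nabla>\<rho>\<rangle> \<le> - M \<integral>\<langle>\<nabla>f, \<nabla>\<phi>\<^sub>r\<rangle> = O(\<parallel>\<nabla>f\<parallel>\<^bsub>L1\<^esub> / r)\<close>. Letting \<open>r\<close> tend to infinity and
  replacing \<open>\<rho>\<close> by \<open>- \<rho>\<close> gives harmonicity. The pairing is linear in \<open>\<rho>\<close> by
  Rademacher's theorem, which also makes the weak gradient of \<open>f\<close> unique, so that the local
  gradients glue to a global one.\<close>

section \<open>Lipschitz functions of one real variable\<close>

text \<open>Two default values shape the argument. \<open>intrinsic_dist\<close> turns an infinite
  distance into 0, so a lower bound for it is worth something only once the distance between any two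
  points is known to be finite; this comes from chaining curves through simplexes and from
  connectedness. And \<open>sobolev_gradient\<close> is a choice, about which nothing is known, not
  even measurability, until one vector field is shown to serve all relatively compact subdomains at
  once. The metric is merely measurable, so curves have to avoid a prescribed null set. A segment
  with both ends fixed may lie inside that set, but by Fubini almost every choice of the second end
  gives a segment that meets it at almost no time. Two points of a simplex are therefore joined
  through a generic third point. This bounds the intrinsic distance within a simplex by a multiple
  of the Euclidean distance in coordinates; hence functions that are Lipschitz for it are Euclidean
  Lipschitz functions in every chart, and Rademacher's theorem applies to them.\<close>

lemma interval_measure_le_lborel:
  fixes F :: "real \<Rightarrow> real"
  assumes mono: "\<And>x y. x \<le> y \<Longrightarrow> F x \<le> F y"
    and lip: "\<And>x y. x \<le> y \<Longrightarrow> F y - F x \<le> K * (y - x)"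
    and cont: "continuous_on UNIV F"
    and A: "A \<in> sets borel"
  shows "emeasure (interval_measure F) (A \<inter> {a<..b}) \<le> K * emeasure lborel (A \<inter> {a<..b})"
proof -
  have K: "K \<ge> 0" using mono[of 0 1] lip[of 0 1] by simp
  \<comment> \<open>The complementary function is monotone as well. Its Stieltjes measure is
    positive and adds up with that of \<open>F\<close> to \<open>K\<close> times Lebesgue measure,
    which gives the inequality.\<close>
  define G where "G = (\<lambda>x. K * x - F x)"
  have monoG: "\<And>x y. x \<le> y \<Longrightarrow> G x \<le> G y"
    using lip by (force simp: G_def algebra_simps)
  have contG: "continuous_on UNIV G" unfolding G_def by (intro continuous_intros cont)
  have rF: "\<And>a. continuous (at_right a) F" and rG: "\<And>a. continuous (at_right a) G"
    using cont contG by (auto simp: continuous_on_eq_continuous_within intro: continuous_within_subset)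
  let ?MF = "interval_measure F" and ?MG = "interval_measure G"
  have Ioc: "emeasure ?MF {c<..d} + emeasure ?MG {c<..d} = ennreal K * emeasure lborel {c<..d}"
    if "c \<le> d" for c d
  proof -
    have "emeasure ?MF {c<..d} + emeasure ?MG {c<..d} = ennreal (F d - F c) + ennreal (G d - G c)"
      using that emeasure_interval_measure_Ioc[OF that mono rF] emeasure_interval_measure_Ioc[OF that monoG rG] by simp
    also have "\<dots> = ennreal (K * (d - c))"
      using mono[OF that] monoG[OF that] by (simp add: G_def ennreal_plus[symmetric] algebra_simps del: ennreal_plus)
    finally show ?thesis using that K by (simp add: ennreal_mult)
  qed
  let ?I = "{a<..b}"
  have finF: "emeasure ?MF (B \<inter> ?I) \<noteq> \<infinity>" and finG: "emeasure ?MG (B \<inter> ?I) \<noteq> \<infinity>"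
    and finL: "emeasure lborel (B \<inter> ?I) \<noteq> \<infinity>" for B
  proof -
    have "emeasure ?MF (B \<inter> ?I) \<le> emeasure ?MF ?I" by (intro emeasure_mono) auto
    also have "\<dots> < \<infinity>" by (auto simp: emeasure_interval_measure_Ioc_eq[OF mono rF])
    finally show "emeasure ?MF (B \<inter> ?I) \<noteq> \<infinity>" by simp
    have "emeasure ?MG (B \<inter> ?I) \<le> emeasure ?MG ?I" by (intro emeasure_mono) auto
    also have "\<dots> < \<infinity>" by (auto simp: emeasure_interval_measure_Ioc_eq[OF monoG rG])
    finally show "emeasure ?MG (B \<inter> ?I) \<noteq> \<infinity>" by simp
    have "emeasure lborel (B \<inter> ?I) \<le> emeasure lborel ?I" by (intro emeasure_mono) auto
    also have "\<dots> < \<infinity>" by (cases "a \<le> b") auto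
    finally show "emeasure lborel (B \<inter> ?I) \<noteq> \<infinity>" by simp
  qed
  \<comment> \<open>Checked on half-open intervals and extended to Borel sets by a Dynkin argument.
    Intersecting with \<open>?I\<close> keeps all three measures finite, so that complements can be
    handled by subtraction.\<close>
  have "emeasure ?MF (A \<inter> ?I) + emeasure ?MG (A \<inter> ?I) = K * emeasure lborel (A \<inter> ?I)"
  proof (cases "a \<le> b")
    case False then show ?thesis by simp
  next
    case ab: True
    let ?E = "range (\<lambda>(c, d). {c<..d::real})"
    have "A \<in> sigma_sets UNIV ?E"
      using A by (simp add: borel_sigma_sets_Ioc)
    have st: "Int_stable ?E" by (auto simp: Int_stable_def)
    have cl: "?E \<subseteq> Pow UNIV" by simp
    from st cl \<open>A \<in> sigma_sets UNIV ?E\<close> show ?thesis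
    proof (induction rule: sigma_sets_induct_disjoint)
      case (basic B)
      then obtain c d where B: "B = {c<..d}" by auto
      then have BI: "B \<inter> ?I = {max a c<..min b d}" by auto
      show ?case
      proof (cases "max a c \<le> min b d")
        case True then show ?thesis unfolding BI by (rule Ioc)
      next
        case False then have "B \<inter> ?I = {}" unfolding BI by auto
        then show ?thesis by simp
      qed
    next
      case empty then show ?case by simp
    next
      case (compl B)
      then have B: "B \<in> sets borel" by (simp add: borel_sigma_sets_Ioc)
      have eq: "(UNIV - B) \<inter> ?I = ?I - (B \<inter> ?I)" by auto
      have 1: "emeasure ?MF ((UNIV - B) \<inter> ?I) = emeasure ?MF ?I - emeasure ?MF (B \<inter> ?I)"
        unfolding eq using B finF[of B] by (intro emeasure_Diff) auto
      have 2: "emeasure ?MG ((UNIV - B) \<inter> ?I) = emeasure ?MG ?I - emeasure ?MG (B \<inter> ?I)"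
        unfolding eq using B finG[of B] by (intro emeasure_Diff) auto
      have 3: "emeasure lborel ((UNIV - B) \<inter> ?I) = emeasure lborel ?I - emeasure lborel (B \<inter> ?I)"
        unfolding eq using B finL[of B] by (intro emeasure_Diff) auto
      have l1: "emeasure ?MF (B \<inter> ?I) \<le> emeasure ?MF ?I" by (intro emeasure_mono) auto
      have l2: "emeasure ?MG (B \<inter> ?I) \<le> emeasure ?MG ?I" by (intro emeasure_mono) auto
      have l3: "emeasure lborel (B \<inter> ?I) \<le> emeasure lborel ?I" by (intro emeasure_mono) auto
      obtain f1 where f1: "f1 \<ge> 0" "emeasure ?MF (B \<inter> ?I) = ennreal f1" using finF[of B] by (cases "emeasure ?MF (B \<inter> ?I)") auto
      obtain f2 where f2: "f2 \<ge> 0" "emeasure ?MF ?I = ennreal f2" using finF[of UNIV] by (cases "emeasure ?MF ?I") auto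
      obtain g1 where g1: "g1 \<ge> 0" "emeasure ?MG (B \<inter> ?I) = ennreal g1" using finG[of B] by (cases "emeasure ?MG (B \<inter> ?I)") auto
      obtain g2 where g2: "g2 \<ge> 0" "emeasure ?MG ?I = ennreal g2" using finG[of UNIV] by (cases "emeasure ?MG ?I") auto
      obtain h1 where h1: "h1 \<ge> 0" "emeasure lborel (B \<inter> ?I) = ennreal h1" using finL[of B] by (cases "emeasure lborel (B \<inter> ?I)") auto
      obtain h2 where h2: "h2 \<ge> 0" "emeasure lborel ?I = ennreal h2" using finL[of UNIV] by (cases "emeasure lborel ?I") auto
      have "f1 + g1 = K * h1"
        using compl.IH f1 g1 h1 K by (simp add: ennreal_plus[symmetric] ennreal_mult[symmetric] del: ennreal_plus)
      moreover have "f2 + g2 = K * h2"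
        using Ioc[OF ab] f2 g2 h2 K by (simp add: ennreal_plus[symmetric] ennreal_mult[symmetric] del: ennreal_plus)
      moreover have "f1 \<le> f2" "g1 \<le> g2" "h1 \<le> h2" using l1 l2 l3 f1 f2 g1 g2 h1 h2 by (auto simp: ennreal_le_iff)
      ultimately show ?case unfolding 1 2 3 f1 f2 g1 g2 h1 h2 using K f1 g1 h1
        by (simp add: ennreal_minus ennreal_plus[symmetric] ennreal_mult[symmetric] algebra_simps del: ennreal_plus)
    next
      case (union B)
      then have B: "\<And>i. B i \<in> sets borel" by (auto simp: borel_sigma_sets_Ioc)
      have dj: "disjoint_family (\<lambda>i. B i \<inter> ?I)"
        using union(1) by (auto simp: disjoint_family_on_def)
      have eq: "(\<Union> (range B)) \<inter> ?I = (\<Union>i. B i \<inter> ?I)" by auto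
      have 1: "emeasure ?MF (\<Union> (range B) \<inter> ?I) = (\<Sum>i. emeasure ?MF (B i \<inter> ?I))"
        unfolding eq using B dj by (intro suminf_emeasure[symmetric]) auto
      have 2: "emeasure ?MG (\<Union> (range B) \<inter> ?I) = (\<Sum>i. emeasure ?MG (B i \<inter> ?I))"
        unfolding eq using B dj by (intro suminf_emeasure[symmetric]) auto
      have 3: "emeasure lborel (\<Union> (range B) \<inter> ?I) = (\<Sum>i. emeasure lborel (B i \<inter> ?I))"
        unfolding eq using B dj by (intro suminf_emeasure[symmetric]) auto
      show ?case unfolding 1 2 3 using union(3)
        by (simp add: suminf_add[OF summableI summableI] ennreal_suminf_cmult)
    qed
  qed
  then show ?thesis by (metis le_iff_add)
qed

text \<open>Adding \<open>L * x\<close> makes \<open>f\<close> monotone. The Stieltjes measure of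
  the sum is absolutely continuous, and its Radon-Nikodym density, diminished by \<open>L\<close>,
  is the required function.\<close>

lemma lipschitz_real_density:
  fixes f :: "real \<Rightarrow> real"
  assumes "L-lipschitz_on UNIV f"
  obtains g where "g \<in> borel_measurable borel" "\<And>a b. a \<le> b \<Longrightarrow> (g has_integral (f b - f a)) {a..b}"
proof -
  have L: "L \<ge> 0" using assms lipschitz_on_nonneg by blast
  have lip: "\<bar>f x - f y\<bar> \<le> L * \<bar>x - y\<bar>" for x y
    using lipschitz_onD[OF assms, of x y] by (simp add: dist_real_def)
  define F where "F = (\<lambda>x. f x + L * x)"
  have mono: "\<And>x y. x \<le> y \<Longrightarrow> F x \<le> F y"
  proof -
    fix x y :: real assume "x \<le> y"
    then have e: "\<bar>x - y\<bar> = y - x" by simp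
    have "f x - f y \<le> L * (y - x)" using lip[of x y] unfolding e by linarith
    then show "F x \<le> F y" by (simp add: F_def algebra_simps)
  qed
  have lipF: "\<And>x y. x \<le> y \<Longrightarrow> F y - F x \<le> (2 * L) * (y - x)"
  proof -
    fix x y :: real assume "x \<le> y"
    then have e: "\<bar>y - x\<bar> = y - x" by simp
    have "f y - f x \<le> L * (y - x)" using lip[of y x] unfolding e by linarith
    then show "F y - F x \<le> (2 * L) * (y - x)" by (simp add: F_def algebra_simps)
  qed
  have cont: "continuous_on UNIV F"
    unfolding F_def by (intro continuous_intros lipschitz_on_continuous_on[OF assms])
  let ?M = "interval_measure F"
  have ac: "absolutely_continuous lborel ?M"
    unfolding absolutely_continuous_def
  proof
    fix A :: "real set" assume A: "A \<in> null_sets lborel"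
    then have Ab: "A \<in> sets borel" by auto
    have "A \<inter> {- real n<..real n} \<in> null_sets ?M" for n :: nat
    proof -
      have "emeasure lborel (A \<inter> {- real n<..real n}) = 0"
        using A by (intro null_setsD1 null_set_Int2) auto
      then have "emeasure ?M (A \<inter> {- real n<..real n}) \<le> 0"
        using interval_measure_le_lborel[OF mono lipF cont Ab, of "- real n" "real n"] by simp
      then show ?thesis using Ab by (auto simp: null_sets_def)
    qed
    then have "(\<Union>n::nat. A \<inter> {- real n<..real n}) \<in> null_sets ?M" by blast
    moreover have "(\<Union>n::nat. A \<inter> {- real n<..real n}) = A"
    proof -
      have "\<exists>n::nat. - real n < x \<and> x \<le> real n" for x
      proof -
        obtain n :: nat where "\<bar>x\<bar> < real n" using reals_Archimedean2 by blast
        then show ?thesis by (intro exI[of _ n]) auto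
      qed
      then show ?thesis by auto
    qed
    ultimately show "A \<in> null_sets ?M" by simp
  qed
  obtain g0 where g0: "g0 \<in> borel_measurable lborel" "density lborel g0 = ?M"
    using sigma_finite_measure.Radon_Nikodym[OF sigma_finite_lborel ac] by auto
  define g where "g = (\<lambda>x. enn2real (g0 x) - L)"
  have "g \<in> borel_measurable borel" using g0(1) by (simp add: g_def)
  moreover have "(g has_integral (f b - f a)) {a..b}" if ab: "a \<le> b" for a b
  proof -
    have rF: "continuous_on {a..b} F" using cont continuous_on_subset by blast
    have rr: "\<And>a. continuous (at_right a) F"
      using cont by (auto simp: continuous_on_eq_continuous_within intro: continuous_within_subset)
    have 1: "(\<integral>\<^sup>+x. g0 x * indicator {a..b} x \<partial>lborel) = ennreal (F b - F a)"
    proof -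
      have "(\<integral>\<^sup>+x. g0 x * indicator {a..b} x \<partial>lborel) = emeasure (density lborel g0) {a..b}"
        using g0(1) by (subst emeasure_density) auto
      also have "\<dots> = ennreal (F b - F a)"
        unfolding g0(2) by (rule emeasure_interval_measure_Icc[OF ab mono]) (use cont in auto)
      finally show ?thesis .
    qed
    \<comment> \<open>The density may take the value infinity, which \<open>enn2real\<close> would
      turn into 0; finiteness of the integral confines this to a null set.\<close>
    have "AE x in lborel. g0 x * indicator {a..b} x \<noteq> \<infinity>"
      using 1 g0(1) by (intro nn_integral_PInf_AE) auto
    then have ae: "AE x in lborel. ennreal (enn2real (g0 x) * indicator {a..b} x) = g0 x * indicator {a..b} x"
      by eventually_elim (auto simp: indicator_def less_top)
    have 2: "(\<integral>\<^sup>+x. ennreal (enn2real (g0 x) * indicator {a..b} x) \<partial>lborel) = ennreal (F b - F a)"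
      using nn_integral_cong_AE[OF ae] 1 by simp
    have "((\<lambda>x. enn2real (g0 x) * indicator {a..b} x) has_integral (F b - F a)) UNIV"
      using g0(1) 2 mono[OF ab] by (intro nn_integral_has_integral) auto
    then have "((\<lambda>x. enn2real (g0 x)) has_integral (F b - F a)) {a..b}"
      by (simp add: has_integral_restrict_UNIV[symmetric, where s="{a..b}"] indicator_def of_bool_def if_distrib cong: if_cong)
    moreover have "((\<lambda>x. L) has_integral (L * (b - a))) {a..b}"
      using has_integral_const_real[of L a b] ab by (simp add: mult.commute)
    ultimately have "((\<lambda>x. enn2real (g0 x) - L) has_integral (F b - F a - L * (b - a))) {a..b}"
      by (rule has_integral_diff)
    then show ?thesis by (simp add: g_def F_def algebra_simps)
  qed
  ultimately show ?thesis using that by blast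
qed

text \<open>The differentiation theorem for cubes controls averages over \<open>{x..x + h}\<close>
  with \<open>h > 0\<close> and so yields the right derivative only. Applied to the reflected
  density it yields the left derivative.\<close>

lemma lipschitz_real_AE_differentiable:
  fixes f :: "real \<Rightarrow> real"
  assumes "L-lipschitz_on UNIV f"
  obtains g where "g \<in> borel_measurable borel"
    "\<And>a b. a \<le> b \<Longrightarrow> (g has_integral (f b - f a)) {a..b}"
    "AE x in lborel. (f has_real_derivative g x) (at x)"
proof -
  obtain g where g: "g \<in> borel_measurable borel"
      "\<And>a b. a \<le> b \<Longrightarrow> (g has_integral (f b - f a)) {a..b}"
    using lipschitz_real_density[OF assms] by metis
  have int: "g integrable_on cbox a b" for a b
    using g(2)[of a b] by (cases "a \<le> b") auto
  have intr: "(\<lambda>x. g (- x)) integrable_on cbox a b" for a b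
    using int[of "-b" "-a"] integrable_reflect[of g "-a" "-b"] by simp
  obtain N1 where N1: "negligible N1" "\<And>x e. \<lbrakk>x \<notin> N1; 0 < e\<rbrakk> \<Longrightarrow>
        \<exists>d>0. \<forall>h. 0 < h \<and> h < d \<longrightarrow> norm (integral (cbox x (x + h *\<^sub>R One)) g /\<^sub>R h ^ DIM(real) - g x) < e"
    using integrable_ccontinuous_explicit[OF int] by metis
  obtain N2 where N2: "negligible N2" "\<And>x e. \<lbrakk>x \<notin> N2; 0 < e\<rbrakk> \<Longrightarrow>
        \<exists>d>0. \<forall>h. 0 < h \<and> h < d \<longrightarrow>
          norm (integral (cbox x (x + h *\<^sub>R One)) (\<lambda>x. g (- x)) /\<^sub>R h ^ DIM(real) - g (- x)) < e"
    using integrable_ccontinuous_explicit[OF intr] by metis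
  have N: "negligible (N1 \<union> uminus ` N2)"
    using N1(1) N2(1)
    by (intro negligible_Un negligible_differentiable_image_negligible) (auto intro!: derivative_intros)
  have "(f has_real_derivative g x) (at x)" if x: "x \<notin> N1 \<union> uminus ` N2" for x
    unfolding DERIV_def LIM_eq
  proof (intro allI impI)
    fix r :: real assume r: "r > 0"
    have "- x \<notin> N2" using x by (metis UnCI add.inverse_inverse image_eqI)
    from N2(2)[OF this r] obtain d2 where d2: "d2 > 0" "\<And>h. 0 < h \<Longrightarrow> h < d2 \<Longrightarrow>
        norm (integral {- x..- x + h} (\<lambda>x. g (- x)) / h - g x) < r"
      by (auto simp: divide_inverse mult.commute)
    from N1(2)[OF _ r, of x] x obtain d1 where d1: "d1 > 0" "\<And>h. 0 < h \<Longrightarrow> h < d1 \<Longrightarrow>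
        norm (integral {x..x + h} g / h - g x) < r"
      by (auto simp: divide_inverse mult.commute)
    have "norm ((f (x + h) - f x) / h - g x) < r" if h: "h \<noteq> 0" "\<bar>h\<bar> < min d1 d2" for h
    proof (cases "h > 0")
      case True
      then have "integral {x..x + h} g = f (x + h) - f x"
        using g(2)[of x "x + h"] by (simp add: integral_unique)
      then show ?thesis using d1(2)[of h] h True by simp
    next
      case False
      then have hn: "h < 0" using h by simp
      have "integral {- x..- x + (- h)} (\<lambda>x. g (- x)) = integral {x + h..x} g"
        using Henstock_Kurzweil_Integration.integral_reflect_real[of "x" "x + h" g] by (simp add: algebra_simps)
      also have "\<dots> = f x - f (x + h)"
        using g(2)[of "x + h" x] hn by (simp add: integral_unique)
      finally have e: "integral {- x..- x + (- h)} (\<lambda>x. g (- x)) / (- h) = (f (x + h) - f x) / h"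
        by (simp add: minus_divide_left[symmetric] minus_divide_right[symmetric] diff_divide_distrib)
      have "norm (integral {- x..- x + (- h)} (\<lambda>x. g (- x)) / (- h) - g x) < r"
        using d2(2)[of "- h"] h hn by simp
      then show ?thesis unfolding e .
    qed
    then show "\<exists>s>0. \<forall>h. h \<noteq> 0 \<and> norm (h - 0) < s \<longrightarrow> norm ((f (x + h) - f x) / h - g x) < r"
      using d1(1) d2(1) by (intro exI[of _ "min d1 d2"]) auto
  qed
  moreover have "AE x in lebesgue. x \<notin> N1 \<union> uminus ` N2"
    using N AE_not_in[of "N1 \<union> uminus ` N2" lebesgue] by (simp only: negligible_iff_null_sets)
  ultimately have "AE x in lebesgue. (f has_real_derivative g x) (at x)"
    by (auto elim: eventually_mono)
  then have "AE x in lborel. (f has_real_derivative g x) (at x)"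
    by (simp add: AE_completion_iff)
  with g that show ?thesis by blast
qed

section \<open>Rademacher's theorem\<close>

text \<open>McShane's extension: the infimum of the cones of slope \<open>L\<close> erected over the
  graph of \<open>f\<close>. It keeps the constant \<open>L\<close>.\<close>

lemma lipschitz_extension_real:
  fixes f :: "'a::metric_space \<Rightarrow> real"
  assumes f: "L-lipschitz_on S f"
  obtains F where "L-lipschitz_on UNIV F" "\<And>x. x \<in> S \<Longrightarrow> F x = f x"
proof (cases "S = {}")
  case True
  have "L-lipschitz_on UNIV (\<lambda>x. 0::real)"
    using lipschitz_on_nonneg[OF f] by (auto intro!: lipschitz_onI)
  with that True show ?thesis by blast
next
  case False
  have L: "L \<ge> 0" by (rule lipschitz_on_nonneg[OF f])
  define F where "F x = (INF y\<in>S. f y + L * dist x y)" for x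
  have lip: "f y \<le> f z + L * dist y z" if "y \<in> S" "z \<in> S" for y z
    using lipschitz_onD[OF f that] by (simp add: dist_real_def)
  have bdd: "bdd_below ((\<lambda>y. f y + L * dist x y) ` S)" for x
  proof -
    obtain z where z: "z \<in> S" using False by blast
    have "f z - L * dist x z \<le> f y + L * dist x y" if "y \<in> S" for y
    proof -
      have "f z \<le> f y + L * dist z y" by (rule lip[OF z that])
      also have "L * dist z y \<le> L * (dist x z + dist x y)"
        using L dist_triangle3[of z y x] by (intro mult_left_mono) (auto simp: dist_commute)
      finally show ?thesis by (simp add: algebra_simps)
    qed
    then show ?thesis by (intro bdd_belowI2[of _ "f z - L * dist x z"])
  qed
  have ext: "F x = f x" if "x \<in> S" for x
  proof (rule antisym)
    show "F x \<le> f x" unfolding F_def using cINF_lower[OF bdd that, of x] by simp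
    show "f x \<le> F x" unfolding F_def using lip[OF that] False by (intro cINF_greatest) auto
  qed
  have one: "F x \<le> F x' + L * dist x x'" for x x'
  proof -
    have "F x - L * dist x x' \<le> f y + L * dist x' y" if "y \<in> S" for y
    proof -
      have "F x \<le> f y + L * dist x y" unfolding F_def by (rule cINF_lower[OF bdd that])
      also have "L * dist x y \<le> L * (dist x x' + dist x' y)"
        using L dist_triangle[of x y x'] by (intro mult_left_mono) auto
      finally show ?thesis by (simp add: algebra_simps)
    qed
    then have "F x - L * dist x x' \<le> F x'" unfolding F_def[of x'] using False by (intro cINF_greatest) auto
    then show ?thesis by simp
  qed
  have "L-lipschitz_on UNIV F"
  proof (rule lipschitz_onI[OF _ L])
    fix x x' :: 'a
    show "dist (F x) (F x') \<le> L * dist x x'"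
      using one[of x x'] one[of x' x] by (auto simp: dist_real_def abs_le_iff dist_commute)
  qed
  with that ext show ?thesis by blast
qed

text \<open>By Tonelli and translation invariance, the measure of \<open>N\<close> is the integral over \<open>x\<close> of
  the measure of \<open>{t \<in> {0..1}. x + t v \<in> N}\<close>.\<close>

lemma null_set_if_null_on_lines:
  fixes N :: "'a::euclidean_space set"
  assumes N: "N \<in> sets borel" and lines: "\<And>x. AE t in lborel. x + t *\<^sub>R v \<notin> N"
  shows "N \<in> null_sets lborel"
proof -
  let ?f = "\<lambda>x t. indicator N (x + t *\<^sub>R v) * indicator {0..1::real} t :: ennreal"
  have meas: "case_prod ?f \<in> borel_measurable (lborel \<Otimes>\<^sub>M lborel)"
    using N by measurable
  have "(\<integral>\<^sup>+t. \<integral>\<^sup>+x. ?f x t \<partial>lborel \<partial>lborel) = (\<integral>\<^sup>+x. \<integral>\<^sup>+t. ?f x t \<partial>lborel \<partial>lborel)"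
    using lborel_pair.Fubini'[OF meas] by simp
  also have "\<dots> = (\<integral>\<^sup>+x. 0 \<partial>(lborel :: 'a measure))"
  proof (intro nn_integral_cong)
    fix x :: 'a
    have "AE t in lborel. ?f x t = 0" using lines[of x] by eventually_elim auto
    then have "(\<integral>\<^sup>+t. ?f x t \<partial>lborel) = (\<integral>\<^sup>+t. 0 \<partial>(lborel::real measure))" by (intro nn_integral_cong_AE)
    then show "(\<integral>\<^sup>+t. ?f x t \<partial>lborel) = 0" by simp
  qed
  finally have 0: "(\<integral>\<^sup>+t. \<integral>\<^sup>+x. ?f x t \<partial>lborel \<partial>lborel) = 0" by simp
  have "(\<integral>\<^sup>+x. ?f x t \<partial>lborel) = emeasure lborel N * indicator {0..1} t" for t
  proof -
    have "(\<integral>\<^sup>+x. ?f x t \<partial>lborel) = (\<integral>\<^sup>+x. indicator N (t *\<^sub>R v + x) \<partial>lborel) * indicator {0..1} t"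
      using N by (subst nn_integral_multc) (auto simp: add.commute)
    also have "(\<integral>\<^sup>+x. indicator N (t *\<^sub>R v + x) \<partial>lborel) = (\<integral>\<^sup>+x. indicator N x \<partial>distr lborel borel ((+) (t *\<^sub>R v)))"
      using N by (subst nn_integral_distr) auto
    also have "\<dots> = emeasure lborel N" using N by (subst lborel_distr_plus) simp
    finally show ?thesis .
  qed
  then have "emeasure lborel N = 0" using 0 N by (simp add: nn_integral_cmult_indicator)
  with N show ?thesis by auto
qed

text \<open>Fixing the increments \<open>1 / (n + 1)\<close> makes \<open>dir_deriv\<close> the
  limit of a sequence of Borel functions, hence Borel on the whole space. Where the directional
  derivative exists it is this limit; at other points the value carries no information.\<close>

definition dir_quot :: "('a::real_normed_vector \<Rightarrow> real) \<Rightarrow> 'a \<Rightarrow> nat \<Rightarrow> 'a \<Rightarrow> real" where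
  "dir_quot f v n x = (f (x + (1 / real (Suc n)) *\<^sub>R v) - f x) * real (Suc n)"

definition dir_deriv :: "('a::real_normed_vector \<Rightarrow> real) \<Rightarrow> 'a \<Rightarrow> 'a \<Rightarrow> real" where
  "dir_deriv f v x = lim (\<lambda>n. dir_quot f v n x)"

lemma dir_quot_tendsto:
  assumes "((\<lambda>t. f (x + t *\<^sub>R v)) has_real_derivative D) (at 0)"
  shows "(\<lambda>n. dir_quot f v n x) \<longlonglongrightarrow> D"
proof -
  have 1: "((\<lambda>h. (f (x + h *\<^sub>R v) - f x) / h) \<longlongrightarrow> D) (at 0)"
    using assms by (simp add: DERIV_def)
  have 2: "filterlim (\<lambda>n. 1 / real (Suc n)) (at 0) sequentially"
    unfolding filterlim_at using LIMSEQ_inverse_real_of_nat by (simp add: divide_inverse)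
  show ?thesis using filterlim_compose[OF 1 2] by (simp add: dir_quot_def)
qed

lemma dir_deriv_eq:
  assumes "((\<lambda>t. f (x + t *\<^sub>R v)) has_real_derivative D) (at 0)"
  shows "dir_deriv f v x = D"
  unfolding dir_deriv_def by (rule limI[OF dir_quot_tendsto[OF assms]])

lemma dir_quot_measurable [measurable]:
  fixes f :: "'a::euclidean_space \<Rightarrow> real"
  assumes [measurable]: "f \<in> borel_measurable borel"
  shows "dir_quot f v n \<in> borel_measurable borel"
  unfolding dir_quot_def by measurable

lemma dir_deriv_measurable [measurable]:
  fixes f :: "'a::euclidean_space \<Rightarrow> real"
  assumes [measurable]: "f \<in> borel_measurable borel"
  shows "dir_deriv f v \<in> borel_measurable borel"
  unfolding dir_deriv_def by measurable

lemma lipschitz_on_UNIV_measurable: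
  fixes f :: "'a::euclidean_space \<Rightarrow> real"
  assumes "L-lipschitz_on UNIV f"
  shows "f \<in> borel_measurable borel"
  using lipschitz_on_continuous_on[OF assms] by (rule borel_measurable_continuous_onI)

lemma dir_quot_bound:
  assumes "L-lipschitz_on UNIV f"
  shows "\<bar>dir_quot f v n x\<bar> \<le> L * norm v"
proof -
  have "\<bar>f (x + (1 / real (Suc n)) *\<^sub>R v) - f x\<bar> \<le> L * (norm v / real (Suc n))"
    using lipschitz_onD[OF assms, of "x + (1 / real (Suc n)) *\<^sub>R v" x] by (simp add: dist_norm del: of_nat_Suc)
  then have "\<bar>f (x + (1 / real (Suc n)) *\<^sub>R v) - f x\<bar> * real (Suc n) \<le> L * norm v"
    by (simp add: pos_le_divide_eq del: of_nat_Suc)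
  then show ?thesis unfolding dir_quot_def abs_mult by simp
qed

text \<open>The right-hand side uses countable quantifiers only, so that the set of points at which
  a directional derivative exists is seen to be Borel. Rational increments suffice because the
  difference quotient is continuous away from 0.\<close>

lemma DERIV_exists_iff_Cauchy:
  fixes g :: "real \<Rightarrow> real"
  assumes "continuous_on UNIV g"
  shows "(\<exists>D. (g has_real_derivative D) (at 0)) \<longleftrightarrow>
    (\<forall>k::nat. \<exists>m::nat. \<forall>s::rat. \<forall>t::rat. s \<noteq> 0 \<and> t \<noteq> 0 \<and> \<bar>of_rat s\<bar> < 1 / real (Suc m) \<and> \<bar>of_rat t\<bar> < 1 / real (Suc m) \<longrightarrow>
       \<bar>(g (of_rat s) - g 0) / of_rat s - (g (of_rat t) - g 0) / of_rat t\<bar> \<le> 1 / real (Suc k))"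
  (is "?L \<longleftrightarrow> ?R")
proof -
  define q where "q = (\<lambda>h. (g h - g 0) / h)"
  have qc: "continuous_on (-{0}) q"
    unfolding q_def by (intro continuous_intros continuous_on_subset[OF assms]) auto
  show ?thesis
  proof
    assume ?L
    then obtain D where D: "(q \<longlongrightarrow> D) (at 0)" by (auto simp: DERIV_def q_def)
    show ?R
    proof
      fix k :: nat
      define \<kappa> where "\<kappa> = 1 / real (Suc k)"
      have "\<kappa> > 0" by (simp add: \<kappa>_def)
      then have "\<forall>\<^sub>F h in at 0. dist (q h) D < \<kappa> / 2"
        by (intro tendstoD[OF D]) simp
      then obtain d where d: "d > 0" "\<And>h. h \<noteq> 0 \<Longrightarrow> \<bar>h\<bar> < d \<Longrightarrow> \<bar>q h - D\<bar> < \<kappa> / 2"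
        unfolding eventually_at by (auto simp: dist_real_def)
      obtain m where m: "1 / real (Suc m) < d" using reals_Archimedean[OF d(1)] by (auto simp: divide_inverse)
      show "\<exists>m::nat. \<forall>s::rat. \<forall>t::rat. s \<noteq> 0 \<and> t \<noteq> 0 \<and> \<bar>of_rat s\<bar> < 1 / real (Suc m) \<and> \<bar>of_rat t\<bar> < 1 / real (Suc m) \<longrightarrow>
       \<bar>(g (of_rat s) - g 0) / of_rat s - (g (of_rat t) - g 0) / of_rat t\<bar> \<le> 1 / real (Suc k)"
      proof (intro exI allI impI)
        fix s t :: rat
        assume a: "s \<noteq> 0 \<and> t \<noteq> 0 \<and> \<bar>of_rat s\<bar> < 1 / real (Suc m) \<and> \<bar>of_rat t\<bar> < 1 / real (Suc m)"
        have "\<bar>q (of_rat s) - D\<bar> < \<kappa> / 2" "\<bar>q (of_rat t) - D\<bar> < \<kappa> / 2"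
          using a m by (intro d(2); force)+
        then have "\<bar>q (of_rat s) - q (of_rat t)\<bar> \<le> \<kappa>" by linarith
        then show "\<bar>(g (of_rat s) - g 0) / of_rat s - (g (of_rat t) - g 0) / of_rat t\<bar> \<le> 1 / real (Suc k)"
          by (simp add: q_def \<kappa>_def)
      qed
    qed
  next
    assume R: ?R
    have approx: "\<exists>r::rat. r \<noteq> 0 \<and> \<bar>of_rat r\<bar> < d \<and> \<bar>q (of_rat r) - q h\<bar> < e"
      if h: "h \<noteq> 0" "\<bar>h\<bar> < d" and e: "e > 0" for h d e
    proof -
      have "isCont q h" using qc h by (simp add: continuous_on_eq_continuous_at open_Compl)
      then obtain \<delta> where \<delta>: "\<delta> > 0" "\<And>y. \<bar>y - h\<bar> < \<delta> \<Longrightarrow> \<bar>q y - q h\<bar> < e"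
        using e unfolding continuous_at_eps_delta by (auto simp: dist_real_def)
      \<comment> \<open>The three bounds keep the rational number within \<delta> of
        \<open>h\<close>, different from 0, and of modulus below \<open>d\<close>.\<close>
      define \<eta> where "\<eta> = min \<delta> (min \<bar>h\<bar> (d - \<bar>h\<bar>))"
      have "\<eta> > 0" using \<delta> h by (auto simp: \<eta>_def)
      then obtain r where r: "h < of_rat r" "of_rat r < h + \<eta>"
        using of_rat_dense[of h "h + \<eta>"] by auto
      have a: "\<bar>of_rat r - h\<bar> < \<eta>" using r by auto
      have "r \<noteq> 0" using a by (auto simp: \<eta>_def)
      moreover have "\<bar>of_rat r :: real\<bar> < d"
        using a unfolding \<eta>_def min_less_iff_conj by linarith
      moreover have "\<bar>q (of_rat r) - q h\<bar> < e" using a by (intro \<delta>(2)) (auto simp: \<eta>_def)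
      ultimately show ?thesis by blast
    qed
    have cau: "\<exists>d>0. \<forall>x y. x \<noteq> 0 \<and> \<bar>x\<bar> < d \<and> y \<noteq> 0 \<and> \<bar>y\<bar> < d \<longrightarrow> \<bar>q x - q y\<bar> < e" if e: "e > 0" for e
    proof -
      have "e / 3 > 0" using e by simp
      from reals_Archimedean[OF this] obtain k where k0: "1 / real (Suc k) < e / 3" unfolding inverse_eq_divide ..
      define \<kappa> where "\<kappa> = 1 / real (Suc k)"
      have k: "\<kappa> < e / 3" using k0 by (simp add: \<kappa>_def)
      obtain m :: nat where "\<forall>s::rat. \<forall>t::rat. s \<noteq> 0 \<and> t \<noteq> 0 \<and> \<bar>of_rat s\<bar> < 1 / real (Suc m) \<and> \<bar>of_rat t\<bar> < 1 / real (Suc m)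
         \<longrightarrow> \<bar>q (of_rat s) - q (of_rat t)\<bar> \<le> \<kappa>"
        using R[THEN spec, of k] unfolding q_def \<kappa>_def by (elim exE)
      then have m: "\<bar>q (of_rat s) - q (of_rat t)\<bar> \<le> \<kappa>" if "s \<noteq> 0" "t \<noteq> 0"
         "\<bar>of_rat s\<bar> < 1 / real (Suc m)" "\<bar>of_rat t\<bar> < 1 / real (Suc m)" for s t
        using that by blast
      define \<mu> where "\<mu> = 1 / real (Suc m)"
      have \<mu>: "\<mu> > 0" by (simp add: \<mu>_def)
      have e3: "e / 3 > 0" using e by simp
      have "\<bar>q x - q y\<bar> < e" if a: "x \<noteq> 0" "\<bar>x\<bar> < \<mu>" "y \<noteq> 0" "\<bar>y\<bar> < \<mu>" for x y
      proof -
        obtain s where s: "s \<noteq> 0" "\<bar>of_rat s\<bar> < \<mu>" "\<bar>q (of_rat s) - q x\<bar> < e/3"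
          using approx[OF a(1,2) e3] by blast
        obtain t where t: "t \<noteq> 0" "\<bar>of_rat t\<bar> < \<mu>" "\<bar>q (of_rat t) - q y\<bar> < e/3"
          using approx[OF a(3,4) e3] by blast
        from m[OF s(1) t(1)] s t have "\<bar>q (of_rat s) - q (of_rat t)\<bar> \<le> \<kappa>" unfolding \<mu>_def by blast
        with s(3) t(3) k show "\<bar>q x - q y\<bar> < e" by linarith
      qed
      then show ?thesis using \<mu> by blast
    qed
    define h where "h n = 1 / real (Suc n)" for n
    have h0: "h \<longlonglongrightarrow> 0"
      using LIMSEQ_inverse_real_of_nat by (simp add: h_def[abs_def] divide_inverse)
    have hpos: "h n > 0" for n by (simp add: h_def)
    have ev: "\<exists>N. \<forall>n\<ge>N. \<bar>h n\<bar> < d" if "d > 0" for d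
      using LIMSEQ_D[OF h0 that] by auto
    have "Cauchy (\<lambda>n. q (h n))"
    proof (rule metric_CauchyI)
      fix e :: real assume "e > 0"
      from cau[OF this] obtain d where d: "d > 0"
        "\<And>x y. x \<noteq> 0 \<Longrightarrow> \<bar>x\<bar> < d \<Longrightarrow> y \<noteq> 0 \<Longrightarrow> \<bar>y\<bar> < d \<Longrightarrow> \<bar>q x - q y\<bar> < e" by blast
      obtain N where "\<forall>n\<ge>N. \<bar>h n\<bar> < d" using ev[OF d(1)] by blast
      then show "\<exists>M. \<forall>m\<ge>M. \<forall>n\<ge>M. dist (q (h m)) (q (h n)) < e"
        unfolding dist_real_def using d(2) hpos less_imp_neq by (metis less_irrefl)
    qed
    then obtain D where D: "(\<lambda>n. q (h n)) \<longlonglongrightarrow> D" by (metis Cauchy_convergent convergent_def)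
    have "(q \<longlongrightarrow> D) (at 0)"
      unfolding LIM_eq
    proof (intro allI impI)
      fix e :: real assume "e > 0"
      then have e2: "e / 2 > 0" by simp
      from cau[OF this] obtain d where d: "d > 0"
        "\<And>x y. x \<noteq> 0 \<Longrightarrow> \<bar>x\<bar> < d \<Longrightarrow> y \<noteq> 0 \<Longrightarrow> \<bar>y\<bar> < d \<Longrightarrow> \<bar>q x - q y\<bar> < e / 2" by blast
      obtain N where N: "\<And>n. n \<ge> N \<Longrightarrow> \<bar>h n\<bar> < d" using ev[OF d(1)] by blast
      obtain N' where N': "\<And>n. n \<ge> N' \<Longrightarrow> \<bar>q (h n) - D\<bar> < e / 2" using LIMSEQ_D[OF D e2] by auto
      let ?n = "max N N'"
      have "\<bar>q x - D\<bar> < e" if "x \<noteq> 0" "\<bar>x\<bar> < d" for x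
      proof -
        have "h ?n \<noteq> 0" using hpos[of ?n] by simp
        then have "\<bar>q x - q (h ?n)\<bar> < e / 2" using d(2)[OF that] N[of ?n] by simp
        moreover have "\<bar>q (h ?n) - D\<bar> < e / 2" by (rule N') simp
        ultimately show ?thesis by linarith
      qed
      then show "\<exists>s>0. \<forall>x. x \<noteq> 0 \<and> norm (x - 0) < s \<longrightarrow> norm (q x - D) < e"
        using d(1) by (intro exI[of _ d]) auto
    qed
    then show ?L by (auto simp: DERIV_def q_def)
  qed
qed

text \<open>On every line in direction \<open>v\<close> the one-variable theorem makes the
  exceptional times null. Since the exceptional set is Borel, being null on all these lines makes it
  null in space.\<close>

lemma lipschitz_AE_directional:
  fixes f :: "'a::euclidean_space \<Rightarrow> real"
  assumes f: "L-lipschitz_on UNIV f"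
  shows "AE x in lborel. ((\<lambda>t. f (x + t *\<^sub>R v)) has_real_derivative dir_deriv f v x) (at 0)"
proof -
  have cf: "continuous_on UNIV f" by (rule lipschitz_on_continuous_on[OF f])
  have [measurable]: "f \<in> borel_measurable borel" by (rule lipschitz_on_UNIV_measurable[OF f])
  have cl: "continuous_on UNIV (\<lambda>t. f (x + t *\<^sub>R v))" for x
    by (intro continuous_on_compose2[OF cf]) (auto intro!: continuous_intros)
  define N where "N = {x. \<not> (\<exists>D. ((\<lambda>t. f (x + t *\<^sub>R v)) has_real_derivative D) (at 0))}"
  have "Measurable.pred borel (\<lambda>x. \<exists>D. ((\<lambda>t. f (x + t *\<^sub>R v)) has_real_derivative D) (at 0))"
    unfolding DERIV_exists_iff_Cauchy[OF cl] by measurable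
  then have N: "N \<in> sets borel" unfolding N_def by measurable
  have "AE t in lborel. x + t *\<^sub>R v \<notin> N" for x
  proof -
    have "(L * norm v)-lipschitz_on UNIV (\<lambda>t. f (x + t *\<^sub>R v))"
    proof (rule lipschitz_onI)
      fix s t :: real
      have "dist (f (x + s *\<^sub>R v)) (f (x + t *\<^sub>R v)) \<le> L * dist (x + s *\<^sub>R v) (x + t *\<^sub>R v)"
        by (rule lipschitz_onD[OF f]) auto
      also have "dist (x + s *\<^sub>R v) (x + t *\<^sub>R v) = norm v * dist s t"
        by (simp add: dist_norm scaleR_left_diff_distrib[symmetric] mult.commute)
      finally show "dist (f (x + s *\<^sub>R v)) (f (x + t *\<^sub>R v)) \<le> L * norm v * dist s t"
        by (simp add: mult.assoc)
    qed (use lipschitz_on_nonneg[OF f] in simp)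
    from lipschitz_real_AE_differentiable[OF this] obtain g where
      g: "AE t in lborel. ((\<lambda>t. f (x + t *\<^sub>R v)) has_real_derivative g t) (at t)" by metis
    then show ?thesis
    proof eventually_elim
      case (elim t)
      have "((\<lambda>s. f (x + (s + t) *\<^sub>R v)) has_real_derivative g t) (at 0)"
        using elim DERIV_shift[of "\<lambda>s. f (x + s *\<^sub>R v)" "g t" 0 t] by simp
      then show ?case by (auto simp: N_def scaleR_add_left add.assoc add.commute[of "t *\<^sub>R v"])
    qed
  qed
  then have "N \<in> null_sets lborel" by (rule null_set_if_null_on_lines[OF N])
  then have "AE x in lborel. x \<notin> N" by (rule AE_not_in)
  then show ?thesis
    by eventually_elim (auto simp: N_def dest: dir_deriv_eq)
qed

text \<open>For a nonempty closed \<open>K\<close> these functions decrease to its indicator as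
  \<open>m\<close> grows. Being Lipschitz, they can be integrated by parts, which indicators
  cannot.\<close>

definition plateau :: "'a::metric_space set \<Rightarrow> nat \<Rightarrow> 'a \<Rightarrow> real" where
  "plateau K m x = max 0 (1 - real m * infdist x K)"

lemma plateau_bounds: "0 \<le> plateau K m x" "plateau K m x \<le> 1"
  by (auto simp: plateau_def infdist_nonneg)

lemma plateau_lipschitz: "(real m)-lipschitz_on UNIV (plateau K m)"
proof (rule lipschitz_onI)
  fix x y :: 'a
  have "\<bar>infdist x K - infdist y K\<bar> \<le> dist x y"
    using infdist_triangle[of x K y] infdist_triangle[of y K x] by (auto simp: dist_commute abs_le_iff)
  then have "\<bar>real m * infdist x K - real m * infdist y K\<bar> \<le> real m * dist x y"
    by (simp add: right_diff_distrib[symmetric] abs_mult mult_left_mono)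
  then show "dist (plateau K m x) (plateau K m y) \<le> real m * dist x y"
    unfolding plateau_def dist_real_def by linarith
qed simp

lemma plateau_tendsto:
  assumes "closed K" "K \<noteq> {}"
  shows "(\<lambda>m. plateau K m x) \<longlonglongrightarrow> indicator K x"
proof (cases "x \<in> K")
  case True
  then show ?thesis by (simp add: plateau_def)
next
  case False
  then have pos: "infdist x K > 0" using assms infdist_pos_not_in_closed by blast
  then obtain m0 :: nat where m0: "1 < real m0 * infdist x K" using reals_Archimedean3 by blast
  have "plateau K m x = 0" if "m \<ge> m0" for m
  proof -
    have "real m0 * infdist x K \<le> real m * infdist x K" using that pos by (intro mult_right_mono) auto
    then show ?thesis using m0 by (simp add: plateau_def)
  qed
  then have "\<forall>\<^sub>F m in sequentially. plateau K m x = 0" using eventually_sequentially by blast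
  then show ?thesis using False by (simp add: tendsto_eventually)
qed

lemma plateau_support:
  fixes K :: "'a::heine_borel set"
  assumes "compact K" "K \<noteq> {}" "open O'" "K \<subseteq> O'"
  obtains M m0 where "compact M" "M \<subseteq> O'" "\<And>m x. m \<ge> m0 \<Longrightarrow> x \<notin> M \<Longrightarrow> plateau K m x = 0"
proof -
  obtain d where d: "d > 0" "{x. infdist x K \<le> d} \<subseteq> O'"
    using compact_in_open_separated[OF assms(2,1,3,4)] by blast
  obtain m0 :: nat where m0: "1 < real m0 * d" using reals_Archimedean3[OF d(1)] by blast
  have "compact {x. infdist x K \<le> d}" by (rule compact_infdist_le[OF assms(2,1) d(1)])
  moreover have "plateau K m x = 0" if "m \<ge> m0" "x \<notin> {x. infdist x K \<le> d}" for m x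
  proof -
    have "real m0 * d \<le> real m * infdist x K" using that d(1) by (intro mult_mono) auto
    then show ?thesis using m0 by (simp add: plateau_def)
  qed
  ultimately show ?thesis using that d(2) by blast
qed

lemma plateau_measurable [measurable]: "plateau (K :: 'a::euclidean_space set) m \<in> borel_measurable borel"
  by (rule lipschitz_on_UNIV_measurable[OF plateau_lipschitz])

text \<open>The du Bois-Reymond lemma with plateau functions as the only test functions. They
  converge to indicators of compact sets, so \<open>H\<close> has integral 0 over every compact
  subset of \<open>O'\<close>; and the sets where \<open>H\<close> is positive or negative are, up
  to null sets, countable unions of compact sets.\<close>

lemma AE_zero_by_test_functions:
  fixes H :: "'a::euclidean_space \<Rightarrow> real"
  assumes O: "open O'"
    and int: "\<And>K. compact K \<Longrightarrow> K \<subseteq> O' \<Longrightarrow> set_integrable lebesgue K H"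
    and test: "\<And>K m. compact K \<Longrightarrow> K \<noteq> {} \<Longrightarrow> K \<subseteq> O' \<Longrightarrow>
        (\<And>x. x \<notin> O' \<Longrightarrow> plateau K m x = 0) \<Longrightarrow> bounded {x. plateau K m x \<noteq> 0} \<Longrightarrow>
        closure {x. plateau K m x \<noteq> 0} \<subseteq> O' \<Longrightarrow> integral\<^sup>L lebesgue (\<lambda>x. H x * plateau K m x) = 0"
  shows "AE x in lebesgue. x \<in> O' \<longrightarrow> H x = 0"
proof -
  have Kint: "set_lebesgue_integral lebesgue K H = 0" if K: "compact K" "K \<subseteq> O'" for K
  proof (cases "K = {}")
    case True then show ?thesis by (simp add: set_lebesgue_integral_def)
  next
    case False
    obtain M m0 where M: "compact M" "M \<subseteq> O'" "\<And>m x. m \<ge> m0 \<Longrightarrow> x \<notin> M \<Longrightarrow> plateau K m x = 0"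
      using plateau_support[OF K(1) False O K(2)] by metis
    have Hm: "(\<lambda>x. indicator M x * H x) \<in> borel_measurable lebesgue"
      using int[OF M(1,2)] by (auto simp: set_integrable_def)
    have zero: "integral\<^sup>L lebesgue (\<lambda>x. H x * plateau K (m + m0) x) = 0" for m
    proof (rule test[OF K(1) False K(2)])
      have sub: "{x. plateau K (m + m0) x \<noteq> 0} \<subseteq> M" using M(3)[of "m + m0"] by force
      then show "bounded {x. plateau K (m + m0) x \<noteq> 0}"
        using M(1) bounded_subset compact_imp_bounded by blast
      show "closure {x. plateau K (m + m0) x \<noteq> 0} \<subseteq> O'"
        using closure_minimal[OF sub] M(1,2) compact_imp_closed by blast
      show "plateau K (m + m0) x = 0" if "x \<notin> O'" for x using M(3)[of "m + m0" x] that M(2) by force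
    qed
    have "(\<lambda>m. integral\<^sup>L lebesgue (\<lambda>x. (indicator M x * H x) * plateau K (m + m0) x))
        \<longlonglongrightarrow> integral\<^sup>L lebesgue (\<lambda>x. (indicator M x * H x) * indicator K x)"
    proof (rule integral_dominated_convergence[where w="\<lambda>x. \<bar>indicator M x * H x\<bar>"])
      show "(\<lambda>x. indicator M x * H x * indicat_real K x) \<in> borel_measurable lebesgue"
        by (rule borel_measurable_times[OF Hm borel_measurable_indicator])
          (use borel_compact[OF K(1)] in auto)
      show "(\<lambda>x. indicator M x * H x * plateau K (m + m0) x) \<in> borel_measurable lebesgue" for m
        by (intro borel_measurable_times Hm) (auto intro: measurable_completion)
      show "integrable lebesgue (\<lambda>x. \<bar>indicator M x * H x\<bar>)"
        using int[OF M(1,2)] by (intro integrable_abs) (simp add: set_integrable_def)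
      show "AE x in lebesgue. (\<lambda>m. indicator M x * H x * plateau K (m + m0) x) \<longlonglongrightarrow> indicator M x * H x * indicat_real K x"
      proof (intro AE_I2 tendsto_mult tendsto_const)
        fix x show "(\<lambda>m. plateau K (m + m0) x) \<longlonglongrightarrow> indicat_real K x"
          using LIMSEQ_ignore_initial_segment[OF plateau_tendsto[of K x, OF compact_imp_closed[OF K(1)] False], of m0] .
      qed
      show "AE x in lebesgue. norm (indicator M x * H x * plateau K (m + m0) x) \<le> \<bar>indicator M x * H x\<bar>" for m
        using plateau_bounds[of K "m + m0"] by (intro AE_I2) (auto simp: abs_mult intro!: mult_left_le)
    qed
    moreover have "integral\<^sup>L lebesgue (\<lambda>x. (indicator M x * H x) * plateau K (m + m0) x) = 0" for m
    proof -
      have "(\<lambda>x. (indicator M x * H x) * plateau K (m + m0) x) = (\<lambda>x. H x * plateau K (m + m0) x)"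
        using M(3)[of "m + m0"] by (auto simp: indicator_def fun_eq_iff)
      then show ?thesis using zero by simp
    qed
    ultimately have "integral\<^sup>L lebesgue (\<lambda>x. (indicator M x * H x) * indicator K x) = 0"
      by (simp add: LIMSEQ_const_iff)
    moreover have "(\<lambda>x. (indicator M x * H x) * indicator K x) = (\<lambda>x. indicator K x *\<^sub>R H x)"
    proof
      fix x
      have "x \<in> M" if "x \<in> K"
      proof (rule ccontr)
        assume "x \<notin> M" then have "plateau K m0 x = 0" using M(3) by blast
        then show False using that by (simp add: plateau_def)
      qed
      then show "(indicator M x * H x) * indicator K x = indicator K x *\<^sub>R H x" by (auto simp: indicator_def)
    qed
    ultimately show ?thesis by (simp add: set_lebesgue_integral_def)
  qed
  \<comment> \<open>Integrability is assumed on compact sets only. Measurability on all of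
    \<open>O'\<close> follows by exhausting \<open>O'\<close> with compact sets up to a null
    set.\<close>
  have Hmeas: "(\<lambda>x. indicator O' x * H x) \<in> borel_measurable lebesgue"
  proof -
    have "O' \<in> sets lebesgue" using O by auto
    obtain C' N where C: "negligible N" "\<And>n::nat. compact (C' n)" "O' = (\<Union>n. C' n) \<union> N"
      using lebesgue_regular_inner[OF \<open>O' \<in> sets lebesgue\<close>] by metis
    have "(\<lambda>x. indicator (C' n) x * H x) \<in> borel_measurable lebesgue" for n
      using int[of "C' n"] C by (auto simp: set_integrable_def)
    then have lm: "(\<lambda>x. indicator (\<Union>i\<le>n. C' i) x * H x) \<in> borel_measurable lebesgue" for n
      using int[of "\<Union>i\<le>n. C' i"] C by (auto simp: set_integrable_def intro!: compact_UN)
    have "AE x in lebesgue. x \<notin> N" using C(1) by (simp add: negligible_iff_null_sets AE_not_in)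
    then have "AE x in lebesgue. (\<lambda>n. indicator (\<Union>i\<le>n. C' i) x * H x) \<longlonglongrightarrow> indicator O' x * H x"
    proof eventually_elim
      case (elim x)
      show ?case
      proof (cases "x \<in> O'")
        case True
        then obtain k where "x \<in> C' k" using elim C(3) by auto
        then have "\<forall>n\<ge>k. indicator (\<Union>i\<le>n. C' i) x * H x = indicator O' x * H x"
          using True by (auto simp: indicator_def)
        then show ?thesis by (intro tendsto_eventually) (auto simp: eventually_sequentially)
      next
        case False
        then have 1: "indicat_real (\<Union>i\<le>n. C' i) x * H x = 0" for n using C(3) by (auto simp: indicator_def)
        have 2: "indicat_real O' x * H x = 0" using False by simp
        show ?thesis unfolding 1 2 by (rule tendsto_const)
      qed
    qed
    then have "AE x in lebesgue. lim (\<lambda>n. indicator (\<Union>i\<le>n. C' i) x * H x) = indicator O' x * H x"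
      by eventually_elim (rule limI)
    then show ?thesis by (rule borel_measurable_AE[OF borel_measurable_lim_metric[OF lm]])
  qed
  \<comment> \<open>The two signs treat the positive and the negative part of \<open>H\<close> at
    once.\<close>
  have sign: "AE x in lebesgue. x \<in> O' \<longrightarrow> \<sigma> * H x \<le> 0" if \<sigma>: "\<sigma> = 1 \<or> \<sigma> = -1" for \<sigma> :: real
  proof -
    let ?S = "{x. 0 < \<sigma> * (indicator O' x * H x)}"
    have "(\<lambda>x. \<sigma> * (indicator O' x * H x)) \<in> borel_measurable lebesgue" using Hmeas by simp
    then have S: "?S \<in> sets lebesgue" by (simp add: borel_measurable_iff_greater)
    obtain C' N where C: "negligible N" "\<And>n::nat. compact (C' n)" "?S = (\<Union>n. C' n) \<union> N"
      using lebesgue_regular_inner[OF S] by metis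
    have Cnull: "AE x in lebesgue. x \<notin> C' n" for n
    proof -
      have sub: "C' n \<subseteq> ?S" using C(3) by blast
      have O'': "C' n \<subseteq> O'"
      proof
        fix x assume "x \<in> C' n"
        then have "0 < \<sigma> * (indicator O' x * H x)" using sub by blast
        then show "x \<in> O'" by (cases "x \<in> O'") auto
      qed
      let ?h = "\<lambda>x. \<sigma> * (indicator (C' n) x *\<^sub>R H x)"
      have i: "integrable lebesgue ?h" using int[OF C(2) O''] by (simp add: set_integrable_def)
      have nn: "0 \<le> ?h x" for x using sub O'' by (fastforce simp: indicator_def)
      have "integral\<^sup>L lebesgue ?h = 0" using Kint[OF C(2) O''] by (simp add: set_lebesgue_integral_def)
      then have "AE x in lebesgue. ?h x = 0" using integral_nonneg_eq_0_iff_AE[OF i] nn by simp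
      then show ?thesis
      proof eventually_elim
        case (elim x) then show ?case using sub O'' by (fastforce simp: indicator_def)
      qed
    qed
    have "AE x in lebesgue. x \<notin> N" using C(1) by (simp add: negligible_iff_null_sets AE_not_in)
    moreover have "AE x in lebesgue. \<forall>n. x \<notin> C' n" using Cnull by (simp add: AE_all_countable)
    ultimately show ?thesis
    proof eventually_elim
      case (elim x)
      then have "x \<notin> ?S" unfolding C(3) by blast
      then show ?case by (auto simp: indicator_def)
    qed
  qed
  from sign[OF disjI1[OF refl]] sign[OF disjI2[OF refl]] show ?thesis by eventually_elim auto
qed

section \<open>Additivity of directional derivatives in the direction\<close>

lemma integral_lborel_translation:
  fixes g :: "'a::euclidean_space \<Rightarrow> real"
  assumes "g \<in> borel_measurable borel"
  shows "integral\<^sup>L lborel (\<lambda>x. g (x + c)) = integral\<^sup>L lborel g"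
proof -
  have "integral\<^sup>L lborel g = integral\<^sup>L (distr lborel borel ((+) c)) g"
    by (simp add: lborel_distr_plus)
  also have "\<dots> = integral\<^sup>L lborel (\<lambda>x. g (c + x))" using assms by (intro integral_distr) auto
  finally show ?thesis by (simp add: add.commute)
qed

text \<open>At the moving point \<open>x + (1 / (n + 1)) u\<close> nothing is known about
  convergence of the quotients themselves. After a translation the quotient stands at the fixed
  point \<open>x\<close> and the motion is in the argument of \<psi>, which is continuous. A
  constant on a ball enlarged by \<open>norm u\<close> dominates.\<close>

lemma dir_quot_test_tendsto:
  fixes f :: "'a::euclidean_space \<Rightarrow> real"
  assumes f: "L-lipschitz_on UNIV f" and \<psi>: "continuous_on UNIV \<psi>" "bounded {x. \<psi> x \<noteq> 0}"
  shows "(\<lambda>n. \<integral>x. dir_quot f v n (x + (1 / real (Suc n)) *\<^sub>R u) * \<psi> x \<partial>lborel)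
    \<longlonglongrightarrow> (\<integral>x. dir_deriv f v x * \<psi> x \<partial>lborel)"
    and "integrable lborel (\<lambda>x. dir_quot f v n (x + c) * \<psi> x)"
    and "integrable lborel (\<lambda>x. dir_deriv f v x * \<psi> x)"
proof -
  have [measurable]: "f \<in> borel_measurable borel" by (rule lipschitz_on_UNIV_measurable[OF f])
  have [measurable]: "\<psi> \<in> borel_measurable borel" using \<psi>(1) by (rule borel_measurable_continuous_onI)
  obtain r0 where r0: "\<And>x. \<psi> x \<noteq> 0 \<Longrightarrow> norm x \<le> r0" using \<psi>(2) unfolding bounded_iff by blast
  define r where "r = max r0 0"
  have r: "\<And>x. \<psi> x \<noteq> 0 \<Longrightarrow> norm x \<le> r" "r \<ge> 0" using r0 unfolding r_def by (blast intro: max.coboundedI1, simp)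
  have "compact (\<psi> ` cball 0 r)"
    by (intro compact_continuous_image continuous_on_subset[OF \<psi>(1)]) auto
  then obtain M0 where "\<forall>y\<in>\<psi> ` cball 0 r. norm y \<le> M0"
    using compact_imp_bounded bounded_iff by metis
  then have M0: "\<And>x. norm x \<le> r \<Longrightarrow> \<bar>\<psi> x\<bar> \<le> M0" by auto
  have M: "\<bar>\<psi> x\<bar> \<le> M0" for x
    using M0[of x] M0[of 0] r by (cases "\<psi> x = 0") (auto intro: order_trans[OF abs_ge_zero])
  have L: "L \<ge> 0" by (rule lipschitz_on_nonneg[OF f])
  have M0p: "M0 \<ge> 0" using M[of 0] by simp
  have intW: "integrable lborel (\<lambda>x. L * norm v * M0 * indicator (cball 0 s) x)" for s :: real
    by (intro integrable_mult_right integrable_real_indicator emeasure_bounded_finite) auto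
  show i1: "integrable lborel (\<lambda>x. dir_quot f v n (x + c) * \<psi> x)" for n c
  proof (rule Bochner_Integration.integrable_bound[OF intW[of r]])
    show "AE x in lborel. norm (dir_quot f v n (x + c) * \<psi> x) \<le> norm (L * norm v * M0 * indicator (cball 0 r) x)"
    proof (rule AE_I2)
      fix x
      have "\<bar>dir_quot f v n (x + c)\<bar> * \<bar>\<psi> x\<bar> \<le> L * norm v * M0"
        using dir_quot_bound[OF f] M L by (intro mult_mono) auto
      then show "norm (dir_quot f v n (x + c) * \<psi> x) \<le> norm (L * norm v * M0 * indicator (cball 0 r) x)"
        using r(1)[of x] L M0p by (cases "\<psi> x = 0") (auto simp: abs_mult)
    qed
  qed measurable
  have AEd: "AE x in lborel. ((\<lambda>t. f (x + t *\<^sub>R v)) has_real_derivative dir_deriv f v x) (at 0)"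
    by (rule lipschitz_AE_directional[OF f])
  have AEb: "AE x in lborel. \<bar>dir_deriv f v x\<bar> \<le> L * norm v"
    using AEd
  proof eventually_elim
    case (elim x)
    have "(\<lambda>n. \<bar>dir_quot f v n x\<bar>) \<longlonglongrightarrow> \<bar>dir_deriv f v x\<bar>"
      by (intro tendsto_rabs dir_quot_tendsto elim)
    then show ?case by (rule LIMSEQ_le_const2) (use dir_quot_bound[OF f] in blast)
  qed
  show "integrable lborel (\<lambda>x. dir_deriv f v x * \<psi> x)"
  proof (rule Bochner_Integration.integrable_bound[OF intW[of r]])
    show "AE x in lborel. norm (dir_deriv f v x * \<psi> x) \<le> norm (L * norm v * M0 * indicator (cball 0 r) x)"
      using AEb
    proof eventually_elim
      case (elim x)
      have "\<bar>dir_deriv f v x\<bar> * \<bar>\<psi> x\<bar> \<le> L * norm v * M0"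
        using elim M L by (intro mult_mono) auto
      then show ?case
        using r(1)[of x] L M0p by (cases "\<psi> x = 0") (auto simp: abs_mult)
    qed
  qed measurable
  define c where "c n = (1 / real (Suc n)) *\<^sub>R u" for n
  have cn: "norm (c n) \<le> norm u" for n by (simp add: c_def divide_le_eq mult_le_cancel_left1)
  have c0: "c \<longlonglongrightarrow> 0"
  proof -
    have "(\<lambda>n. (1 / real (Suc n)) *\<^sub>R u) \<longlonglongrightarrow> 0 *\<^sub>R u"
      using LIMSEQ_inverse_real_of_nat by (intro tendsto_scaleR tendsto_const) (simp add: divide_inverse)
    then show ?thesis by (simp add: c_def[abs_def])
  qed
  have shift: "(\<integral>x. dir_quot f v n (x + c n) * \<psi> x \<partial>lborel) = (\<integral>x. dir_quot f v n x * \<psi> (x - c n) \<partial>lborel)" for n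
  proof -
    have "(\<integral>x. (\<lambda>y. dir_quot f v n y * \<psi> (y - c n)) (x + c n) \<partial>lborel) = (\<integral>y. dir_quot f v n y * \<psi> (y - c n) \<partial>lborel)"
      by (rule integral_lborel_translation) measurable
    then show ?thesis by simp
  qed
  have "(\<lambda>n. \<integral>x. dir_quot f v n x * \<psi> (x - c n) \<partial>lborel) \<longlonglongrightarrow> (\<integral>x. dir_deriv f v x * \<psi> x \<partial>lborel)"
  proof (rule integral_dominated_convergence[where w="\<lambda>x. L * norm v * M0 * indicator (cball 0 (r + norm u)) x"])
    show "AE x in lborel. (\<lambda>n. dir_quot f v n x * \<psi> (x - c n)) \<longlonglongrightarrow> dir_deriv f v x * \<psi> x"
      using AEd
    proof eventually_elim
      case (elim x)
      have "isCont \<psi> x" using \<psi>(1) by (simp add: continuous_on_eq_continuous_at)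
      moreover have "(\<lambda>n. x - c n) \<longlonglongrightarrow> x" using tendsto_diff[OF tendsto_const c0, of x] by simp
      ultimately have "(\<lambda>n. \<psi> (x - c n)) \<longlonglongrightarrow> \<psi> x" by (rule isCont_tendsto_compose)
      then show ?case by (intro tendsto_mult dir_quot_tendsto elim)
    qed
    show "AE x in lborel. norm (dir_quot f v n x * \<psi> (x - c n)) \<le> L * norm v * M0 * indicator (cball 0 (r + norm u)) x" for n
    proof (rule AE_I2)
      fix x
      have 1: "\<bar>dir_quot f v n x\<bar> * \<bar>\<psi> (x - c n)\<bar> \<le> L * norm v * M0"
        using dir_quot_bound[OF f] M L by (intro mult_mono) auto
      have 2: "norm x \<le> r + norm u" if "\<psi> (x - c n) \<noteq> 0"
        using r(1)[OF that] cn[of n] norm_triangle_sub[of x "c n"] by linarith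
      show "norm (dir_quot f v n x * \<psi> (x - c n)) \<le> L * norm v * M0 * indicator (cball 0 (r + norm u)) x"
        using 1 2 L M0p by (cases "\<psi> (x - c n) = 0") (auto simp: abs_mult)
    qed
  qed (use intW in auto)
  then show "(\<lambda>n. \<integral>x. dir_quot f v n (x + (1 / real (Suc n)) *\<^sub>R u) * \<psi> x \<partial>lborel)
    \<longlonglongrightarrow> (\<integral>x. dir_deriv f v x * \<psi> x \<partial>lborel)"
    using shift by (simp add: c_def)
qed

text \<open>The difference quotient in direction \<open>u + v\<close> is the sum of one along \<open>u\<close> and one along
  \<open>v\<close> at a shifted point; tested against a continuous function, the shift moves onto that
  function and disappears in the limit.\<close>

lemma dir_deriv_add:
  fixes f :: "'a::euclidean_space \<Rightarrow> real"
  assumes f: "L-lipschitz_on UNIV f"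
  shows "AE x in lborel. dir_deriv f (u + v) x = dir_deriv f u x + dir_deriv f v x"
proof -
  have [measurable]: "f \<in> borel_measurable borel" by (rule lipschitz_on_UNIV_measurable[OF f])
  define H where "H x = dir_deriv f (u + v) x - dir_deriv f u x - dir_deriv f v x" for x
  have [measurable]: "H \<in> borel_measurable borel" unfolding H_def by measurable
  have zero: "(\<integral>x. H x * \<psi> x \<partial>lborel) = 0" "integrable lborel (\<lambda>x. H x * \<psi> x)"
    if \<psi>: "continuous_on UNIV \<psi>" "bounded {x. \<psi> x \<noteq> 0}" for \<psi> :: "'a \<Rightarrow> real"
  proof -
    note T = dir_quot_test_tendsto[OF f \<psi>]
    have q: "dir_quot f (u + v) n x = dir_quot f v n (x + (1 / real (Suc n)) *\<^sub>R u) + dir_quot f u n x" for n x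
      by (simp add: dir_quot_def algebra_simps)
    have "(\<lambda>n. (\<integral>x. dir_quot f v n (x + (1 / real (Suc n)) *\<^sub>R u) * \<psi> x \<partial>lborel) +
               (\<integral>x. dir_quot f u n (x + (1 / real (Suc n)) *\<^sub>R 0) * \<psi> x \<partial>lborel))
      \<longlonglongrightarrow> (\<integral>x. dir_deriv f v x * \<psi> x \<partial>lborel) + (\<integral>x. dir_deriv f u x * \<psi> x \<partial>lborel)"
      by (intro tendsto_add T(1))
    moreover have "(\<integral>x. dir_quot f v n (x + (1 / real (Suc n)) *\<^sub>R u) * \<psi> x \<partial>lborel) +
               (\<integral>x. dir_quot f u n (x + (1 / real (Suc n)) *\<^sub>R 0) * \<psi> x \<partial>lborel)
        = (\<integral>x. dir_quot f (u + v) n (x + (1 / real (Suc n)) *\<^sub>R 0) * \<psi> x \<partial>lborel)" for n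
      using T(2)[of v n "(1 / real (Suc n)) *\<^sub>R u"] T(2)[of u n 0]
      by (subst Bochner_Integration.integral_add[symmetric]) (auto simp: q ring_distribs)
    ultimately have "(\<integral>x. dir_deriv f v x * \<psi> x \<partial>lborel) + (\<integral>x. dir_deriv f u x * \<psi> x \<partial>lborel)
        = (\<integral>x. dir_deriv f (u + v) x * \<psi> x \<partial>lborel)"
      using T(1)[of "u + v" 0] by (metis (no_types, lifting) LIMSEQ_unique ext)
    moreover have "(\<lambda>x. H x * \<psi> x) = (\<lambda>x. dir_deriv f (u + v) x * \<psi> x - dir_deriv f u x * \<psi> x - dir_deriv f v x * \<psi> x)"
      by (auto simp: H_def algebra_simps)
    ultimately show "(\<integral>x. H x * \<psi> x \<partial>lborel) = 0" "integrable lborel (\<lambda>x. H x * \<psi> x)"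
      using T(3) by auto
  qed
  have "AE x in lebesgue. x \<in> UNIV \<longrightarrow> H x = 0"
  proof (rule AE_zero_by_test_functions)
    fix K :: "'a set" assume K: "compact K"
    show "set_integrable lebesgue K H"
    proof (cases "K = {}")
      case False
      obtain M m0 where M: "compact M" "\<And>m x. m \<ge> m0 \<Longrightarrow> x \<notin> M \<Longrightarrow> plateau K m x = 0"
        using plateau_support[OF K False open_UNIV] by (metis subset_UNIV)
      have "bounded {x. plateau K m0 x \<noteq> 0}"
        by (rule bounded_subset[OF compact_imp_bounded[OF M(1)]]) (use M(2) in blast)
      then have "integrable lborel (\<lambda>x. H x * plateau K m0 x)"
        by (intro zero(2) lipschitz_on_continuous_on[OF plateau_lipschitz])
      \<comment> \<open>On \<open>K\<close> the plateau equals 1, so the product that is already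
        known to be integrable dominates \<open>H\<close> there.\<close>
      then have "integrable lborel (\<lambda>x. indicator K x *\<^sub>R H x)"
      proof (rule Bochner_Integration.integrable_bound)
        have "K \<in> sets borel" using K by (simp add: borel_compact)
        then show "(\<lambda>x. indicat_real K x *\<^sub>R H x) \<in> borel_measurable lborel" by measurable
      qed (auto simp: indicator_def plateau_def)
      then show ?thesis unfolding set_integrable_def
        by (metis borel_measurable_integrable integrable_completion)
    qed (simp add: set_integrable_def)
  next
    fix K :: "'a set" and m assume b: "bounded {x. plateau K m x \<noteq> 0}"
    show "integral\<^sup>L lebesgue (\<lambda>x. H x * plateau K m x) = 0"
      using zero(1)[OF lipschitz_on_continuous_on[OF plateau_lipschitz] b] by (subst integral_completion) auto
  qed auto
  then show ?thesis by (simp add: AE_completion_iff H_def algebra_simps)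
qed

lemma dir_deriv_0 [simp]: "dir_deriv f 0 x = 0"
  by (rule dir_deriv_eq) simp

lemma dir_deriv_scaleR:
  fixes f :: "'a::euclidean_space \<Rightarrow> real"
  assumes f: "L-lipschitz_on UNIV f"
  shows "AE x in lborel. dir_deriv f (c *\<^sub>R v) x = c * dir_deriv f v x"
  using lipschitz_AE_directional[OF f, of v]
proof eventually_elim
  case (elim x)
  have "((\<lambda>t. c * t) has_real_derivative c) (at 0)" by (auto intro!: derivative_eq_intros)
  moreover have "((\<lambda>t. f (x + t *\<^sub>R v)) has_real_derivative dir_deriv f v x) (at (c * 0))" using elim by simp
  ultimately have "((\<lambda>t. f (x + (c * t) *\<^sub>R v)) has_real_derivative dir_deriv f v x * c) (at 0)"
    using DERIV_chain2[of "\<lambda>t. f (x + t *\<^sub>R v)" _ "\<lambda>t. c * t" 0] by blast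
  then show ?case by (intro dir_deriv_eq) (simp add: mult.commute)
qed

lemma dir_deriv_sum:
  fixes f :: "'a::euclidean_space \<Rightarrow> real"
  assumes f: "L-lipschitz_on UNIV f" and "finite S"
  shows "AE x in lborel. dir_deriv f (\<Sum>b\<in>S. c b *\<^sub>R b) x = (\<Sum>b\<in>S. c b * dir_deriv f b x)"
  using \<open>finite S\<close>
proof (induction S)
  case (insert b S)
  show ?case
    using insert.IH dir_deriv_add[OF f, of "c b *\<^sub>R b" "\<Sum>b\<in>S. c b *\<^sub>R b"] dir_deriv_scaleR[OF f, of "c b" b]
    by eventually_elim (use insert.hyps in simp)
qed simp

section \<open>The gradient of a Lipschitz function and total differentiability\<close>

definition lip_gradient :: "('a::euclidean_space \<Rightarrow> real) \<Rightarrow> 'a \<Rightarrow> 'a" where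
  "lip_gradient f x = (\<Sum>b\<in>Basis. dir_deriv f b x *\<^sub>R b)"

lemma lip_gradient_inner_Basis: "b \<in> Basis \<Longrightarrow> lip_gradient f x \<bullet> b = dir_deriv f b x"
  by (simp add: lip_gradient_def)

lemma lip_gradient_measurable [measurable]:
  fixes f :: "'a::euclidean_space \<Rightarrow> real"
  assumes [measurable]: "f \<in> borel_measurable borel"
  shows "lip_gradient f \<in> borel_measurable borel"
  unfolding lip_gradient_def by measurable

lemma lipschitz_AE_directional_gradient:
  fixes f :: "'a::euclidean_space \<Rightarrow> real"
  assumes f: "L-lipschitz_on UNIV f"
  shows "AE x in lborel. ((\<lambda>t. f (x + t *\<^sub>R v)) has_real_derivative (v \<bullet> lip_gradient f x)) (at 0)"
  using dir_deriv_sum[OF f finite_Basis, of "\<lambda>b. v \<bullet> b"] lipschitz_AE_directional[OF f, of v]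
proof eventually_elim
  case (elim x)
  have "v \<bullet> lip_gradient f x = dir_deriv f v x"
    using elim(1) by (simp add: euclidean_representation lip_gradient_def inner_sum_right mult.commute)
  with elim(2) show ?case by simp
qed

text \<open>Almost everywhere the derivatives in countably many dense directions exist at once and
  depend linearly on the direction. Finitely many of these directions form a net of the unit sphere,
  and the Lipschitz bound carries their estimates over to all directions uniformly.\<close>

theorem Rademacher:
  fixes f :: "'a::euclidean_space \<Rightarrow> real"
  assumes f: "L-lipschitz_on UNIV f"
  shows "AE x in lborel. (f has_derivative (\<lambda>v. v \<bullet> lip_gradient f x)) (at x)"
proof -
  obtain D :: "'a set" where D: "countable D" "\<And>X. open X \<Longrightarrow> X \<noteq> {} \<Longrightarrow> \<exists>d\<in>D. d \<in> X"
    using countable_dense_setE by blast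
  have L: "L \<ge> 0" by (rule lipschitz_on_nonneg[OF f])
  have "AE x in lborel. \<forall>v\<in>D. ((\<lambda>t. f (x + t *\<^sub>R v)) has_real_derivative (v \<bullet> lip_gradient f x)) (at 0)"
    using D(1) lipschitz_AE_directional_gradient[OF f] by (simp add: AE_ball_countable)
  then show ?thesis
  proof eventually_elim
    case (elim x)
    let ?G = "lip_gradient f x"
    show ?case
      unfolding has_derivative_at_alt
    proof (intro conjI allI impI)
      show "bounded_linear (\<lambda>v. v \<bullet> ?G)" by (rule bounded_linear_inner_left)
    next
      fix e :: real assume e: "e > 0"
      \<comment> \<open>Replacing a unit direction by one at distance below \<eta> costs
        \<open>L * \<eta> * t\<close> in \<open>f\<close> and \<open>norm ?G * \<eta> * t\<close> in
        the linear part, together at most half of the permitted \<open>e * t\<close>. The other half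
        is left to the difference quotients along the net.\<close>
      define \<eta> where "\<eta> = e / (2 * (L + norm ?G + 1))"
      have pos: "L + norm ?G + 1 > 0" using L by (simp add: add_nonneg_pos)
      have \<eta>: "\<eta> > 0" using e pos by (simp add: \<eta>_def)
      have \<eta>le: "(L + norm ?G) * \<eta> \<le> e / 2"
      proof -
        have "(L + norm ?G) * \<eta> \<le> (L + norm ?G + 1) * \<eta>" using \<eta> by (intro mult_right_mono) auto
        also have "\<dots> = e / 2" using less_imp_neq[OF pos] unfolding \<eta>_def
          by (metis mult.commute nonzero_mult_divide_mult_cancel_left times_divide_eq_right)
        finally show ?thesis .
      qed
      have "sphere (0::'a) 1 \<subseteq> (\<Union>v\<in>D. ball v \<eta>)"
      proof
        fix w :: 'a
        obtain v where "v \<in> D" "v \<in> ball w \<eta>" using D(2)[of "ball w \<eta>"] \<eta> by auto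
        then show "w \<in> (\<Union>v\<in>D. ball v \<eta>)" by (auto simp: dist_commute)
      qed
      then obtain F where F: "F \<subseteq> D" "finite F" "sphere (0::'a) 1 \<subseteq> (\<Union>v\<in>F. ball v \<eta>)"
        using compactE_image[OF compact_sphere, of D "\<lambda>v. ball v \<eta>" 0 1] by blast
      have "\<exists>d>0. \<forall>t. \<bar>t\<bar> < d \<longrightarrow> \<bar>f (x + t *\<^sub>R v) - f x - t * (v \<bullet> ?G)\<bar> \<le> (e / 2) * \<bar>t\<bar>" if "v \<in> F" for v
      proof -
        have "((\<lambda>t. f (x + t *\<^sub>R v)) has_derivative (\<lambda>t. t * (v \<bullet> ?G))) (at 0)"
          using elim that F(1) by (auto simp: has_field_derivative_def mult.commute[of _ "v \<bullet> ?G"])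
        then have "\<forall>e>0. \<exists>d>0. \<forall>t. \<bar>t\<bar> < d \<longrightarrow> \<bar>f (x + t *\<^sub>R v) - f x - t * (v \<bullet> ?G)\<bar> \<le> e * \<bar>t\<bar>"
          unfolding has_derivative_at_alt by simp
        then show ?thesis using e half_gt_zero by blast
      qed
      then obtain d where d: "\<And>v. v \<in> F \<Longrightarrow> d v > 0"
         "\<And>v t. v \<in> F \<Longrightarrow> \<bar>t\<bar> < d v \<Longrightarrow> \<bar>f (x + t *\<^sub>R v) - f x - t * (v \<bullet> ?G)\<bar> \<le> (e / 2) * \<bar>t\<bar>"
        by metis
      define \<delta> where "\<delta> = Min (insert 1 (d ` F))"
      have \<delta>: "\<delta> > 0" "\<And>v. v \<in> F \<Longrightarrow> \<delta> \<le> d v"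
        unfolding \<delta>_def using F(2) d(1) by (auto simp: Min_gr_iff)
      have "norm (f y - f x - (y - x) \<bullet> ?G) \<le> e * norm (y - x)" if y: "norm (y - x) < \<delta>" for y
      proof (cases "y = x")
        case False
        define t where "t = norm (y - x)"
        define w where "w = (1 / t) *\<^sub>R (y - x)"
        have t: "t > 0" using False by (simp add: t_def)
        have yw: "y = x + t *\<^sub>R w" using t by (simp add: w_def)
        have "w \<in> sphere 0 1" using t by (simp add: w_def t_def[symmetric])
        then obtain v where v: "v \<in> F" "dist v w < \<eta>" using F(3) by auto
        have 1: "\<bar>f (x + t *\<^sub>R w) - f (x + t *\<^sub>R v)\<bar> \<le> L * (t * \<eta>)"
        proof -
          have "\<bar>f (x + t *\<^sub>R w) - f (x + t *\<^sub>R v)\<bar> \<le> L * dist (x + t *\<^sub>R w) (x + t *\<^sub>R v)"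
            using lipschitz_onD[OF f, of "x + t *\<^sub>R w" "x + t *\<^sub>R v"] by (simp add: dist_real_def)
          also have "dist (x + t *\<^sub>R w) (x + t *\<^sub>R v) = t * dist w v"
            using t by (simp add: dist_norm scaleR_diff_right[symmetric])
          also have "L * (t * dist w v) \<le> L * (t * \<eta>)"
            using v(2) t L by (intro mult_left_mono) (auto simp: dist_commute)
          finally show ?thesis .
        qed
        have 2: "\<bar>f (x + t *\<^sub>R v) - f x - t * (v \<bullet> ?G)\<bar> \<le> (e / 2) * t"
          using d(2)[OF v(1), of t] \<delta>(2)[OF v(1)] y t by (simp add: t_def)
        have 3: "\<bar>t * (v \<bullet> ?G) - t * (w \<bullet> ?G)\<bar> \<le> norm ?G * (t * \<eta>)"
        proof -
          have "\<bar>t * (v \<bullet> ?G) - t * (w \<bullet> ?G)\<bar> = t * \<bar>(v - w) \<bullet> ?G\<bar>"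
            using t by (simp add: inner_diff_left right_diff_distrib[symmetric] abs_mult)
          also have "\<dots> \<le> t * (norm (v - w) * norm ?G)"
            using t by (intro mult_left_mono Cauchy_Schwarz_ineq2) auto
          also have "\<dots> \<le> t * (\<eta> * norm ?G)"
            using t v(2) by (intro mult_left_mono mult_right_mono) (auto simp: dist_norm)
          finally show ?thesis by (simp add: algebra_simps)
        qed
        have "\<bar>f (x + t *\<^sub>R w) - f x - t * (w \<bullet> ?G)\<bar> \<le> L * (t * \<eta>) + (e / 2) * t + norm ?G * (t * \<eta>)"
          using 1 2 3 by linarith
        also have "\<dots> = ((L + norm ?G) * \<eta>) * t + (e / 2) * t" by (simp add: algebra_simps)
        also have "\<dots> \<le> (e / 2) * t + (e / 2) * t"
          using \<eta>le t by (intro add_right_mono mult_right_mono) auto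
        also have "\<dots> = e * t" by simp
        finally show ?thesis using t \<open>w \<in> sphere 0 1\<close> by (simp add: yw abs_mult)
      qed simp
      then show "\<exists>d>0. \<forall>y. norm (y - x) < d \<longrightarrow> norm (f y - f x - (y - x) \<bullet> ?G) \<le> e * norm (y - x)"
        using \<delta>(1) by blast
    qed
  qed
qed

text \<open>The derivative in the direction of the gradient is its squared norm. That direction
  varies with the point, so total differentiability is used here and not the almost everywhere
  statement for one fixed direction.\<close>

lemma lipschitz_AE_norm_gradient_le:
  fixes f :: "'a::euclidean_space \<Rightarrow> real"
  assumes f: "L-lipschitz_on UNIV f"
  shows "AE x in lborel. norm (lip_gradient f x) \<le> L"
proof -
  have L: "L \<ge> 0" by (rule lipschitz_on_nonneg[OF f])
  show ?thesis
    using Rademacher[OF f]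
  proof eventually_elim
    case (elim x)
    let ?G = "lip_gradient f x"
    have "((\<lambda>t. f (x + t *\<^sub>R ?G)) has_derivative (\<lambda>t. (t *\<^sub>R ?G) \<bullet> ?G)) (at 0)"
    proof (rule has_derivative_compose[of "\<lambda>t. x + t *\<^sub>R ?G" "\<lambda>t. t *\<^sub>R ?G", where g=f and g'="\<lambda>v. v \<bullet> ?G"])
      show "((\<lambda>t. x + t *\<^sub>R ?G) has_derivative (\<lambda>t. t *\<^sub>R ?G)) (at 0)" by (auto intro!: derivative_eq_intros)
    qed (use elim in simp)
    then have "((\<lambda>t. f (x + t *\<^sub>R ?G)) has_real_derivative (?G \<bullet> ?G)) (at 0)"
      by (simp add: has_field_derivative_def mult.commute[of _ "?G \<bullet> ?G"])
    then have lim: "(\<lambda>n. dir_quot f ?G n x) \<longlonglongrightarrow> ?G \<bullet> ?G" by (rule dir_quot_tendsto)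
    have "?G \<bullet> ?G \<le> L * norm ?G"
      by (rule LIMSEQ_le_const2[OF lim]) (use dir_quot_bound[OF f, of ?G] in \<open>auto intro: order_trans[OF abs_ge_self]\<close>)
    then have "norm ?G * norm ?G \<le> L * norm ?G" by (simp add: power2_norm_eq_inner[symmetric] power2_eq_square)
    then show ?case using L by (cases "norm ?G = 0") (auto simp: mult_le_cancel_right)
  qed
qed

section \<open>Integration by parts for Lipschitz functions\<close>

lemma bounded_support_radius:
  fixes \<psi> :: "'a::real_normed_vector \<Rightarrow> real"
  assumes "bounded {x. \<psi> x \<noteq> 0}"
  obtains r where "r \<ge> 0" "\<And>x. norm x > r \<Longrightarrow> \<psi> x = 0"
proof -
  obtain r0 where "\<And>x. \<psi> x \<noteq> 0 \<Longrightarrow> norm x \<le> r0" using assms unfolding bounded_iff by blast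
  then show ?thesis using that[of "max r0 0"] by (metis max.cobounded2 max_less_iff_conj not_le)
qed

lemma integrable_bounded_support:
  fixes f :: "'a::euclidean_space \<Rightarrow> real"
  assumes "continuous_on UNIV f" "bounded {x. f x \<noteq> 0}"
  shows "integrable lborel f"
proof -
  obtain r where r: "r \<ge> 0" "\<And>x. norm x > r \<Longrightarrow> f x = 0" using bounded_support_radius[OF assms(2)] by metis
  have "set_integrable lborel (cball 0 r) f"
    unfolding set_integrable_def by (intro borel_integrable_compact continuous_on_subset[OF assms(1)]) auto
  moreover have "(\<lambda>x. indicator (cball 0 r) x *\<^sub>R f x) = f"
    using r(2) by (force simp: indicator_def)
  ultimately show ?thesis by (simp add: set_integrable_def)
qed

text \<open>By translation invariance every difference quotient already has integral 0, and the
  quotients converge to the derivative when tested against a continuous function of bounded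
  support.\<close>

lemma integral_dir_deriv_bounded_support:
  fixes f :: "'a::euclidean_space \<Rightarrow> real"
  assumes f: "L-lipschitz_on UNIV f" and b: "bounded {x. f x \<noteq> 0}"
  shows "integral\<^sup>L lborel (dir_deriv f v) = 0"
proof -
  have [measurable]: "f \<in> borel_measurable borel" by (rule lipschitz_on_UNIV_measurable[OF f])
  obtain r where r: "r \<ge> 0" "\<And>x. norm x > r \<Longrightarrow> f x = 0" using bounded_support_radius[OF b] by metis
  \<comment> \<open>The increments are at most \<open>v\<close> in norm, so all difference quotients
    vanish off this ball, on which the test function is 1.\<close>
  let ?K = "cball (0::'a) (r + norm v)"
  define \<psi> where "\<psi> = plateau ?K 1"
  have \<psi>: "continuous_on UNIV \<psi>" unfolding \<psi>_def by (rule lipschitz_on_continuous_on[OF plateau_lipschitz])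
  have \<psi>1: "\<psi> x = 1" if "norm x \<le> r + norm v" for x using that by (simp add: \<psi>_def plateau_def)
  have "bounded {x. \<psi> x \<noteq> 0}"
  proof -
    have "compact {x. infdist x ?K \<le> 1}" by (rule compact_infdist_le) (use r(1) norm_ge_zero[of v] in \<open>auto simp: not_less\<close>)
    moreover have "{x. \<psi> x \<noteq> 0} \<subseteq> {x. infdist x ?K \<le> 1}" by (auto simp: \<psi>_def plateau_def)
    ultimately show ?thesis using bounded_subset compact_imp_bounded by blast
  qed
  note T = dir_quot_test_tendsto(1)[OF f \<psi> this, of v 0]
  have q0: "dir_quot f v n x = 0" if "norm x > r + norm v" for n x
  proof -
    have "norm ((1 / real (Suc n)) *\<^sub>R v) \<le> norm v" by (simp add: divide_le_eq mult_le_cancel_left1)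
    then have "norm (x + (1 / real (Suc n)) *\<^sub>R v) > r"
      using that norm_triangle_ineq4[of "x + (1 / real (Suc n)) *\<^sub>R v" "(1 / real (Suc n)) *\<^sub>R v"] by simp
    moreover have "norm x > r" using that norm_ge_zero[of v] by linarith
    ultimately show ?thesis using r(2) by (simp add: dir_quot_def)
  qed
  have qe: "dir_quot f v n x * \<psi> x = dir_quot f v n x" for n x
    using q0[of x n] \<psi>1[of x] by (cases "norm x \<le> r + norm v") auto
  have de: "dir_deriv f v x * \<psi> x = dir_deriv f v x" for x
  proof (cases "norm x \<le> r + norm v")
    case False
    then have "dir_quot f v n x = 0" for n using q0 by simp
    then have "dir_deriv f v x = 0" by (simp add: dir_deriv_def)
    then show ?thesis by simp
  qed (use \<psi>1 in simp)
  have "(\<integral>x. dir_quot f v n x \<partial>lborel) = 0" for n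
  proof -
    have i: "integrable lborel f" by (rule integrable_bounded_support[OF lipschitz_on_continuous_on[OF f] b])
    define c where "c = (1 / real (Suc n)) *\<^sub>R v"
    have i2: "integrable lborel (\<lambda>x. f (x + c))"
    proof (rule integrable_bounded_support)
      show "continuous_on UNIV (\<lambda>x. f (x + c))"
        by (intro continuous_on_compose2[OF lipschitz_on_continuous_on[OF f]] continuous_intros) auto
      have "norm x \<le> r + norm c" if "f (x + c) \<noteq> 0" for x
        using r(2)[of "x + c"] that norm_triangle_ineq4[of "x + c" c] by force
      then show "bounded {x. f (x + c) \<noteq> 0}" unfolding bounded_iff by blast
    qed
    have "(\<integral>x. (f (x + c) - f x) * real (Suc n) \<partial>lborel) = (\<integral>x. f (x + c) - f x \<partial>lborel) * real (Suc n)"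
      by simp
    also have "(\<integral>x. f (x + c) - f x \<partial>lborel) = 0"
      using i i2 integral_lborel_translation[of f c] by simp
    finally show ?thesis by (simp add: dir_quot_def c_def)
  qed
  with T have "(\<lambda>n::nat. 0) \<longlonglongrightarrow> integral\<^sup>L lborel (dir_deriv f v)" by (simp add: qe de)
  then show ?thesis by (simp add: LIMSEQ_const_iff)
qed

lemma lipschitz_mult_bounded_support:
  fixes f \<psi> :: "'a::euclidean_space \<Rightarrow> real"
  assumes f: "L-lipschitz_on UNIV f" and \<psi>: "L'-lipschitz_on UNIV \<psi>" and b: "bounded {x. \<psi> x \<noteq> 0}"
  obtains C where "C-lipschitz_on UNIV (\<lambda>x. f x * \<psi> x)"
proof -
  obtain r where r: "r \<ge> 0" "\<And>x. norm x > r \<Longrightarrow> \<psi> x = 0" using bounded_support_radius[OF b] by metis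
  have L: "L \<ge> 0" "L' \<ge> 0" using lipschitz_on_nonneg f \<psi> by auto
  define A where "A = \<bar>f 0\<bar> + L * r"
  define B where "B = \<bar>\<psi> 0\<bar> + L' * r"
  have A: "\<bar>f x\<bar> \<le> A" if "norm x \<le> r" for x
  proof -
    have "\<bar>f x - f 0\<bar> \<le> L * norm x" using lipschitz_onD[OF f, of x 0] by (simp add: dist_real_def)
    also have "\<dots> \<le> L * r" using that L by (intro mult_left_mono)
    finally show ?thesis by (simp add: A_def)
  qed
  have B: "\<bar>\<psi> x\<bar> \<le> B" for x
  proof (cases "norm x \<le> r")
    case True
    have "\<bar>\<psi> x - \<psi> 0\<bar> \<le> L' * norm x" using lipschitz_onD[OF \<psi>, of x 0] by (simp add: dist_real_def)
    also have "\<dots> \<le> L' * r" using True L by (intro mult_left_mono)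
    finally show ?thesis by (simp add: B_def)
  next
    case False
    then show ?thesis using r L by (simp add: B_def)
  qed
  have AB: "A \<ge> 0" "B \<ge> 0" using A[of 0] B[of 0] r(1) by auto
  have one: "\<bar>f x * \<psi> x - f y * \<psi> y\<bar> \<le> (A * L' + B * L) * dist x y" if "norm x \<le> r" for x y
  proof -
    have "f x * \<psi> x - f y * \<psi> y = f x * (\<psi> x - \<psi> y) + \<psi> y * (f x - f y)" by (simp add: algebra_simps)
    then have "\<bar>f x * \<psi> x - f y * \<psi> y\<bar> \<le> \<bar>f x\<bar> * \<bar>\<psi> x - \<psi> y\<bar> + \<bar>\<psi> y\<bar> * \<bar>f x - f y\<bar>"
      by (metis abs_mult abs_triangle_ineq)
    also have "\<dots> \<le> A * (L' * dist x y) + B * (L * dist x y)"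
      using A[OF that] B AB lipschitz_onD[OF f, of x y] lipschitz_onD[OF \<psi>, of x y]
      by (intro add_mono mult_mono) (auto simp: dist_real_def)
    finally show ?thesis by (simp add: algebra_simps)
  qed
  have "(A * L' + B * L)-lipschitz_on UNIV (\<lambda>x. f x * \<psi> x)"
  proof (rule lipschitz_onI)
    fix x y :: 'a
    show "dist (f x * \<psi> x) (f y * \<psi> y) \<le> (A * L' + B * L) * dist x y"
    proof (cases "norm x \<le> r \<or> norm y \<le> r")
      case True
      then show ?thesis using one[of x y] one[of y x] by (auto simp: dist_real_def abs_minus_commute dist_commute)
    next
      case False
      then show ?thesis using r AB L by simp
    qed
  qed (use AB L in simp)
  then show ?thesis by (rule that)
qed

text \<open>The product has bounded support, so its derivative integrates to 0; the product rule
  holds at almost every point.\<close>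

lemma integral_dir_deriv_by_parts:
  fixes f \<psi> :: "'a::euclidean_space \<Rightarrow> real"
  assumes f: "L-lipschitz_on UNIV f" and \<psi>: "L'-lipschitz_on UNIV \<psi>" and b: "bounded {x. \<psi> x \<noteq> 0}"
  shows "(\<integral>x. dir_deriv f v x * \<psi> x \<partial>lborel) = - (\<integral>x. f x * dir_deriv \<psi> v x \<partial>lborel)"
    and "integrable lborel (\<lambda>x. f x * dir_deriv \<psi> v x)"
proof -
  have [measurable]: "f \<in> borel_measurable borel" by (rule lipschitz_on_UNIV_measurable[OF f])
  have [measurable]: "\<psi> \<in> borel_measurable borel" by (rule lipschitz_on_UNIV_measurable[OF \<psi>])
  obtain C where C: "C-lipschitz_on UNIV (\<lambda>x. f x * \<psi> x)" using lipschitz_mult_bounded_support[OF f \<psi> b] by metis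
  have b2: "bounded {x. f x * \<psi> x \<noteq> 0}" by (rule bounded_subset[OF b]) auto
  have ae: "AE x in lborel. dir_deriv (\<lambda>x. f x * \<psi> x) v x = dir_deriv f v x * \<psi> x + f x * dir_deriv \<psi> v x"
    using lipschitz_AE_directional[OF f, of v] lipschitz_AE_directional[OF \<psi>, of v]
  proof eventually_elim
    case (elim x)
    show ?case by (rule dir_deriv_eq) (use DERIV_mult[OF elim] in \<open>simp add: mult.commute\<close>)
  qed
  obtain r where r: "r \<ge> 0" "\<And>x. norm x > r \<Longrightarrow> \<psi> x = 0" using bounded_support_radius[OF b] by metis
  have d0: "dir_deriv \<psi> v x = 0" if "norm x > r" for x
  proof (rule dir_deriv_eq)
    have "open {t::real. r < norm (x + t *\<^sub>R v)}" by (intro open_Collect_less continuous_intros)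
    then have "\<forall>\<^sub>F t::real in nhds 0. r < norm (x + t *\<^sub>R v)"
      unfolding eventually_nhds using that by (intro exI[of _ "{t::real. r < norm (x + t *\<^sub>R v)}"]) simp
    then have "\<forall>\<^sub>F t in nhds 0. \<psi> (x + t *\<^sub>R v) = 0" by eventually_elim (use r(2) in simp)
    then show "((\<lambda>t. \<psi> (x + t *\<^sub>R v)) has_real_derivative 0) (at 0)"
      by (subst DERIV_cong_ev[OF refl _ refl, where g="\<lambda>_. 0"]) auto
  qed
  \<comment> \<open>\<open>f\<close> need not have bounded support. Since \<phi> is 1 wherever the
    derivative of \<psi> can be nonzero, \<open>f\<close> may be replaced by its product with
    \<phi>, which is an admissible test function for the derivative of \<psi>.\<close>
  define \<phi> where "\<phi> = plateau (cball (0::'a) r) 1"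
  have \<phi>: "1-lipschitz_on UNIV \<phi>" using plateau_lipschitz[of 1] by (simp add: \<phi>_def)
  have \<phi>b: "bounded {x. \<phi> x \<noteq> 0}"
  proof -
    have "compact {x. infdist x (cball (0::'a) r) \<le> 1}" by (rule compact_infdist_le) (use r(1) in auto)
    moreover have "{x. \<phi> x \<noteq> 0} \<subseteq> {x. infdist x (cball 0 r) \<le> 1}" by (auto simp: \<phi>_def plateau_def)
    ultimately show ?thesis using bounded_subset compact_imp_bounded by blast
  qed
  have f\<phi>: "f x * dir_deriv \<psi> v x = dir_deriv \<psi> v x * (f x * \<phi> x)" for x
    using d0[of x] by (cases "norm x \<le> r") (auto simp: \<phi>_def plateau_def)
  obtain C' where C': "C'-lipschitz_on UNIV (\<lambda>x. f x * \<phi> x)" using lipschitz_mult_bounded_support[OF f \<phi> \<phi>b] by metis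
  show i2: "integrable lborel (\<lambda>x. f x * dir_deriv \<psi> v x)"
    unfolding f\<phi> by (rule dir_quot_test_tendsto(3)[OF \<psi> lipschitz_on_continuous_on[OF C']])
       (rule bounded_subset[OF \<phi>b], auto)
  have i1: "integrable lborel (\<lambda>x. dir_deriv f v x * \<psi> x)"
    by (rule dir_quot_test_tendsto(3)[OF f lipschitz_on_continuous_on[OF \<psi>] b])
  have "0 = (\<integral>x. dir_deriv f v x * \<psi> x + f x * dir_deriv \<psi> v x \<partial>lborel)"
    using integral_dir_deriv_bounded_support[OF C b2, of v] integral_cong_AE[OF _ _ ae] by simp
  also have "\<dots> = (\<integral>x. dir_deriv f v x * \<psi> x \<partial>lborel) + (\<integral>x. f x * dir_deriv \<psi> v x \<partial>lborel)"
    using i1 i2 by simp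
  finally show "(\<integral>x. dir_deriv f v x * \<psi> x \<partial>lborel) = - (\<integral>x. f x * dir_deriv \<psi> v x \<partial>lborel)" by simp
qed

section \<open>Uniqueness of weak gradients\<close>

lemma compact_lebesgue:
  fixes S :: "'a::euclidean_space set"
  assumes "compact S"
  shows "S \<in> sets lebesgue" "emeasure lebesgue S < \<infinity>"
  using fmeasurableD[OF lmeasurable_compact[OF assms]] fmeasurableD2[OF lmeasurable_compact[OF assms]]
  unfolding infinity_ennreal_def less_top by blast+

text \<open>The pointwise inequality
  \<open>\<bar>a\<bar> \<le> \<epsilon> + a\<^sup>2 / \<epsilon>\<close> replaces the Cauchy-Schwarz
  inequality for integrals. With \<open>I = \<epsilon> * \<epsilon>\<close> the bound is a multiple
  of \<epsilon>.\<close>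

lemma abs_integral_le_by_squares:
  fixes g :: "'a::euclidean_space \<Rightarrow> real"
  assumes S: "compact S" and g: "(\<lambda>x. indicator S x * g x) \<in> borel_measurable lebesgue"
    and I: "(\<integral>\<^sup>+x\<in>S. ennreal ((g x)\<^sup>2) \<partial>lebesgue) \<le> ennreal I" "I \<ge> 0"
    and \<epsilon>: "\<epsilon> > 0"
  shows "set_integrable lebesgue S g"
    and "(\<integral>x. \<bar>indicator S x * g x\<bar> \<partial>lebesgue) \<le> \<epsilon> * measure lebesgue S + I / \<epsilon>"
proof -
  have S': "S \<in> sets lebesgue" "emeasure lebesgue S < \<infinity>"
    using compact_lebesgue[OF S] by blast+
  have AM: "\<bar>a\<bar> \<le> \<epsilon> + (a\<^sup>2) / \<epsilon>" for a :: real
  proof -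
    have "0 \<le> (\<bar>a\<bar> - \<epsilon>)\<^sup>2" by simp
    then have "2 * (\<bar>a\<bar> * \<epsilon>) \<le> \<epsilon>\<^sup>2 + a\<^sup>2" by (simp add: power2_diff)
    moreover have "0 \<le> \<bar>a\<bar> * \<epsilon>" using \<epsilon> by simp
    ultimately have "\<bar>a\<bar> * \<epsilon> \<le> \<epsilon>\<^sup>2 + a\<^sup>2" by linarith
    then show ?thesis using \<epsilon> by (simp add: field_simps power2_eq_square)
  qed
  have g2: "(\<lambda>x. ennreal ((g x)\<^sup>2) * indicator S x) = (\<lambda>x. ennreal ((indicator S x * g x)\<^sup>2))"
    by (auto simp: indicator_def)
  have m2: "(\<lambda>x. ennreal ((indicator S x * g x)\<^sup>2)) \<in> borel_measurable lebesgue" using g by measurable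
  have "(\<integral>\<^sup>+x. ennreal \<bar>indicator S x * g x\<bar> \<partial>lebesgue)
      \<le> (\<integral>\<^sup>+x. ennreal \<epsilon> * indicator S x + ennreal (1 / \<epsilon>) * ennreal ((indicator S x * g x)\<^sup>2) \<partial>lebesgue)"
  proof (rule nn_integral_mono)
    fix x
    show "ennreal \<bar>indicator S x * g x\<bar> \<le> ennreal \<epsilon> * indicator S x + ennreal (1 / \<epsilon>) * ennreal ((indicator S x * g x)\<^sup>2)"
    proof (cases "x \<in> S")
      case True
      then show ?thesis using AM[of "g x"] \<epsilon>
        by (simp add: ennreal_mult[symmetric] ennreal_plus[symmetric] ennreal_leI del: ennreal_plus)
    qed simp
  qed
  also have "\<dots> = ennreal \<epsilon> * emeasure lebesgue S + ennreal (1 / \<epsilon>) * (\<integral>\<^sup>+x. ennreal ((indicator S x * g x)\<^sup>2) \<partial>lebesgue)"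
    using S' m2 by (subst nn_integral_add) (auto simp: nn_integral_cmult_indicator nn_integral_cmult)
  also have "\<dots> \<le> ennreal \<epsilon> * emeasure lebesgue S + ennreal (1 / \<epsilon>) * ennreal I"
    using I(1) unfolding g2 by (intro add_left_mono mult_left_mono) auto
  also have "\<dots> = ennreal (\<epsilon> * measure lebesgue S + I / \<epsilon>)"
    using S' \<epsilon> I(2) by (subst emeasure_eq_ennreal_measure)
      (auto simp: ennreal_mult[symmetric] ennreal_plus[symmetric] simp del: ennreal_plus)
  finally have bound: "(\<integral>\<^sup>+x. ennreal \<bar>indicator S x * g x\<bar> \<partial>lebesgue) \<le> ennreal (\<epsilon> * measure lebesgue S + I / \<epsilon>)" .
  have int: "integrable lebesgue (\<lambda>x. indicator S x * g x)"
    using bound by (intro integrableI_bounded g) (auto simp: le_less_trans)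
  then show "set_integrable lebesgue S g" by (simp add: set_integrable_def)
  have "ennreal (\<integral>x. \<bar>indicator S x * g x\<bar> \<partial>lebesgue) = (\<integral>\<^sup>+x. ennreal \<bar>indicator S x * g x\<bar> \<partial>lebesgue)"
    using int by (intro nn_integral_eq_integral[symmetric]) auto
  with bound have "ennreal (\<integral>x. \<bar>indicator S x * g x\<bar> \<partial>lebesgue) \<le> ennreal (\<epsilon> * measure lebesgue S + I / \<epsilon>)"
    by simp
  then show "(\<integral>x. \<bar>indicator S x * g x\<bar> \<partial>lebesgue) \<le> \<epsilon> * measure lebesgue S + I / \<epsilon>"
    by (subst (asm) ennreal_le_iff) (use \<epsilon> I(2) in auto)
qed

text \<open>Tested against a plateau function, the derivative of \<open>w k\<close> moves onto the
  test function and leaves \<open>w k\<close> itself as a factor, which tends to 0 in square mean.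
  So the limit \<open>H\<close> annihilates all test functions. The constants \<open>L k\<close> may
  grow without bound, and no estimate uniform in \<open>k\<close> refers to them.\<close>

theorem weak_gradient_closable:
  fixes w :: "nat \<Rightarrow> 'a::euclidean_space \<Rightarrow> real"
  assumes O: "open O'"
    and w: "\<And>k. (L k)-lipschitz_on UNIV (w k)"
    and H: "(\<lambda>x. indicator O' x *\<^sub>R H x) \<in> borel_measurable lebesgue"
    and lim: "(\<lambda>k. \<integral>\<^sup>+x\<in>O'. ennreal ((w k x)\<^sup>2 + (norm (lip_gradient (w k) x - H x))\<^sup>2) \<partial>lebesgue) \<longlonglongrightarrow> 0"
  shows "AE x in lebesgue. x \<in> O' \<longrightarrow> H x = 0"
proof -
  have wm [measurable]: "w k \<in> borel_measurable borel" for k by (rule lipschitz_on_UNIV_measurable[OF w])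
  define J where "J k = (\<integral>\<^sup>+x\<in>O'. ennreal ((w k x)\<^sup>2 + (norm (lip_gradient (w k) x - H x))\<^sup>2) \<partial>lebesgue)" for k
  have J: "J \<longlonglongrightarrow> 0" using lim by (simp add: J_def[abs_def])
  have Jle: "\<exists>k. J k \<le> ennreal I" if "I > 0" for I
  proof -
    have "\<forall>\<^sub>F k in sequentially. J k < ennreal I" using J that by (intro order_tendstoD) auto
    then show ?thesis using eventually_happens' less_imp_le by (metis trivial_limit_sequentially)
  qed
  have comp: "AE x in lebesgue. x \<in> O' \<longrightarrow> H x \<bullet> b = 0" if b: "b \<in> Basis" for b
  proof (rule AE_zero_by_test_functions[OF O])
    have b1: "norm b = 1" using b by simp
    have Hb: "(\<lambda>x. indicator S x * (H x \<bullet> b)) \<in> borel_measurable lebesgue" if "compact S" "S \<subseteq> O'" for S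
    proof -
      have "(\<lambda>x. indicator S x * ((indicator O' x *\<^sub>R H x) \<bullet> b)) \<in> borel_measurable lebesgue"
        by (intro borel_measurable_times borel_measurable_indicator borel_measurable_inner H)
           (use compact_lebesgue(1)[OF that(1)] in auto)
      also have "(\<lambda>x. indicator S x * ((indicator O' x *\<^sub>R H x) \<bullet> b)) = (\<lambda>x. indicator S x * (H x \<bullet> b))"
        using that by (auto simp: indicator_def fun_eq_iff)
      finally show ?thesis .
    qed
    have bnd: "set_integrable lebesgue S (\<lambda>x. dir_deriv (w k) b x - H x \<bullet> b)" (is ?A)
       "(\<integral>x. \<bar>indicator S x * (dir_deriv (w k) b x - H x \<bullet> b)\<bar> \<partial>lebesgue) \<le> \<epsilon> * measure lebesgue S + I / \<epsilon>" (is ?B)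
       "(\<integral>x. \<bar>indicator S x * w k x\<bar> \<partial>lebesgue) \<le> \<epsilon> * measure lebesgue S + I / \<epsilon>" (is ?C)
       "set_integrable lebesgue S (w k)" (is ?D)
      if S: "compact S" "S \<subseteq> O'" and k: "J k \<le> ennreal I" and I: "I \<ge> 0" and \<epsilon>: "\<epsilon> > 0" for S k I \<epsilon>
    proof -
      have le: "\<bar>dir_deriv (w k) b x - H x \<bullet> b\<bar> \<le> norm (lip_gradient (w k) x - H x)" for x
        using Cauchy_Schwarz_ineq2[of "lip_gradient (w k) x - H x" b] b b1
        by (simp add: inner_diff_left lip_gradient_inner_Basis)
      have I1: "(\<integral>\<^sup>+x\<in>S. ennreal ((dir_deriv (w k) b x - H x \<bullet> b)\<^sup>2) \<partial>lebesgue) \<le> J k"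
        unfolding J_def
      proof (rule nn_integral_mono)
        fix x
        have "(dir_deriv (w k) b x - H x \<bullet> b)\<^sup>2 \<le> (w k x)\<^sup>2 + (norm (lip_gradient (w k) x - H x))\<^sup>2"
          using power_mono[OF le[of x], of 2] zero_le_power2[of "w k x"]
          unfolding power2_abs by linarith
        then show "ennreal ((dir_deriv (w k) b x - H x \<bullet> b)\<^sup>2) * indicator S x
          \<le> ennreal ((w k x)\<^sup>2 + (norm (lip_gradient (w k) x - H x))\<^sup>2) * indicator O' x"
          using S(2) by (auto simp: indicator_def simp del: ennreal_plus intro: ennreal_leI)
      qed
      have I2: "(\<integral>\<^sup>+x\<in>S. ennreal ((w k x)\<^sup>2) \<partial>lebesgue) \<le> J k"
        unfolding J_def
        by (rule nn_integral_mono) (use S(2) in \<open>auto simp: indicator_def simp del: ennreal_plus intro!: ennreal_leI\<close>)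
      have wl: "w k \<in> borel_measurable lebesgue" by (rule measurable_completion) simp
      have dl: "dir_deriv (w k) b \<in> borel_measurable lebesgue" by (rule measurable_completion) simp
      have Sl: "S \<in> sets lebesgue" by (rule compact_lebesgue(1)[OF S(1)])
      have m1: "(\<lambda>x. indicator S x * (dir_deriv (w k) b x - H x \<bullet> b)) \<in> borel_measurable lebesgue"
      proof -
        have "(\<lambda>x. indicator S x * dir_deriv (w k) b x - indicator S x * (H x \<bullet> b)) \<in> borel_measurable lebesgue"
          by (intro borel_measurable_diff Hb S borel_measurable_times borel_measurable_indicator Sl dl)
        then show ?thesis by (simp add: right_diff_distrib)
      qed
      have m2: "(\<lambda>x. indicator S x * w k x) \<in> borel_measurable lebesgue"
        by (intro borel_measurable_times borel_measurable_indicator Sl wl)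
      show ?A ?B using abs_integral_le_by_squares[OF S(1) m1 order_trans[OF I1 k] I \<epsilon>] by auto
      show ?C ?D using abs_integral_le_by_squares[OF S(1) m2 order_trans[OF I2 k] I \<epsilon>] by auto
    qed
    \<comment> \<open>A single \<open>k\<close> is enough: the derivative of \<open>w k\<close> is
      bounded by \<open>L k\<close>, and its difference from \<open>H\<close> is square
      integrable.\<close>
    show "set_integrable lebesgue S (\<lambda>x. H x \<bullet> b)" if S: "compact S" "S \<subseteq> O'" for S
    proof -
      obtain k where k: "J k \<le> ennreal 1" using Jle[of 1] by auto
      have "set_integrable lebesgue S (dir_deriv (w k) b)"
        unfolding set_integrable_def
      proof (rule integrableI_bounded_set_indicator[where B="L k"])
        show "AE x in lebesgue. x \<in> S \<longrightarrow> norm (dir_deriv (w k) b x) \<le> L k"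
          using AE_completion[OF lipschitz_AE_norm_gradient_le[OF w, of k]]
        proof eventually_elim
          case (elim x)
          have "\<bar>lip_gradient (w k) x \<bullet> b\<bar> \<le> norm (lip_gradient (w k) x) * norm b" by (rule Cauchy_Schwarz_ineq2)
          then show ?case using elim b b1 by (simp add: lip_gradient_inner_Basis)
        qed
        show "S \<in> sets lebesgue" "emeasure lebesgue S < \<infinity>"
          using compact_lebesgue[OF S(1)] by blast+
        show "dir_deriv (w k) b \<in> borel_measurable lebesgue" by (rule measurable_completion) simp
      qed
      from set_integral_diff(1)[OF this bnd(1)[OF S k, of 1]] show ?thesis by simp
    qed
    show "integral\<^sup>L lebesgue (\<lambda>x. (H x \<bullet> b) * plateau K m x) = 0"
      if K: "compact K" "K \<noteq> {}" "bounded {x. plateau K m x \<noteq> 0}" "closure {x. plateau K m x \<noteq> 0} \<subseteq> O'" for K m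
    proof -
      define \<psi> where "\<psi> = plateau K m"
      define S where "S = closure {x. \<psi> x \<noteq> 0}"
      have S: "compact S" "S \<subseteq> O'" using K by (auto simp: S_def \<psi>_def)
      have \<psi>S: "\<psi> x = 0" if "x \<notin> S" for x using that closure_subset[of "{x. \<psi> x \<noteq> 0}"] by (auto simp: S_def)
      have \<psi>b: "0 \<le> \<psi> x" "\<psi> x \<le> 1" for x by (auto simp: \<psi>_def plateau_bounds)
      have \<psi>L: "(real m)-lipschitz_on UNIV \<psi>" unfolding \<psi>_def by (rule plateau_lipschitz)
      have [measurable]: "\<psi> \<in> borel_measurable borel" by (simp add: \<psi>_def)
      have bd: "bounded {x. \<psi> x \<noteq> 0}" using K by (simp add: \<psi>_def)
      have d0: "dir_deriv \<psi> b x = 0" if "x \<notin> S" for x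
      proof (rule dir_deriv_eq)
        have "open ((\<lambda>t::real. x + t *\<^sub>R b) -` (- S))"
          by (intro open_vimage) (auto simp: S_def intro!: continuous_intros)
        then have "\<forall>\<^sub>F t::real in nhds 0. x + t *\<^sub>R b \<notin> S"
          unfolding eventually_nhds using that by (intro exI[of _ "(\<lambda>t::real. x + t *\<^sub>R b) -` (- S)"]) simp
        then have "\<forall>\<^sub>F t in nhds 0. \<psi> (x + t *\<^sub>R b) = 0" by eventually_elim (use \<psi>S in simp)
        then show "((\<lambda>t. \<psi> (x + t *\<^sub>R b)) has_real_derivative 0) (at 0)"
          by (subst DERIV_cong_ev[OF refl _ refl, where g="\<lambda>_. 0"]) auto
      qed
      have d1: "AE x in lebesgue. \<bar>dir_deriv \<psi> b x\<bar> \<le> real m"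
        using AE_completion[OF lipschitz_AE_norm_gradient_le[OF \<psi>L]]
      proof eventually_elim
        case (elim x)
        have "\<bar>lip_gradient \<psi> x \<bullet> b\<bar> \<le> norm (lip_gradient \<psi> x) * norm b" by (rule Cauchy_Schwarz_ineq2)
        then show ?case using elim b b1 by (simp add: lip_gradient_inner_Basis)
      qed
      define T where "T = integral\<^sup>L lebesgue (\<lambda>x. (H x \<bullet> b) * \<psi> x)"
      \<comment> \<open>The index \<open>k\<close> is chosen according to \<open>I\<close> and
        leaves no trace in the bound. One summand is the error of replacing \<open>H\<close> by the
        derivative of \<open>w k\<close>; the factor \<open>real m\<close> of the other is the slope
        of the test function that receives the derivative.\<close>
      have est: "\<bar>T\<bar> \<le> (1 + real m) * (\<epsilon> * measure lebesgue S + I / \<epsilon>)" if \<epsilon>: "\<epsilon> > 0" and I: "I > 0" for \<epsilon> I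
      proof -
        obtain k where k: "J k \<le> ennreal I" using Jle[OF I] by auto
        note B = bnd[OF S k less_imp_le[OF I] \<epsilon>]
        have wl: "w k \<in> borel_measurable lebesgue" by (rule measurable_completion) simp
        have dl: "dir_deriv \<psi> b \<in> borel_measurable lebesgue" by (rule measurable_completion) simp
        have pl: "\<psi> \<in> borel_measurable lebesgue" by (rule measurable_completion) simp
        have i1: "integrable lebesgue (\<lambda>x. \<bar>indicator S x * (dir_deriv (w k) b x - H x \<bullet> b)\<bar>)"
          using B(1) by (intro integrable_abs) (simp add: set_integrable_def)
        have i2: "integrable lebesgue (\<lambda>x. (indicator S x * (dir_deriv (w k) b x - H x \<bullet> b)) * \<psi> x)"
        proof (rule Bochner_Integration.integrable_bound[OF i1])
          show "(\<lambda>x. indicator S x * (dir_deriv (w k) b x - H x \<bullet> b) * \<psi> x) \<in> borel_measurable lebesgue"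
            using B(1) pl by (intro borel_measurable_times[OF _ pl]) (auto simp: set_integrable_def)
          show "AE x in lebesgue. norm (indicator S x * (dir_deriv (w k) b x - H x \<bullet> b) * \<psi> x)
             \<le> norm \<bar>indicator S x * (dir_deriv (w k) b x - H x \<bullet> b)\<bar>"
            using \<psi>b by (intro AE_I2) (simp add: abs_mult mult_left_le)
        qed
        have j1: "\<bar>integral\<^sup>L lebesgue (\<lambda>x. (indicator S x * (dir_deriv (w k) b x - H x \<bullet> b)) * \<psi> x)\<bar>
            \<le> \<epsilon> * measure lebesgue S + I / \<epsilon>"
        proof -
          have "\<bar>integral\<^sup>L lebesgue (\<lambda>x. (indicator S x * (dir_deriv (w k) b x - H x \<bullet> b)) * \<psi> x)\<bar>
             \<le> integral\<^sup>L lebesgue (\<lambda>x. \<bar>(indicator S x * (dir_deriv (w k) b x - H x \<bullet> b)) * \<psi> x\<bar>)"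
            by (rule integral_abs_bound)
          also have "\<dots> \<le> integral\<^sup>L lebesgue (\<lambda>x. \<bar>indicator S x * (dir_deriv (w k) b x - H x \<bullet> b)\<bar>)"
            using \<psi>b by (intro integral_mono integrable_abs[OF i2] i1) (simp add: abs_mult mult_left_le)
          finally show ?thesis using B(2) by simp
        qed
        have p: "(\<integral>x. dir_deriv (w k) b x * \<psi> x \<partial>lebesgue) = - (\<integral>x. w k x * dir_deriv \<psi> b x \<partial>lebesgue)"
          using integral_dir_deriv_by_parts(1)[OF w \<psi>L bd, of k b] by (subst (1 2) integral_completion) auto
        have i3: "integrable lebesgue (\<lambda>x. dir_deriv (w k) b x * \<psi> x)"
          using dir_quot_test_tendsto(3)[OF w lipschitz_on_continuous_on[OF \<psi>L] bd] by (subst integrable_completion) auto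
        have i4: "integrable lebesgue (\<lambda>x. w k x * dir_deriv \<psi> b x)"
          using integral_dir_deriv_by_parts(2)[OF w \<psi>L bd] by (subst integrable_completion) auto
        have i5: "integrable lebesgue (\<lambda>x. real m * \<bar>indicator S x * w k x\<bar>)"
          using B(4) by (intro integrable_mult_right integrable_abs) (simp add: set_integrable_def)
        have j2: "\<bar>integral\<^sup>L lebesgue (\<lambda>x. w k x * dir_deriv \<psi> b x)\<bar> \<le> real m * (\<epsilon> * measure lebesgue S + I / \<epsilon>)"
        proof -
          have "\<bar>integral\<^sup>L lebesgue (\<lambda>x. w k x * dir_deriv \<psi> b x)\<bar> \<le> integral\<^sup>L lebesgue (\<lambda>x. \<bar>w k x * dir_deriv \<psi> b x\<bar>)"
            by (rule integral_abs_bound)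
          also have "\<dots> \<le> integral\<^sup>L lebesgue (\<lambda>x. real m * \<bar>indicator S x * w k x\<bar>)"
          proof (rule integral_mono_AE[OF integrable_abs[OF i4] i5])
            show "AE x in lebesgue. \<bar>w k x * dir_deriv \<psi> b x\<bar> \<le> real m * \<bar>indicator S x * w k x\<bar>"
              using d1
            proof eventually_elim
              case (elim x)
              then show ?case using d0[of x]
                by (cases "x \<in> S") (auto simp: abs_mult mult.commute[of "\<bar>w k x\<bar>"] mult_right_mono)
            qed
          qed
          also have "\<dots> = real m * integral\<^sup>L lebesgue (\<lambda>x. \<bar>indicator S x * w k x\<bar>)" by simp
          also have "\<dots> \<le> real m * (\<epsilon> * measure lebesgue S + I / \<epsilon>)" using B(3) by (intro mult_left_mono) auto
          finally show ?thesis .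
        qed
        have "(\<lambda>x. (H x \<bullet> b) * \<psi> x) = (\<lambda>x. dir_deriv (w k) b x * \<psi> x - (indicator S x * (dir_deriv (w k) b x - H x \<bullet> b)) * \<psi> x)"
        proof
          fix x show "(H x \<bullet> b) * \<psi> x = dir_deriv (w k) b x * \<psi> x - (indicator S x * (dir_deriv (w k) b x - H x \<bullet> b)) * \<psi> x"
            using \<psi>S[of x] by (cases "x \<in> S") (auto simp: algebra_simps)
        qed
        then have "T = (\<integral>x. dir_deriv (w k) b x * \<psi> x \<partial>lebesgue)
             - (\<integral>x. (indicator S x * (dir_deriv (w k) b x - H x \<bullet> b)) * \<psi> x \<partial>lebesgue)"
          unfolding T_def using i2 i3 by simp
        then have "\<bar>T\<bar> \<le> (\<epsilon> * measure lebesgue S + I / \<epsilon>) + real m * (\<epsilon> * measure lebesgue S + I / \<epsilon>)"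
          using j1 j2 p by linarith
        then show ?thesis by (simp add: algebra_simps)
      qed
      \<comment> \<open>This is the factor of \<epsilon> in \<open>est\<close> for
        \<open>I = \<epsilon> * \<epsilon>\<close>.\<close>
      define A where "A = (1 + real m) * (measure lebesgue S + 1)"
      have A: "A > 0" unfolding A_def by (intro mult_pos_pos) (simp_all add: add_nonneg_pos)
      have small: "\<bar>T\<bar> \<le> A * \<epsilon>" if "\<epsilon> > 0" for \<epsilon>
        using est[OF that, of "\<epsilon> * \<epsilon>"] that by (simp add: A_def algebra_simps)
      have "\<bar>T\<bar> \<le> 0"
      proof (rule field_le_epsilon)
        fix e :: real assume e: "e > 0"
        show "\<bar>T\<bar> \<le> 0 + e" using small[of "e / A"] e A by simp
      qed
      then show ?thesis by (simp add: T_def \<psi>_def)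
    qed
  qed
  have "AE x in lebesgue. \<forall>b\<in>Basis. x \<in> O' \<longrightarrow> H x \<bullet> b = 0"
    using comp by (subst AE_ball_countable) (auto intro: countable_finite)
  then show ?thesis by eventually_elim (auto simp: euclidean_eq_iff[where 'a='a])
qed

section \<open>Geometry of Riemannian polyhedra\<close>

lemma bary_dist_nonneg: "0 \<le> bary_dist \<alpha> \<beta>"
  by (simp add: bary_dist_def sum_nonneg)

lemma locally_lipschitz_compose:
  assumes h: "locally_lipschitz S d d' h" and k: "locally_lipschitz T d' d'' k" and sub: "h ` S \<subseteq> T"
    and d: "\<And>x. d x x = 0" "\<And>x y. 0 \<le> d x y" and d': "\<And>x y. 0 \<le> d' x y"
  shows "locally_lipschitz S d d'' (\<lambda>x. k (h x))"
  unfolding locally_lipschitz_def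
proof
  fix x assume x: "x \<in> S"
  obtain r1 C1 where 1: "r1 > 0" "\<And>y z. y \<in> S \<Longrightarrow> z \<in> S \<Longrightarrow> d x y < r1 \<Longrightarrow> d x z < r1 \<Longrightarrow> d' (h y) (h z) \<le> C1 * d y z"
    using h x unfolding locally_lipschitz_def by metis
  obtain r2 C2 where 2: "r2 > 0" "\<And>y z. y \<in> T \<Longrightarrow> z \<in> T \<Longrightarrow> d' (h x) y < r2 \<Longrightarrow> d' (h x) z < r2 \<Longrightarrow> d'' (k y) (k z) \<le> C2 * d' y z"
  proof -
    have "h x \<in> T" using x sub by blast
    then show ?thesis using that k unfolding locally_lipschitz_def by metis
  qed
  \<comment> \<open>The given constants may be negative; moreover \<open>D1\<close> has to be
    positive because a radius is divided by it.\<close>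
  define D1 where "D1 = max C1 1"
  define D2 where "D2 = max C2 0"
  have D1: "D1 > 0" "C1 \<le> D1" and D2: "D2 \<ge> 0" "C2 \<le> D2" by (auto simp: D1_def D2_def)
  have lip1: "d' (h y) (h z) \<le> D1 * d y z" if "y \<in> S" "z \<in> S" "d x y < r1" "d x z < r1" for y z
    using 1(2)[OF that] mult_right_mono[OF D1(2) d(2)[of y z]] by linarith
  have near: "d' (h x) (h y) < r2" if "y \<in> S" "d x y < min r1 (r2 / D1)" for y
  proof -
    have "d' (h x) (h y) \<le> D1 * d x y" using that x d(1) 1(1) by (intro lip1) auto
    also have "\<dots> < r2" using that D1 by (simp add: pos_less_divide_eq mult.commute)
    finally show ?thesis .
  qed
  have "d'' (k (h y)) (k (h z)) \<le> (D2 * D1) * d y z"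
    if "y \<in> S" "z \<in> S" "d x y < min r1 (r2 / D1)" "d x z < min r1 (r2 / D1)" for y z
  proof -
    have "d'' (k (h y)) (k (h z)) \<le> C2 * d' (h y) (h z)"
      using that near sub by (intro 2(2)) auto
    also have "\<dots> \<le> D2 * d' (h y) (h z)" by (intro mult_right_mono D2 d')
    also have "\<dots> \<le> D2 * (D1 * d y z)" using that by (intro mult_left_mono lip1 D2) auto
    finally show ?thesis by (simp add: mult.assoc)
  qed
  moreover have "min r1 (r2 / D1) > 0" using 1(1) 2(1) D1 by simp
  ultimately show "\<exists>r>0. \<exists>C. \<forall>y\<in>S. \<forall>z\<in>S. d x y < r \<and> d x z < r \<longrightarrow> d'' (k (h y)) (k (h z)) \<le> C * d y z"
    by blast
qed

lemma locally_lipschitz_continuous_on: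
  fixes h :: "'a::metric_space \<Rightarrow> 'b::metric_space"
  assumes "locally_lipschitz S dist dist h"
  shows "continuous_on S h"
  unfolding continuous_on_iff
proof (intro ballI allI impI)
  fix x and e :: real assume x: "x \<in> S" and e: "e > 0"
  obtain r C where r: "r > 0" "\<And>y z. y \<in> S \<Longrightarrow> z \<in> S \<Longrightarrow> dist x y < r \<Longrightarrow> dist x z < r \<Longrightarrow> dist (h y) (h z) \<le> C * dist y z"
    using assms x unfolding locally_lipschitz_def by metis
  define D where "D = max C 1"
  have D: "D > 0" "C \<le> D" by (auto simp: D_def)
  show "\<exists>d>0. \<forall>x'\<in>S. dist x' x < d \<longrightarrow> dist (h x') (h x) < e"
  proof (intro exI[of _ "min r (e / D)"] conjI ballI impI)
    fix y assume y: "y \<in> S" "dist y x < min r (e / D)"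
    have "dist (h y) (h x) \<le> C * dist y x" using y x r(1) by (intro r(2)) (auto simp: dist_commute)
    also have "\<dots> \<le> D * dist y x" by (intro mult_right_mono D) auto
    also have "\<dots> < e" using y D by (simp add: pos_less_divide_eq mult.commute)
    finally show "dist (h y) (h x) < e" .
  qed (use r(1) e D in simp)
qed

lemma locally_lipschitz_compact_imp_lipschitz:
  fixes h :: "'a::metric_space \<Rightarrow> 'b::metric_space"
  assumes h: "locally_lipschitz S dist dist h" and S: "compact S"
  obtains C where "C-lipschitz_on S h"
proof -
  \<comment> \<open>\<open>local_lipschitz\<close> concerns families of maps; here the family is
    constant over a one-point parameter set.\<close>
  have ll: "local_lipschitz {0::real} S (\<lambda>_. h)"
  proof (rule local_lipschitzI)
    fix t :: real and x assume "t \<in> {0}" and x: "x \<in> S"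
    obtain r C where r: "r > 0" "\<And>y z. y \<in> S \<Longrightarrow> z \<in> S \<Longrightarrow> dist x y < r \<Longrightarrow> dist x z < r \<Longrightarrow> dist (h y) (h z) \<le> C * dist y z"
      using h x unfolding locally_lipschitz_def by metis
    have "(max C 0)-lipschitz_on (cball x (r/2) \<inter> S) h"
    proof (rule lipschitz_onI)
      fix y z assume "y \<in> cball x (r/2) \<inter> S" "z \<in> cball x (r/2) \<inter> S"
      then have "dist (h y) (h z) \<le> C * dist y z" using r(1) by (intro r(2)) auto
      also have "\<dots> \<le> max C 0 * dist y z" by (intro mult_right_mono) auto
      finally show "dist (h y) (h z) \<le> max C 0 * dist y z" .
    qed simp
    then show "\<exists>u>0. \<exists>L. \<forall>t\<in>cball t u \<inter> {0}. L-lipschitz_on (cball x u \<inter> S) h"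
      using r(1) by (intro exI[of _ "r/2"]) auto
  qed
  obtain C where "\<And>t. t \<in> {0::real} \<Longrightarrow> C-lipschitz_on S h"
    by (rule local_lipschitz_compact_implies_lipschitz[OF ll S compact_sing]) auto
  then show ?thesis using that by blast
qed

text \<open>By polarization, the distances between images and to the image of 0 determine the inner
  products, and then the squared norm of each defect of linearity expands to 0. The image may be a
  proper affine subspace of the target.\<close>

lemma isometry_affine:
  fixes f :: "'a::real_inner \<Rightarrow> 'b::real_inner"
  assumes "\<And>x y. dist (f x) (f y) = dist x y"
  shows "linear (\<lambda>x. f x - f 0)"
proof -
  define A where "A x = f x - f 0" for x
  have n: "norm (A x - A y) = norm (x - y)" for x y using assms by (simp add: A_def dist_norm)
  have n0: "norm (A x) = norm x" for x using n[of x 0] by (simp add: A_def)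
  have i: "A x \<bullet> A y = x \<bullet> y" for x y
  proof -
    have "(norm (A x - A y))\<^sup>2 = (norm (x - y))\<^sup>2" by (simp add: n)
    then have "(norm (A x))\<^sup>2 - 2 * (A x \<bullet> A y) + (norm (A y))\<^sup>2 = (norm x)\<^sup>2 - 2 * (x \<bullet> y) + (norm y)\<^sup>2"
      by (simp add: power2_norm_eq_inner inner_diff_left inner_diff_right inner_commute)
    then show ?thesis by (simp add: n0)
  qed
  have "A (x + y) - A x - A y = 0" for x y
  proof -
    have "(A (x + y) - A x - A y) \<bullet> (A (x + y) - A x - A y) = 0"
      by (simp add: inner_diff_left inner_diff_right i inner_add_left inner_add_right inner_commute)
    then show ?thesis by (simp only: inner_eq_zero_iff)
  qed
  moreover have "A (c *\<^sub>R x) - c *\<^sub>R A x = 0" for c x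
  proof -
    have "(A (c *\<^sub>R x) - c *\<^sub>R A x) \<bullet> (A (c *\<^sub>R x) - c *\<^sub>R A x) = 0"
      by (simp add: inner_diff_left inner_diff_right i inner_commute)
    then show ?thesis by (simp only: inner_eq_zero_iff)
  qed
  ultimately have "linear A" by (intro linearI) (auto simp: algebra_simps)
  then show ?thesis by (simp add: A_def[abs_def])
qed

definition bary :: "('v, 'x, 'e, 'n::finite) triangulated \<Rightarrow> 'x \<Rightarrow> 'v \<Rightarrow> real" where
  "bary P p = inv_into (realization (simplexes P)) (theta P) p"

definition emb :: "('v, 'x, 'e::euclidean_space, 'n::finite) triangulated \<Rightarrow> 'x \<Rightarrow> 'e" where
  "emb P p = embedding P (bary P p)"

lemma carrier_simplex_bary: "carrier_simplex P p = support (bary P p)"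
  by (simp add: carrier_simplex_def bary_def)

lemma to_coord_emb: "to_coord P s p = inv (chart P s) (emb P p)"
  by (simp add: to_coord_def emb_def bary_def)

section \<open>Carriers, stars and the closed embedding\<close>

locale riem_polyhedron =
  fixes P :: "('v, 'x::metric_space, 'e::euclidean_space, 'n::finite) triangulated"
  assumes riem: "riemannian_polyhedron P" and homog: "homogeneous P"
begin

abbreviation "K \<equiv> simplexes P"
abbreviation "R \<equiv> realization (simplexes P)"
abbreviation "carr \<equiv> carrier_simplex P"
abbreviation "Dm \<equiv> chart_domain P"
abbreviation "Mx \<equiv> maximal_simplexes P"

lemma lip_poly: "lipschitz_polyhedron P"
  using riem by (simp add: riemannian_polyhedron_def)

lemma complex: "abstract_complex K"
  using lip_poly by (simp add: lipschitz_polyhedron_def)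

lemma simplex_finite: "s \<in> K \<Longrightarrow> finite s" and simplex_nonempty: "s \<in> K \<Longrightarrow> s \<noteq> {}"
  and face_in: "s \<in> K \<Longrightarrow> t \<subseteq> s \<Longrightarrow> t \<noteq> {} \<Longrightarrow> t \<in> K"
  and star_finite: "finite {s \<in> K. v \<in> s}"
  and countable_K: "countable K"
  by (use complex in \<open>unfold abstract_complex_def, blast\<close>)+

lemma theta_bij: "bij_betw (theta P) R UNIV"
  and embedding_bij: "bij_betw (embedding P) R (embedding P ` R)"
  using lip_poly by (auto simp: lipschitz_polyhedron_def lipschitz_homeo_def)

lemma bary_in: "bary P p \<in> R"
  unfolding bary_def by (rule inv_into_into[of p "theta P" R]) (use bij_betw_imp_surj_on[OF theta_bij] in simp)

lemma theta_bary [simp]: "theta P (bary P p) = p"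
  unfolding bary_def by (rule f_inv_into_f[of p "theta P" R]) (use bij_betw_imp_surj_on[OF theta_bij] in simp)

lemma bary_theta: "\<alpha> \<in> R \<Longrightarrow> bary P (theta P \<alpha>) = \<alpha>"
  unfolding bary_def by (rule inv_into_f_f[OF bij_betw_imp_inj_on[OF theta_bij]])

lemma emb_theta: "\<alpha> \<in> R \<Longrightarrow> emb P (theta P \<alpha>) = embedding P \<alpha>"
  by (simp add: emb_def bary_theta)

lemma embedding_eqD: "embedding P \<alpha> = embedding P \<beta> \<Longrightarrow> \<alpha> \<in> R \<Longrightarrow> \<beta> \<in> R \<Longrightarrow> \<alpha> = \<beta>"
  by (rule inj_onD[OF bij_betw_imp_inj_on[OF embedding_bij]])

lemma range_emb: "range (emb P) = embedding P ` R"
proof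
  show "embedding P ` R \<subseteq> range (emb P)"
  proof
    fix e assume "e \<in> embedding P ` R"
    then obtain \<alpha> where "\<alpha> \<in> R" "e = embedding P \<alpha>" by blast
    then have "e = emb P (theta P \<alpha>)" by (simp add: emb_theta)
    then show "e \<in> range (emb P)" by blast
  qed
  show "range (emb P) \<subseteq> embedding P ` R" using bary_in by (auto simp: emb_def)
qed

lemma closed_range_emb: "closed (range (emb P))"
  using lip_poly by (simp add: lipschitz_polyhedron_def range_emb)

definition unemb :: "'e \<Rightarrow> 'x" where
  "unemb e = theta P (inv_into R (embedding P) e)"

lemma unemb_emb [simp]: "unemb (emb P p) = p"
  unfolding unemb_def emb_def inv_into_f_f[OF bij_betw_imp_inj_on[OF embedding_bij] bary_in] by simp

lemma emb_unemb: "e \<in> range (emb P) \<Longrightarrow> emb P (unemb e) = e"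
  by auto

lemma from_coord_unemb: "from_coord P s x = unemb (chart P s x)"
  by (simp add: from_coord_def unemb_def)

lemma locally_lipschitz_bary: "locally_lipschitz UNIV dist bary_dist (bary P)"
  using lip_poly by (simp add: lipschitz_polyhedron_def lipschitz_homeo_def bary_def[abs_def])

lemma locally_lipschitz_emb: "locally_lipschitz UNIV dist dist (emb P)"
proof -
  have "locally_lipschitz R bary_dist dist (embedding P)"
    using lip_poly by (simp add: lipschitz_polyhedron_def lipschitz_homeo_def)
  from locally_lipschitz_compose[OF locally_lipschitz_bary this] bary_in
  show ?thesis by (auto simp: emb_def[abs_def] bary_dist_nonneg)
qed

lemma locally_lipschitz_unemb: "locally_lipschitz (range (emb P)) dist dist unemb"
proof -
  have 1: "locally_lipschitz (range (emb P)) dist bary_dist (inv_into R (embedding P))"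
    and 2: "locally_lipschitz R bary_dist dist (theta P)"
    using lip_poly by (auto simp: lipschitz_polyhedron_def lipschitz_homeo_def range_emb)
  have "inv_into R (embedding P) ` range (emb P) \<subseteq> R"
    unfolding range_emb by (auto intro: inv_into_into)
  from locally_lipschitz_compose[OF 1 2 this] show ?thesis by (auto simp: unemb_def[abs_def] bary_dist_nonneg)
qed

lemma continuous_emb: "continuous_on S (emb P)"
  using locally_lipschitz_continuous_on[OF locally_lipschitz_emb] continuous_on_subset by blast

lemma continuous_unemb: "continuous_on (range (emb P)) unemb"
  by (rule locally_lipschitz_continuous_on[OF locally_lipschitz_unemb])

lemma support_finite: "\<alpha> \<in> R \<Longrightarrow> finite (support \<alpha>)"
  using simplex_finite by (auto simp: realization_def)

lemma carr_in: "carr p \<in> K"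
  using bary_in[of p] by (simp add: carrier_simplex_bary realization_def)

lemma bary_nonneg: "0 \<le> bary P p v"
  using bary_in[of p] by (simp add: realization_def)

lemma bary_pos_iff: "0 < bary P p v \<longleftrightarrow> v \<in> carr p"
  using bary_nonneg[of p v] by (auto simp: carrier_simplex_bary support_def less_le)

lemma continuous_bary: "continuous_on UNIV (\<lambda>p. bary P p v)"
proof -
  have "locally_lipschitz R bary_dist dist (\<lambda>\<alpha>. \<alpha> v)"
    unfolding locally_lipschitz_def
  proof (intro ballI exI[of _ 1] conjI impI)
    fix \<alpha> \<beta> :: "'v \<Rightarrow> real" assume a: "\<alpha> \<in> R" "\<beta> \<in> R"
    let ?S = "support \<alpha> \<union> support \<beta>"
    have fin: "finite ?S" using a support_finite by blast
    show "dist (\<alpha> v) (\<beta> v) \<le> 1 * bary_dist \<alpha> \<beta>"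
    proof (cases "v \<in> ?S")
      case True
      have "(\<alpha> v - \<beta> v)\<^sup>2 \<le> (\<Sum>v\<in>?S. (\<alpha> v - \<beta> v)\<^sup>2)"
        using True fin by (intro member_le_sum) auto
      then have "sqrt ((\<alpha> v - \<beta> v)\<^sup>2) \<le> bary_dist \<alpha> \<beta>"
        unfolding bary_dist_def by (rule real_sqrt_le_mono)
      then show ?thesis by (simp add: dist_real_def)
    next
      case False
      then show ?thesis using bary_dist_nonneg[of \<alpha> \<beta>] by (simp add: support_def)
    qed
  qed simp
  from locally_lipschitz_compose[OF locally_lipschitz_bary this] bary_in
  show ?thesis by (intro locally_lipschitz_continuous_on) (auto simp: bary_dist_nonneg)
qed

lemma open_star: "finite t \<Longrightarrow> open {p. t \<subseteq> carr p}"
proof -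
  assume "finite t"
  then have "open (\<Inter>v\<in>t. {p. 0 < bary P p v})"
    by (intro open_INT) (auto intro!: open_Collect_less continuous_bary continuous_intros)
  also have "(\<Inter>v\<in>t. {p. 0 < bary P p v}) = {p. t \<subseteq> carr p}" by (auto simp: bary_pos_iff)
  finally show ?thesis .
qed

lemma maximal_in: "s \<in> Mx \<Longrightarrow> s \<in> K"
  by (simp add: maximal_simplexes_def)

lemma maximal_subset: "s \<in> Mx \<Longrightarrow> s \<subseteq> t \<Longrightarrow> t \<in> K \<Longrightarrow> t = s"
  by (auto simp: maximal_simplexes_def)

lemma card_maximal: "s \<in> Mx \<Longrightarrow> card s = CARD('n) + 1"
  using homog by (simp add: homogeneous_def)

text \<open>Local finiteness leaves only finitely many simplexes above \<open>t\<close>.\<close>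

lemma simplex_subset_maximal: 
  assumes "t \<in> K" obtains s where "s \<in> Mx" "t \<subseteq> s"
proof -
  obtain v where v: "v \<in> t" using simplex_nonempty[OF assms] by blast
  let ?A = "{s \<in> K. t \<subseteq> s}"
  have "finite ?A" by (rule finite_subset[OF _ star_finite[of v]]) (use v in auto)
  moreover have "t \<in> ?A" using assms by simp
  ultimately have "\<exists>m\<in>?A. t \<subseteq> m \<and> (\<forall>b\<in>?A. m \<subseteq> b \<longrightarrow> m = b)" by (rule finite_has_maximal2)
  then obtain s where s: "s \<in> ?A" "\<forall>b\<in>?A. s \<subseteq> b \<longrightarrow> s = b" by (elim bexE conjE)
  have "\<not> s \<subset> u" if "u \<in> K" for u
  proof
    assume "s \<subset> u"
    then have "u \<in> ?A" "s \<subseteq> u" using that s(1) by auto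
    then have "s = u" using s(2) by blast
    then show False using \<open>s \<subset> u\<close> by simp
  qed
  then have "s \<in> Mx" using s(1) by (simp add: maximal_simplexes_def)
  then show ?thesis using that s(1) by simp
qed

lemma open_simplex_open: "s \<in> Mx \<Longrightarrow> open {p. carr p = s}"
proof -
  assume s: "s \<in> Mx"
  have "{p. carr p = s} = {p. s \<subseteq> carr p}" using maximal_subset[OF s] carr_in by blast
  then show ?thesis using open_star[of s] simplex_finite[OF maximal_in[OF s]] by simp
qed

lemma vertex_in_R: "v \<in> s \<Longrightarrow> s \<in> K \<Longrightarrow> (\<lambda>w. if w = v then 1 else 0) \<in> R"
  and embedding_vertex: "embedding P (\<lambda>w. if w = v then 1 else 0) = position P v"
proof -
  have s: "support (\<lambda>w. if w = v then 1 else (0::real)) = {v}" by (auto simp: support_def)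
  show "v \<in> s \<Longrightarrow> s \<in> K \<Longrightarrow> (\<lambda>w. if w = v then 1 else 0) \<in> R"
    using face_in[of s "{v}"] by (simp add: realization_def s)
  show "embedding P (\<lambda>w. if w = v then 1 else 0) = position P v" by (simp add: embedding_def s)
qed

lemma position_inj: "s \<in> K \<Longrightarrow> inj_on (position P) s"
proof (rule inj_onI)
  fix v w assume s: "s \<in> K" and vw: "v \<in> s" "w \<in> s" "position P v = position P w"
  have "embedding P (\<lambda>u. if u = v then 1 else 0) = embedding P (\<lambda>u. if u = w then 1 else 0)"
    unfolding embedding_vertex by (rule vw(3))
  then have "(\<lambda>u. if u = v then 1 else 0) = (\<lambda>u. if u = w then 1 else (0::real))"
    by (rule embedding_eqD[OF _ vertex_in_R[OF vw(1) s] vertex_in_R[OF vw(2) s]])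
  from fun_cong[OF this, of v] show "v = w" by (simp split: if_splits)
qed

lemma embedding_superset:
  assumes "finite s" "support \<alpha> \<subseteq> s"
  shows "embedding P \<alpha> = (\<Sum>v\<in>s. \<alpha> v *\<^sub>R position P v)"
  unfolding embedding_def
proof (rule sum.mono_neutral_left[OF assms])
  show "\<forall>v\<in>s - support \<alpha>. \<alpha> v *\<^sub>R position P v = 0" by (simp add: support_def)
qed

text \<open>A convex combination of the embedded vertices of \<open>s\<close> is the image of a
  point of the realization with the same coefficients. Injectivity of the embedding identifies these
  with the barycentric coordinates, whose support is the carrier.\<close>

lemma emb_in_hull_iff:
  assumes s: "s \<in> K"
  shows "emb P p \<in> convex hull (position P ` s) \<longleftrightarrow> carr p \<subseteq> s"
    and "convex hull (position P ` s) \<subseteq> range (emb P)"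
proof -
  have fin: "finite s" by (rule simplex_finite[OF s])
  have ex: "\<exists>\<alpha>\<in>R. support \<alpha> \<subseteq> s \<and> embedding P \<alpha> = e" if e: "e \<in> convex hull (position P ` s)" for e
  proof -
    obtain u where u: "\<forall>x\<in>position P ` s. 0 \<le> u x" "sum u (position P ` s) = 1" "(\<Sum>x\<in>position P ` s. u x *\<^sub>R x) = e"
      using e convex_hull_finite[of "position P ` s"] fin by auto
    define \<alpha> where "\<alpha> v = (if v \<in> s then u (position P v) else 0)" for v
    have sup: "support \<alpha> \<subseteq> s" by (auto simp: support_def \<alpha>_def)
    have sums: "sum \<alpha> s = 1" using u(2) by (simp add: \<alpha>_def sum.reindex[OF position_inj[OF s]])
    have sum1: "sum \<alpha> (support \<alpha>) = 1"
      using sum.mono_neutral_left[OF fin sup, of \<alpha>] sums by (auto simp: support_def)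
    then have "support \<alpha> \<noteq> {}" by force
    then have "\<alpha> \<in> R" using face_in[OF s sup] sum1 u(1) by (auto simp: realization_def \<alpha>_def)
    moreover have "embedding P \<alpha> = e"
      using u(3) embedding_superset[OF fin sup] by (simp add: \<alpha>_def sum.reindex[OF position_inj[OF s]])
    ultimately show ?thesis using sup by blast
  qed
  show "convex hull (position P ` s) \<subseteq> range (emb P)"
    using ex unfolding range_emb by blast
  show "emb P p \<in> convex hull (position P ` s) \<longleftrightarrow> carr p \<subseteq> s"
  proof
    assume "emb P p \<in> convex hull (position P ` s)"
    then obtain \<alpha> where \<alpha>: "\<alpha> \<in> R" "support \<alpha> \<subseteq> s" "embedding P \<alpha> = emb P p" using ex by blast
    have "\<alpha> = bary P p"
      using \<alpha>(3) unfolding emb_def by (rule embedding_eqD[OF _ \<alpha>(1) bary_in])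
    then show "carr p \<subseteq> s" using \<alpha>(2) by (simp add: carrier_simplex_bary)
  next
    assume c: "carr p \<subseteq> s"
    then have e: "emb P p = (\<Sum>v\<in>s. bary P p v *\<^sub>R position P v)"
      unfolding emb_def by (intro embedding_superset fin) (simp add: carrier_simplex_bary)
    have "sum (bary P p) s = sum (bary P p) (support (bary P p))"
      using c by (intro sum.mono_neutral_right fin) (auto simp: carrier_simplex_bary support_def)
    also have "\<dots> = 1" using bary_in[of p] by (simp add: realization_def)
    finally show "emb P p \<in> convex hull (position P ` s)"
      unfolding e by (intro convex_sum fin convex_convex_hull bary_nonneg) (auto intro: hull_inc)
  qed
qed

section \<open>Isometric coordinates on a maximal simplex\<close>

lemma chart_isometry: "s \<in> Mx \<Longrightarrow> dist (chart P s x) (chart P s y) = dist x y"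
  and chart_range: "s \<in> Mx \<Longrightarrow> range (chart P s) = affine hull (position P ` s)"
  and metric_measurable: "s \<in> Mx \<Longrightarrow> metric_coeff P s \<in> borel_measurable (lebesgue_on (Dm s))"
  and metric_symmetric: "s \<in> Mx \<Longrightarrow> AE x in lebesgue_on (Dm s). transpose (metric_coeff P s x) = metric_coeff P s x"
  using riem by (auto simp: riemannian_polyhedron_def)

lemma chart_inj: "s \<in> Mx \<Longrightarrow> inj (chart P s)"
  by (rule injI) (metis chart_isometry dist_eq_0_iff)

text \<open>The chart is an isometry between Euclidean spaces, hence affine, and this is its linear
  part.\<close>

definition lin :: "'v set \<Rightarrow> real^'n \<Rightarrow> 'e" where
  "lin s x = chart P s x - chart P s 0"

lemma linear_lin: "s \<in> Mx \<Longrightarrow> linear (lin s)"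
  using isometry_affine[of "chart P s"] chart_isometry by (simp add: lin_def[abs_def])

lemma chart_lin: "chart P s x = chart P s 0 + lin s x"
  by (simp add: lin_def)

lemma norm_lin: "s \<in> Mx \<Longrightarrow> norm (lin s x) = norm x"
  using chart_isometry[of s x 0] by (simp add: lin_def dist_norm)

lemma chart_affine_comb:
  assumes s: "s \<in> Mx" shows "chart P s ((1 - t) *\<^sub>R x + t *\<^sub>R y) = (1 - t) *\<^sub>R chart P s x + t *\<^sub>R chart P s y"
proof -
  interpret l: linear "lin s" by (rule linear_lin[OF s])
  show ?thesis unfolding chart_lin[of s "_ + _"] chart_lin[of s x] chart_lin[of s y]
    unfolding l.add l.scaleR by (simp add: algebra_simps)
qed

definition corner :: "'v set \<Rightarrow> 'v \<Rightarrow> real^'n" where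
  "corner s v = inv (chart P s) (position P v)"

lemma chart_corner: "s \<in> Mx \<Longrightarrow> v \<in> s \<Longrightarrow> chart P s (corner s v) = position P v"
  unfolding corner_def by (rule f_inv_into_f) (auto simp: chart_range intro: hull_inc)

lemma chart_image_hull:
  assumes s: "s \<in> Mx"
  shows "chart P s ` (convex hull X) = convex hull (chart P s ` X)"
    and "chart P s ` (affine hull X) = affine hull (chart P s ` X)"
proof -
  have c: "chart P s ` Y = (+) (chart P s 0) ` (lin s ` Y)" for Y
    by (simp add: image_image lin_def)
  show "chart P s ` (convex hull X) = convex hull (chart P s ` X)"
    unfolding c convex_hull_translation[symmetric] convex_hull_linear_image[OF linear_lin[OF s]] ..
  show "chart P s ` (affine hull X) = affine hull (chart P s ` X)"
    unfolding c affine_hull_translation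
    by (simp add: affine_hull_linear_image[symmetric] linear_lin[OF s] linear_linear)
qed

lemma face_coord:
  assumes s: "s \<in> Mx" and t: "t \<subseteq> s"
  shows "chart P s -` (convex hull (position P ` t)) = convex hull (corner s ` t)"
proof -
  have "position P ` t = chart P s ` (corner s ` t)"
    using chart_corner[OF s] t by (force simp: image_image)
  then have "convex hull (position P ` t) = chart P s ` (convex hull (corner s ` t))"
    by (simp add: chart_image_hull(1)[OF s])
  then show ?thesis using chart_inj[OF s] by (simp add: inj_vimage_image_eq)
qed

lemma dom_hull: "s \<in> Mx \<Longrightarrow> Dm s = convex hull (corner s ` s)"
  using face_coord[of s s] by (simp add: chart_domain_def)

lemma dom_compact: "s \<in> Mx \<Longrightarrow> compact (Dm s)" and dom_convex: "s \<in> Mx \<Longrightarrow> convex (Dm s)"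
  by (auto simp: dom_hull simplex_finite maximal_in intro!: finite_imp_compact_convex_hull)

lemma dom_nonempty: "s \<in> Mx \<Longrightarrow> Dm s \<noteq> {}"
  using simplex_nonempty[OF maximal_in] by (simp add: dom_hull)

lemma dom_lebesgue: "s \<in> Mx \<Longrightarrow> Dm s \<in> sets lebesgue"
  by (intro compact_lebesgue(1) dom_compact)

text \<open>The chart maps onto the affine hull of the embedded vertices, so their preimages span
  the coordinate space. This is what gives the chart domain interior points.\<close>

lemma affine_hull_dom: assumes s: "s \<in> Mx" shows "affine hull (Dm s) = UNIV"
proof -
  have "position P ` s = chart P s ` (corner s ` s)"
    using chart_corner[OF s] by (force simp: image_image)
  then have "range (chart P s) = chart P s ` (affine hull (corner s ` s))"
    by (simp add: chart_range[OF s] chart_image_hull(2)[OF s])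
  then have "affine hull (corner s ` s) = UNIV" using chart_inj[OF s] by (metis inj_image_eq_iff)
  then show ?thesis by (simp add: dom_hull[OF s])
qed

lemma interior_dom_nonempty: assumes s: "s \<in> Mx" shows "interior (Dm s) \<noteq> {}"
  using rel_interior_interior[OF affine_hull_dom[OF s]] rel_interior_eq_empty[OF dom_convex[OF s]] dom_nonempty[OF s] by simp

text \<open>A proper face has at most n corners, hence affine dimension below n.\<close>

lemma negligible_face: assumes s: "s \<in> Mx" and t: "t \<subset> s"
  shows "negligible (convex hull (corner s ` t))"
proof -
  have fin: "finite s" using simplex_finite maximal_in s by blast
  have "card (corner s ` t) \<le> card t" using fin t by (intro card_image_le) (auto intro: finite_subset)
  also have "card t < card s" by (rule psubset_card_mono[OF fin t])
  finally have "card (corner s ` t) \<le> CARD('n)" using card_maximal[OF s] by simp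
  moreover have "aff_dim (corner s ` t) \<le> int (card (corner s ` t)) - 1"
    using aff_dim_le_card[of "corner s ` t"] fin t by (auto intro: finite_subset)
  ultimately have "aff_dim (convex hull (corner s ` t)) < int DIM(real^'n)"
    unfolding aff_dim_convex_hull by (simp del: DIM_cart) simp
  then have "interior (convex hull (corner s ` t)) = {}" using aff_dim_nonempty_interior by force
  then show ?thesis by (simp add: negligible_convex_interior)
qed

lemma from_coord_dom:
  assumes s: "s \<in> Mx" and x: "x \<in> Dm s"
  shows "emb P (from_coord P s x) = chart P s x" "carr (from_coord P s x) \<subseteq> s" "to_coord P s (from_coord P s x) = x"
proof -
  have h: "chart P s x \<in> convex hull (position P ` s)" using x by (simp add: chart_domain_def)
  then show e: "emb P (from_coord P s x) = chart P s x"
    using emb_in_hull_iff(2)[OF maximal_in[OF s]] by (simp add: from_coord_unemb emb_unemb subset_iff)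
  then show "carr (from_coord P s x) \<subseteq> s" using h emb_in_hull_iff(1)[OF maximal_in[OF s]] by metis
  show "to_coord P s (from_coord P s x) = x" using e chart_inj[OF s] by (simp add: to_coord_emb)
qed

lemma to_coord_carr:
  assumes s: "s \<in> Mx" and p: "carr p \<subseteq> s"
  shows "chart P s (to_coord P s p) = emb P p" "to_coord P s p \<in> Dm s" "from_coord P s (to_coord P s p) = p"
proof -
  have h: "emb P p \<in> convex hull (position P ` s)" using p emb_in_hull_iff(1)[OF maximal_in[OF s]] by simp
  then have "emb P p \<in> range (chart P s)"
    using chart_range[OF s] convex_hull_subset_affine_hull by blast
  then show e: "chart P s (to_coord P s p) = emb P p" by (simp add: to_coord_emb f_inv_into_f)
  then show "to_coord P s p \<in> Dm s" using h by (simp add: chart_domain_def)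
  show "from_coord P s (to_coord P s p) = p" by (simp add: from_coord_unemb e)
qed

lemma chart_dom_range: "s \<in> Mx \<Longrightarrow> chart P s ` Dm s \<subseteq> range (emb P)"
  using emb_in_hull_iff(2)[OF maximal_in] by (auto simp: chart_domain_def)

lemma locally_lipschitz_from_coord: assumes s: "s \<in> Mx" shows "locally_lipschitz (Dm s) dist dist (from_coord P s)"
proof -
  have "locally_lipschitz (Dm s) dist dist (chart P s)"
    unfolding locally_lipschitz_def by (intro ballI exI[of _ 1] conjI) (auto simp: chart_isometry[OF s])
  from locally_lipschitz_compose[OF this locally_lipschitz_unemb chart_dom_range[OF s]]
  show ?thesis by (simp add: from_coord_unemb[abs_def])
qed

lemma continuous_from_coord: "s \<in> Mx \<Longrightarrow> continuous_on (Dm s) (from_coord P s)"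
  by (rule locally_lipschitz_continuous_on[OF locally_lipschitz_from_coord])

lemma closed_simplex_image: assumes s: "s \<in> Mx" shows "{p. carr p \<subseteq> s} = from_coord P s ` Dm s"
  using from_coord_dom[OF s] to_coord_carr[OF s] by (auto simp: image_iff) metis

lemma AE_dom: "s \<in> Mx \<Longrightarrow> (AE x in lebesgue_on (Dm s). Q x) \<longleftrightarrow> (AE x in lebesgue. x \<in> Dm s \<longrightarrow> Q x)"
  using dom_lebesgue by (subst AE_restrict_space_iff) auto

lemma AE_dom_generic:
  assumes s: "s \<in> Mx"
  shows "AE x in lebesgue. x \<in> Dm s \<longrightarrow> x \<in> interior (Dm s) \<and> carr (from_coord P s x) = s"
proof -
  have fin: "finite s" using simplex_finite maximal_in s by blast
  have "negligible (\<Union>t\<in>{t. t \<subset> s}. convex hull (corner s ` t))"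
    using negligible_face[OF s] finite_Collect_subsets[OF fin]
    by (intro negligible_Union) (auto intro: finite_subset[of "{t. t \<subset> s}" "{t. t \<subseteq> s}"])
  moreover have "negligible (frontier (Dm s))" by (rule negligible_convex_frontier[OF dom_convex[OF s]])
  ultimately have "negligible ((\<Union>t\<in>{t. t \<subset> s}. convex hull (corner s ` t)) \<union> frontier (Dm s))"
    by (rule negligible_Un)
  then have "AE x in lebesgue. x \<notin> (\<Union>t\<in>{t. t \<subset> s}. convex hull (corner s ` t)) \<union> frontier (Dm s)"
    unfolding negligible_iff_null_sets by (rule AE_not_in)
  then show ?thesis
  proof eventually_elim
    case (elim x)
    show ?case
    proof (intro impI conjI)
      assume x: "x \<in> Dm s"
      then show "x \<in> interior (Dm s)"
        using elim closure_subset[of "Dm s"] by (auto simp: frontier_def)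
      show "carr (from_coord P s x) = s"
      proof (rule ccontr)
        assume ne: "carr (from_coord P s x) \<noteq> s"
        let ?t = "carr (from_coord P s x)"
        have t: "?t \<subset> s" using ne from_coord_dom(2)[OF s x] by blast
        have "emb P (from_coord P s x) \<in> convex hull (position P ` ?t)"
          using emb_in_hull_iff(1)[OF carr_in] by blast
        then have "x \<in> convex hull (corner s ` ?t)"
          using face_coord[OF s, of ?t] t from_coord_dom(1)[OF s x] by auto
        then show False using elim t by blast
      qed
    qed
  qed
qed

end

section \<open>Ellipticity and the volume measure\<close>

lemma matrix_inv_both:
  fixes A :: "real^'n^'n"
  assumes "invertible A"
  shows "A ** matrix_inv A = mat 1" "matrix_inv A ** A = mat 1"
  using assms someI_ex[of "\<lambda>A'. A ** A' = mat 1 \<and> A' ** A = mat 1"]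
  unfolding invertible_def matrix_inv_def by blast+

lemma coercive_invertible:
  fixes A :: "real^'n^'n"
  assumes "c > 0" "\<And>\<xi>. c * (norm \<xi>)\<^sup>2 \<le> \<xi> \<bullet> (A *v \<xi>)"
  shows "invertible A"
proof -
  have "x = 0" if "A *v x = 0" for x
  proof -
    have "c * (norm x)\<^sup>2 \<le> 0" using assms(2)[of x] that by simp
    then show ?thesis using assms(1) by (simp add: mult_le_0_iff)
  qed
  then have "\<exists>B. B ** A = mat 1" using matrix_left_invertible_ker by blast
  then show ?thesis by (simp add: invertible_left_inverse)
qed

lemma abs_det_le:
  fixes B :: "real^'n^'n"
  assumes "\<And>i j. \<bar>B $ i $ j\<bar> \<le> M"
  shows "\<bar>det B\<bar> \<le> fact CARD('n) * M ^ CARD('n)"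
proof -
  have "\<bar>det B\<bar> \<le> (\<Sum>p\<in>{p. p permutes (UNIV :: 'n set)}. \<bar>of_int (sign p) * (\<Prod>i\<in>UNIV. B $ i $ p i)\<bar>)"
    unfolding det_def by (rule sum_abs)
  also have "\<dots> \<le> (\<Sum>p\<in>{p. p permutes (UNIV :: 'n set)}. M ^ CARD('n))"
  proof (rule sum_mono)
    fix p :: "'n \<Rightarrow> 'n"
    have "\<bar>of_int (sign p) * (\<Prod>i\<in>UNIV. B $ i $ p i)\<bar> = (\<Prod>i\<in>UNIV. \<bar>B $ i $ p i\<bar>)"
      by (simp add: abs_mult sign_def abs_prod)
    also have "\<dots> \<le> (\<Prod>i\<in>(UNIV::'n set). M)" using assms by (intro prod_mono) auto
    finally show "\<bar>of_int (sign p) * (\<Prod>i\<in>UNIV. B $ i $ p i)\<bar> \<le> M ^ CARD('n)" by simp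
  qed
  also have "\<dots> = fact CARD('n) * M ^ CARD('n)" by (simp add: card_permutations)
  finally show ?thesis .
qed

text \<open>Positivity follows by deforming \<open>A\<close> to the identity through coercive matrices, the lower bound
  from an upper bound for the determinant of the inverse.\<close>

lemma coercive_det_ge:
  fixes A :: "real^'n^'n"
  assumes c: "c > 0" and A: "\<And>\<xi>. c * (norm \<xi>)\<^sup>2 \<le> \<xi> \<bullet> (A *v \<xi>)"
  shows "c ^ CARD('n) / fact CARD('n) \<le> det A"
proof -
  have pos: "det A > 0"
  proof (rule ccontr)
    assume "\<not> det A > 0"
    define f where "f t = det (\<chi> i j. (1 - t) * (mat 1 :: real^'n^'n) $ i $ j + t * A $ i $ j)" for t :: real
    have "continuous_on {0..1} f" unfolding f_def det_def by (intro continuous_intros)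
    moreover have "f 0 = 1"
    proof -
      have "(\<chi> i j. (mat 1 :: real^'n^'n) $ i $ j) = mat 1" by (simp add: vec_eq_iff)
      then show ?thesis by (simp add: f_def)
    qed
    moreover have "f 1 \<le> 0" using \<open>\<not> det A > 0\<close> by (simp add: f_def vec_lambda_eta)
    ultimately obtain t where t: "0 \<le> t" "t \<le> 1" "f t = 0"
      using IVT2'[of f 1 0 0] by auto
    let ?B = "(\<chi> i j. (1 - t) * (mat 1 :: real^'n^'n) $ i $ j + t * A $ i $ j) :: real^'n^'n"
    have Bv: "?B *v \<xi> = (1 - t) *\<^sub>R \<xi> + t *\<^sub>R (A *v \<xi>)" for \<xi>
    proof -
      have "?B *v \<xi> = (1 - t) *\<^sub>R (mat 1 *v \<xi>) + t *\<^sub>R (A *v \<xi>)"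
        unfolding vec_eq_iff matrix_vector_mult_def
        by (simp add: algebra_simps sum.distrib sum_distrib_left sum_subtractf)
      then show ?thesis by simp
    qed
    have m: "min 1 c * (norm \<xi>)\<^sup>2 \<le> \<xi> \<bullet> (?B *v \<xi>)" for \<xi>
    proof -
      have "min 1 c * (norm \<xi>)\<^sup>2 = (1 - t) * (min 1 c * (norm \<xi>)\<^sup>2) + t * (min 1 c * (norm \<xi>)\<^sup>2)"
        by (simp add: algebra_simps)
      also have "\<dots> \<le> (1 - t) * (1 * (norm \<xi>)\<^sup>2) + t * (c * (norm \<xi>)\<^sup>2)"
        using t by (intro add_mono mult_left_mono mult_right_mono) auto
      also have "\<dots> \<le> (1 - t) * (\<xi> \<bullet> \<xi>) + t * (\<xi> \<bullet> (A *v \<xi>))"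
        using t A[of \<xi>] by (intro add_mono mult_left_mono) (auto simp: power2_norm_eq_inner)
      finally show ?thesis unfolding Bv by (simp add: inner_add_right)
    qed
    have "invertible ?B" by (rule coercive_invertible[OF _ m]) (use c in simp)
    then have "det ?B \<noteq> 0" by (simp add: invertible_det_nz)
    then show False using t(3) by (simp add: f_def)
  qed
  let ?B = "matrix_inv A"
  have inv: "invertible A" by (rule coercive_invertible[OF c A])
  have nB: "norm (?B *v \<eta>) \<le> norm \<eta> / c" for \<eta>
  proof -
    let ?\<xi> = "?B *v \<eta>"
    have "A *v ?\<xi> = \<eta>" using matrix_inv_both(1)[OF inv] by (simp add: matrix_vector_mul_assoc)
    then have "c * (norm ?\<xi>)\<^sup>2 \<le> norm ?\<xi> * norm \<eta>"
      using A[of ?\<xi>] norm_cauchy_schwarz[of ?\<xi> \<eta>] by simp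
    then have "norm ?\<xi> * (c * norm ?\<xi>) \<le> norm ?\<xi> * norm \<eta>" by (simp add: power2_eq_square algebra_simps)
    then have "c * norm ?\<xi> \<le> norm \<eta>" by (cases "norm ?\<xi> = 0") (auto simp: mult_le_cancel_left)
    then show ?thesis using c by (simp add: pos_le_divide_eq mult.commute)
  qed
  have "\<bar>?B $ i $ j\<bar> \<le> 1 / c" for i j
  proof -
    have "?B $ i $ j = (?B *v axis j 1) $ i" by (simp add: matrix_vector_mult_basis column_def)
    also have "\<bar>\<dots>\<bar> \<le> norm (?B *v axis j 1)" by (rule component_le_norm_cart)
    also have "\<dots> \<le> norm (axis j (1::real)) / c" by (rule nB)
    finally show ?thesis by (simp add: norm_axis_1)
  qed
  from abs_det_le[OF this] have 1: "\<bar>det ?B\<bar> \<le> fact CARD('n) * (1 / c) ^ CARD('n)" .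
  have "det A * det ?B = 1" using matrix_inv_both(1)[OF inv] by (metis det_I det_mul)
  then have "1 \<le> det A * (fact CARD('n) * (1 / c) ^ CARD('n))"
    using mult_left_mono[OF order_trans[OF abs_ge_self 1], of "det A"] pos by simp
  then show ?thesis using c by (simp add: field_simps power_divide)
qed

lemma continuous_on_det: "continuous_on UNIV (det :: real^'n^'n \<Rightarrow> real)"
  unfolding det_def[abs_def] by (intro continuous_intros)

context riem_polyhedron
begin

definition elliptic :: "real \<Rightarrow> 'v set \<Rightarrow> real^'n \<Rightarrow> bool" where
  "elliptic \<Lambda> s x \<longleftrightarrow> (\<forall>\<xi>. (norm \<xi>)\<^sup>2 / \<Lambda>\<^sup>2 \<le> \<xi> \<bullet> (metric_coeff P s x *v \<xi>) \<and>
             \<xi> \<bullet> (metric_coeff P s x *v \<xi>) \<le> \<Lambda>\<^sup>2 * (norm \<xi>)\<^sup>2)"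

text \<open>One ellipticity constant serves all simplexes, so it can be fixed once and enter all
  later Lipschitz constants.\<close>

definition \<Lambda> :: real where
  "\<Lambda> = (SOME \<Lambda>. \<Lambda> > 0 \<and> (\<forall>s\<in>Mx. AE x in lebesgue_on (Dm s). elliptic \<Lambda> s x))"

lemma \<Lambda>: "\<Lambda> > 0" "s \<in> Mx \<Longrightarrow> AE x in lebesgue_on (Dm s). elliptic \<Lambda> s x"
proof -
  have "\<exists>\<Lambda>. \<Lambda> > 0 \<and> (\<forall>s\<in>Mx. AE x in lebesgue_on (Dm s). elliptic \<Lambda> s x)"
    using riem by (auto simp: riemannian_polyhedron_def elliptic_def)
  from someI_ex[OF this] show "\<Lambda> > 0" "s \<in> Mx \<Longrightarrow> AE x in lebesgue_on (Dm s). elliptic \<Lambda> s x"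
    unfolding \<Lambda>_def[symmetric] by blast+
qed

text \<open>Points of this kind have full measure in each chart domain. Interiority allows
  derivatives in coordinates; the condition on the carrier makes \<open>metric_at\<close> read the
  matrix of \<open>s\<close> itself.\<close>

definition regular :: "'v set \<Rightarrow> real^'n \<Rightarrow> bool" where
  "regular s x \<longleftrightarrow> s \<in> Mx \<and> x \<in> interior (Dm s) \<and> carr (from_coord P s x) = s \<and> elliptic \<Lambda> s x"

lemma regular_AE: "s \<in> Mx \<Longrightarrow> AE x in lebesgue. x \<in> Dm s \<longrightarrow> regular s x"
proof -
  assume s: "s \<in> Mx"
  have "AE x in lebesgue. x \<in> Dm s \<longrightarrow> elliptic \<Lambda> s x" using \<Lambda>(2)[OF s] AE_dom[OF s] by metis
  with AE_dom_generic[OF s] show ?thesis by eventually_elim (simp add: regular_def s)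
qed

lemma regular_dom: "regular s x \<Longrightarrow> x \<in> Dm s"
  unfolding regular_def using interior_subset by blast

text \<open>The lower bound of \<open>coercive_det_ge\<close> for the coercivity constant
  \<open>1 / \<Lambda>\<^sup>2\<close>. It bounds the volume density from below, uniformly over all
  simplexes.\<close>

definition detmin :: real where "detmin = (1 / \<Lambda>\<^sup>2) ^ CARD('n) / fact CARD('n)"

lemma detmin_pos: "detmin > 0"
  using \<Lambda>(1) by (simp add: detmin_def)

lemma regular_metric:
  assumes "regular s x"
  shows "(norm \<xi>)\<^sup>2 / \<Lambda>\<^sup>2 \<le> \<xi> \<bullet> (metric_coeff P s x *v \<xi>)" "\<xi> \<bullet> (metric_coeff P s x *v \<xi>) \<le> \<Lambda>\<^sup>2 * (norm \<xi>)\<^sup>2"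
    "invertible (metric_coeff P s x)" "detmin \<le> det (metric_coeff P s x)"
proof -
  have e: "elliptic \<Lambda> s x" using assms by (simp add: regular_def)
  then show 1: "(norm \<xi>)\<^sup>2 / \<Lambda>\<^sup>2 \<le> \<xi> \<bullet> (metric_coeff P s x *v \<xi>)"
    and "\<xi> \<bullet> (metric_coeff P s x *v \<xi>) \<le> \<Lambda>\<^sup>2 * (norm \<xi>)\<^sup>2" for \<xi> by (auto simp: elliptic_def)
  have c: "(1 / \<Lambda>\<^sup>2) * (norm \<xi>)\<^sup>2 \<le> \<xi> \<bullet> (metric_coeff P s x *v \<xi>)" for \<xi> using 1[of \<xi>] by simp
  have p: "1 / \<Lambda>\<^sup>2 > 0" using \<Lambda>(1) by simp
  show "invertible (metric_coeff P s x)" by (rule coercive_invertible[OF p c])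
  show "detmin \<le> det (metric_coeff P s x)" unfolding detmin_def by (rule coercive_det_ge[OF p c])
qed

lemma metric_at_from_coord:
  assumes "regular s x"
  shows "metric_at P (from_coord P s x) = metric_coeff P s x"
  using assms from_coord_dom(3)[OF _ regular_dom[OF assms]] by (simp add: regular_def metric_at_def)

lemma g_norm_bounds:
  assumes "regular s x"
  shows "norm \<xi> \<le> \<Lambda> * g_norm P (from_coord P s x) \<xi>" "g_norm P (from_coord P s x) \<xi> \<le> \<Lambda> * norm \<xi>"
proof -
  have g: "g_norm P (from_coord P s x) \<xi> = sqrt (\<xi> \<bullet> (metric_coeff P s x *v \<xi>))"
    by (simp add: g_norm_def g_inner_def metric_at_from_coord[OF assms])
  have "sqrt ((norm \<xi> / \<Lambda>)\<^sup>2) \<le> g_norm P (from_coord P s x) \<xi>"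
    unfolding g using regular_metric(1)[OF assms, of \<xi>] by (intro real_sqrt_le_mono) (simp add: power_divide)
  then show "norm \<xi> \<le> \<Lambda> * g_norm P (from_coord P s x) \<xi>"
    using \<Lambda>(1) by (simp add: pos_divide_le_eq mult.commute)
  have "g_norm P (from_coord P s x) \<xi> \<le> sqrt ((\<Lambda> * norm \<xi>)\<^sup>2)"
    unfolding g using regular_metric(2)[OF assms, of \<xi>] by (intro real_sqrt_le_mono) (simp add: power_mult_distrib)
  then show "g_norm P (from_coord P s x) \<xi> \<le> \<Lambda> * norm \<xi>" using \<Lambda>(1) by simp
qed

section \<open>The volume measure in coordinates\<close>

lemma sets_lebesgue_on_dom: "s \<in> Mx \<Longrightarrow> A \<subseteq> Dm s \<Longrightarrow> A \<in> sets (lebesgue_on (Dm s)) \<longleftrightarrow> A \<in> sets lebesgue"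
  using dom_lebesgue by (subst sets_restrict_space_iff) auto

lemma sets_volume_iff:
  "A \<in> sets (volume P) \<longleftrightarrow> (\<forall>s\<in>Mx. from_coord P s -` A \<inter> Dm s \<in> sets lebesgue)"
  unfolding sets_volume by (simp add: sets_lebesgue_on_dom)

lemma space_volume [simp]: "space (volume P) = UNIV"
proof -
  have "UNIV \<in> sets (volume P)" by (simp add: sets_volume_iff dom_lebesgue)
  then show ?thesis using sets.sets_into_space by blast
qed

lemma density_measurable: "s \<in> Mx \<Longrightarrow>
    (\<lambda>x. ennreal (sqrt (det (metric_coeff P s x)))) \<in> borel_measurable (lebesgue_on (Dm s))"
  using measurable_compose[OF metric_measurable borel_measurable_continuous_onI[OF continuous_on_det]] by measurable

lemma from_coord_measurable: "s \<in> Mx \<Longrightarrow> from_coord P s \<in> measurable (lebesgue_on (Dm s)) (volume P)"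
  by (rule measurableI) (auto simp: sets_volume)

text \<open>The density is bounded below at regular points, so a volume null set is Lebesgue null in
  every chart. Conversely, completeness of Lebesgue measure makes any set with null preimages
  measurable, and then every summand of its volume is 0.\<close>

lemma null_sets_volume_iff:
  "A \<in> null_sets (volume P) \<longleftrightarrow> (\<forall>s\<in>Mx. AE x in lebesgue. x \<in> Dm s \<longrightarrow> from_coord P s x \<notin> A)"
proof
  assume A: "A \<in> null_sets (volume P)"
  then have Av: "A \<in> sets (volume P)" and e0: "emeasure (volume P) A = 0" by auto
  show "\<forall>s\<in>Mx. AE x in lebesgue. x \<in> Dm s \<longrightarrow> from_coord P s x \<notin> A"
  proof
    fix s assume s: "s \<in> Mx"
    let ?B = "from_coord P s -` A \<inter> Dm s"
    let ?d = "\<lambda>x. ennreal (sqrt (det (metric_coeff P s x)))"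
    have B: "?B \<in> sets (lebesgue_on (Dm s))" using Av s by (simp add: sets_volume)
    have "emeasure (density (lebesgue_on (Dm s)) ?d) ?B \<le> 0"
      using emeasure_volume[OF Av[unfolded sets_volume]] e0
        nn_integral_ge_point[OF s, of "\<lambda>s. emeasure (density (lebesgue_on (Dm s))
           (\<lambda>x. ennreal (sqrt (det (metric_coeff P s x))))) (from_coord P s -` A \<inter> Dm s)"] by simp
    then have "(\<integral>\<^sup>+x. ?d x * indicator ?B x \<partial>lebesgue_on (Dm s)) = 0"
      using B density_measurable[OF s] by (simp add: emeasure_density)
    then have "AE x in lebesgue_on (Dm s). ?d x * indicator ?B x = 0"
      using B density_measurable[OF s] by (subst (asm) nn_integral_0_iff_AE) auto
    then have "AE x in lebesgue. x \<in> Dm s \<longrightarrow> ?d x * indicator ?B x = 0" by (simp add: AE_dom[OF s])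
    then show "AE x in lebesgue. x \<in> Dm s \<longrightarrow> from_coord P s x \<notin> A"
      using regular_AE[OF s]
    proof eventually_elim
      case (elim x)
      show ?case
      proof (intro impI notI)
        assume x: "x \<in> Dm s" and a: "from_coord P s x \<in> A"
        then have "det (metric_coeff P s x) \<le> 0" using elim(1) by (simp add: ennreal_eq_0_iff)
        moreover have "detmin \<le> det (metric_coeff P s x)" using elim(2) x regular_metric(4) by blast
        ultimately show False using detmin_pos by linarith
      qed
    qed
  qed
next
  assume A: "\<forall>s\<in>Mx. AE x in lebesgue. x \<in> Dm s \<longrightarrow> from_coord P s x \<notin> A"
  have B: "from_coord P s -` A \<inter> Dm s \<in> null_sets lebesgue" if s: "s \<in> Mx" for s
  proof -
    have "AE x in lebesgue. x \<notin> from_coord P s -` A \<inter> Dm s" using A s by auto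
    then show ?thesis by (simp add: completion.null_sets_iff_AE)
  qed
  have Av: "A \<in> sets (volume P)" using B by (auto simp: sets_volume_iff)
  have "emeasure (density (lebesgue_on (Dm s)) (\<lambda>x. ennreal (sqrt (det (metric_coeff P s x))))) (from_coord P s -` A \<inter> Dm s) = 0"
    if s: "s \<in> Mx" for s
  proof -
    have Bs: "from_coord P s -` A \<inter> Dm s \<in> sets (lebesgue_on (Dm s))" using Av s by (simp add: sets_volume)
    have "AE x in lebesgue_on (Dm s). x \<notin> from_coord P s -` A \<inter> Dm s" using A s by (auto simp: AE_dom[OF s])
    then have "AE x in lebesgue_on (Dm s). ennreal (sqrt (det (metric_coeff P s x))) * indicator (from_coord P s -` A \<inter> Dm s) x = 0"
      by eventually_elim simp
    then show ?thesis using Bs density_measurable[OF s] by (simp add: emeasure_density nn_integral_0_iff_AE)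
  qed
  then have "(\<integral>\<^sup>+s. emeasure (density (lebesgue_on (Dm s)) (\<lambda>x. ennreal (sqrt (det (metric_coeff P s x)))))
      (from_coord P s -` A \<inter> Dm s) \<partial>count_space Mx) = (\<integral>\<^sup>+s. 0 \<partial>count_space Mx)"
    by (intro nn_integral_cong) simp
  then show "A \<in> null_sets (volume P)"
    using emeasure_volume[OF Av[unfolded sets_volume]] Av by auto
qed

lemma AE_volume_iff:
  "(AE p in volume P. Q p) \<longleftrightarrow> (\<forall>s\<in>Mx. AE x in lebesgue. x \<in> Dm s \<longrightarrow> Q (from_coord P s x))"
proof
  assume "AE p in volume P. Q p"
  then obtain N where N: "N \<in> null_sets (volume P)" "{p \<in> space (volume P). \<not> Q p} \<subseteq> N"
    by (auto elim: AE_E simp: null_sets_def)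
  show "\<forall>s\<in>Mx. AE x in lebesgue. x \<in> Dm s \<longrightarrow> Q (from_coord P s x)"
  proof
    fix s assume "s \<in> Mx"
    with N(1) have "AE x in lebesgue. x \<in> Dm s \<longrightarrow> from_coord P s x \<notin> N" by (simp add: null_sets_volume_iff)
    then show "AE x in lebesgue. x \<in> Dm s \<longrightarrow> Q (from_coord P s x)"
      by eventually_elim (use N(2) in auto)
  qed
next
  assume "\<forall>s\<in>Mx. AE x in lebesgue. x \<in> Dm s \<longrightarrow> Q (from_coord P s x)"
  then have "{p. \<not> Q p} \<in> null_sets (volume P)" unfolding null_sets_volume_iff by simp
  from AE_not_in[OF this] show "AE p in volume P. Q p" by simp
qed

lemma measurable_volume_iff:
  fixes h :: "'x \<Rightarrow> 'b::topological_space"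
  shows "h \<in> borel_measurable (volume P) \<longleftrightarrow> (\<forall>s\<in>Mx. (\<lambda>x. h (from_coord P s x)) \<in> borel_measurable (lebesgue_on (Dm s)))"
proof
  assume "h \<in> borel_measurable (volume P)"
  then show "\<forall>s\<in>Mx. (\<lambda>x. h (from_coord P s x)) \<in> borel_measurable (lebesgue_on (Dm s))"
    using measurable_compose[OF from_coord_measurable] by blast
next
  assume h: "\<forall>s\<in>Mx. (\<lambda>x. h (from_coord P s x)) \<in> borel_measurable (lebesgue_on (Dm s))"
  show "h \<in> borel_measurable (volume P)"
  proof (rule measurableI)
    fix A :: "'b set" assume A: "A \<in> sets borel"
    have "from_coord P s -` (h -` A) \<inter> Dm s \<in> sets (lebesgue_on (Dm s))" if "s \<in> Mx" for s
      using measurable_sets[OF h[rule_format, OF that] A] by (simp add: vimage_def Int_def)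
    then show "h -` A \<inter> space (volume P) \<in> sets (volume P)" by (simp add: sets_volume)
  qed simp
qed

lemma open_sets_volume: "open U \<Longrightarrow> U \<in> sets (volume P)"
  unfolding sets_volume_iff
proof
  fix s assume U: "open U" and s: "s \<in> Mx"
  have "openin (top_of_set (Dm s)) (Dm s \<inter> from_coord P s -` U)"
    by (rule continuous_openin_preimage_gen[OF continuous_from_coord[OF s] U])
  then obtain T where T: "open T" "Dm s \<inter> from_coord P s -` U = Dm s \<inter> T" by (auto simp: openin_open)
  then show "from_coord P s -` U \<inter> Dm s \<in> sets lebesgue"
    using dom_lebesgue[OF s] by (simp add: Int_commute sets.Int)
qed

text \<open>The weighted Lebesgue measure of one chart, pushed forward to the polyhedron, is a
  single term of the sum that defines the volume, and its weight is at least
  \<open>sqrt detmin\<close> almost everywhere.\<close>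

lemma nn_integral_volume_ge:
  assumes h: "h \<in> borel_measurable (volume P)" and s: "s \<in> Mx"
  shows "ennreal (sqrt detmin) * (\<integral>\<^sup>+x\<in>Dm s. h (from_coord P s x) \<partial>lebesgue) \<le> integral\<^sup>N (volume P) h"
proof -
  let ?d = "\<lambda>x. ennreal (sqrt (det (metric_coeff P s x)))"
  let ?D = "density (lebesgue_on (Dm s)) ?d"
  have fm: "from_coord P s \<in> measurable ?D (volume P)" using from_coord_measurable[OF s] by simp
  have hm: "(\<lambda>x. h (from_coord P s x)) \<in> borel_measurable (lebesgue_on (Dm s))"
    using h s by (simp add: measurable_volume_iff)
  have "emeasure (distr ?D (volume P) (from_coord P s)) A \<le> emeasure (volume P) A" for A
  proof (cases "A \<in> sets (volume P)")
    case A: True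
    have "emeasure (distr ?D (volume P) (from_coord P s)) A = emeasure ?D (from_coord P s -` A \<inter> Dm s)"
      by (subst emeasure_distr[OF fm A]) simp
    also have "\<dots> \<le> emeasure (volume P) A"
      unfolding emeasure_volume[OF A[unfolded sets_volume]]
      by (rule nn_integral_ge_point[OF s])
    finally show ?thesis .
  qed (simp add: emeasure_notin_sets)
  then have "distr ?D (volume P) (from_coord P s) \<le> volume P"
    by (simp add: le_measure_iff le_fun_def)
  then have "integral\<^sup>N (distr ?D (volume P) (from_coord P s)) h \<le> integral\<^sup>N (volume P) h"
    by (intro nn_integral_mono_measure) auto
  moreover have "integral\<^sup>N (distr ?D (volume P) (from_coord P s)) h = (\<integral>\<^sup>+x. ?d x * h (from_coord P s x) \<partial>lebesgue_on (Dm s))"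
    using fm h hm density_measurable[OF s] by (simp add: nn_integral_distr nn_integral_density)
  moreover have "(\<integral>\<^sup>+x. ennreal (sqrt detmin) * h (from_coord P s x) \<partial>lebesgue_on (Dm s))
      \<le> (\<integral>\<^sup>+x. ?d x * h (from_coord P s x) \<partial>lebesgue_on (Dm s))"
  proof (rule nn_integral_mono_AE)
    have "AE x in lebesgue_on (Dm s). regular s x" using regular_AE[OF s] by (simp add: AE_dom[OF s])
    then show "AE x in lebesgue_on (Dm s). ennreal (sqrt detmin) * h (from_coord P s x) \<le> ?d x * h (from_coord P s x)"
      by eventually_elim (intro mult_right_mono ennreal_leI real_sqrt_le_mono regular_metric(4), auto)
  qed
  moreover have "(\<integral>\<^sup>+x. ennreal (sqrt detmin) * h (from_coord P s x) \<partial>lebesgue_on (Dm s))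
      = ennreal (sqrt detmin) * (\<integral>\<^sup>+x\<in>Dm s. h (from_coord P s x) \<partial>lebesgue)"
    using hm dom_lebesgue[OF s] by (subst nn_integral_cmult) (auto simp: nn_integral_restrict_space)
  ultimately show ?thesis by simp
qed

end

section \<open>The intrinsic distance\<close>

lemma lipschitz_on_inner:
  assumes c: "L-lipschitz_on S c" and b: "norm b \<le> 1"
  shows "L-lipschitz_on S (\<lambda>t. c t \<bullet> b)"
proof (rule lipschitz_onI)
  fix s t assume st: "s \<in> S" "t \<in> S"
  have "\<bar>(c s - c t) \<bullet> b\<bar> \<le> norm (c s - c t) * norm b" by (rule Cauchy_Schwarz_ineq2)
  also have "\<dots> \<le> norm (c s - c t)" using b by (simp add: mult_left_le)
  also have "\<dots> \<le> L * dist s t" using lipschitz_onD[OF c st] by (simp add: dist_norm)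
  finally show "dist (c s \<bullet> b) (c t \<bullet> b) \<le> L * dist s t" by (simp add: dist_real_def inner_diff_left)
qed (rule lipschitz_on_nonneg[OF c])

text \<open>Each component is extended to the whole line and differentiated there. The ends of the
  interval are excluded because the extension says nothing about two-sided derivatives of
  \<open>c\<close> at them.\<close>

lemma lipschitz_curve_AE_differentiable:
  fixes c :: "real \<Rightarrow> 'e::euclidean_space"
  assumes c: "L-lipschitz_on {0..1} c"
  shows "AE t in lebesgue. t \<in> {0<..<1} \<longrightarrow> (\<exists>v. (c has_vector_derivative v) (at t))"
proof -
  have "AE t in lebesgue. t \<in> {0<..<1} \<longrightarrow> (\<exists>d. ((\<lambda>t. c t \<bullet> b) has_real_derivative d) (at t))" if b: "b \<in> Basis" for b
  proof -
    have "L-lipschitz_on {0..1} (\<lambda>t. c t \<bullet> b)" using b by (intro lipschitz_on_inner[OF c]) simp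
    then obtain F where F: "L-lipschitz_on UNIV F" "\<And>t. t \<in> {0..1} \<Longrightarrow> F t = c t \<bullet> b"
      using lipschitz_extension_real by blast
    obtain g where "AE t in lborel. (F has_real_derivative g t) (at t)"
      using lipschitz_real_AE_differentiable[OF F(1)] by metis
    then have "AE t in lebesgue. (F has_real_derivative g t) (at t)" by (rule AE_completion)
    then show ?thesis
    proof eventually_elim
      case (elim t)
      show ?case
      proof
        assume t: "t \<in> {0<..<1}"
        have "((\<lambda>t. c t \<bullet> b) has_real_derivative g t) (at t)"
          by (rule has_field_derivative_transform_within_open[OF elim open_greaterThanLessThan t]) (use F(2) in auto)
        then show "\<exists>d. ((\<lambda>t. c t \<bullet> b) has_real_derivative d) (at t)" by blast
      qed
    qed
  qed
  then have "AE t in lebesgue. \<forall>b\<in>Basis. t \<in> {0<..<1} \<longrightarrow> (\<exists>d. ((\<lambda>t. c t \<bullet> b) has_real_derivative d) (at t))"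
    by (subst AE_ball_countable) (auto intro: countable_finite)
  then show ?thesis
  proof eventually_elim
    case (elim t)
    show ?case
    proof
      assume "t \<in> {0<..<1}"
      with elim obtain d where d: "\<And>b. b \<in> Basis \<Longrightarrow> ((\<lambda>t. c t \<bullet> b) has_real_derivative d b) (at t)" by metis
      have "(c has_derivative (\<lambda>h. h *\<^sub>R (\<Sum>b\<in>Basis. d b *\<^sub>R b))) (at t)"
      proof (subst has_derivative_componentwise_within, rule ballI)
        fix b :: 'e assume b: "b \<in> Basis"
        show "((\<lambda>t. c t \<bullet> b) has_derivative (\<lambda>h. (h *\<^sub>R (\<Sum>b\<in>Basis. d b *\<^sub>R b)) \<bullet> b)) (at t)"
          using d[OF b] b by (simp add: has_field_derivative_def mult.commute[of _ "d b"])
      qed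
      then show "\<exists>v. (c has_vector_derivative v) (at t)" by (auto simp: has_vector_derivative_def)
    qed
  qed
qed

text \<open>Projection onto the direction of the chord reduces the claim to a real Lipschitz
  function, which is the integral of its derivative.\<close>

lemma lipschitz_curve_length_ge:
  fixes c :: "real \<Rightarrow> 'e::euclidean_space"
  assumes c: "L-lipschitz_on {0..1} c"
  shows "ennreal (dist (c 0) (c 1)) \<le> (\<integral>\<^sup>+t\<in>{0..1}. ennreal (norm (vector_derivative c (at t))) \<partial>lebesgue)"
proof -
  \<comment> \<open>If the two ends coincide this is 0, so its norm is only known to be at most
    1.\<close>
  define \<nu> where "\<nu> = sgn (c 1 - c 0)"
  have \<nu>: "norm \<nu> \<le> 1" by (simp add: \<nu>_def norm_sgn)
  have \<nu>e: "(c 1 - c 0) \<bullet> \<nu> = dist (c 0) (c 1)"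
  proof (cases "c 1 = c 0")
    case False
    have "(c 1 - c 0) \<bullet> \<nu> = (norm (c 1 - c 0))\<^sup>2 / norm (c 1 - c 0)"
      by (simp add: \<nu>_def sgn_div_norm power2_norm_eq_inner divide_inverse mult.commute)
    also have "\<dots> = dist (c 0) (c 1)" using False by (simp add: dist_norm norm_minus_commute power2_eq_square)
    finally show ?thesis .
  qed (simp add: \<nu>_def)
  obtain F where F: "L-lipschitz_on UNIV F" "\<And>t. t \<in> {0..1} \<Longrightarrow> F t = c t \<bullet> \<nu>"
    using lipschitz_extension_real[OF lipschitz_on_inner[OF c \<nu>]] by blast
  obtain g where g [measurable]: "g \<in> borel_measurable borel"
    and gi: "\<And>a b. a \<le> b \<Longrightarrow> (g has_integral (F b - F a)) {a..b}"
    and gd: "AE t in lborel. (F has_real_derivative g t) (at t)"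
    using lipschitz_real_AE_differentiable[OF F(1)] by metis
  have gb: "AE t in lborel. \<bar>g t\<bar> \<le> L"
    using gd
  proof eventually_elim
    case (elim t)
    have "((\<lambda>h. F (t + h *\<^sub>R 1)) has_real_derivative g t) (at 0)"
      using elim DERIV_shift[of F "g t" 0 t] by (simp add: add.commute)
    then have "(\<lambda>n. \<bar>dir_quot F 1 n t\<bar>) \<longlonglongrightarrow> \<bar>g t\<bar>" by (intro tendsto_rabs dir_quot_tendsto)
    then show ?case
      by (rule LIMSEQ_le_const2) (use dir_quot_bound[OF F(1), of 1] in auto)
  qed
  have si: "set_integrable lborel {0..1} g"
    unfolding set_integrable_def
    by (rule integrableI_bounded_set_indicator[where B=L]) (use gb in auto)
  have "dist (c 0) (c 1) = integral {0..1} g"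
    using gi[of 0 1] F(2) \<nu>e by (simp add: integral_unique inner_diff_left)
  also have "\<dots> = (LINT t:{0..1}|lborel. g t)" using set_borel_integral_eq_integral(2)[OF si] by simp
  \<comment> \<open>The positive part is taken because the comparison continues with integrals of
    nonnegative functions.\<close>
  also have "\<dots> \<le> (\<integral>t. max 0 (indicator {0..1} t * g t) \<partial>lborel)"
    unfolding set_lebesgue_integral_def using si
    by (intro integral_mono) (auto simp: set_integrable_def)
  finally have 1: "ennreal (dist (c 0) (c 1)) \<le> ennreal (\<integral>t. max 0 (indicator {0..1} t * g t) \<partial>lborel)" by (rule ennreal_leI)
  have "ennreal (\<integral>t. max 0 (indicator {0..1} t * g t) \<partial>lborel) = (\<integral>\<^sup>+t. ennreal (max 0 (indicator {0..1} t * g t)) \<partial>lborel)"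
    using si by (intro nn_integral_eq_integral[symmetric]) (auto simp: set_integrable_def)
  also have "\<dots> = (\<integral>\<^sup>+t. ennreal (max 0 (indicator {0..1} t * g t)) \<partial>lebesgue)"
    by (rule nn_integral_completion[symmetric])
  also have "\<dots> \<le> (\<integral>\<^sup>+t\<in>{0..1}. ennreal (norm (vector_derivative c (at t))) \<partial>lebesgue)"
  proof (rule nn_integral_mono_AE)
    have "AE t in lebesgue. t \<noteq> (0::real) \<and> t \<noteq> 1"
      by (rule AE_completion) (intro AE_conjI AE_lborel_singleton)
    then show "AE t in lebesgue. ennreal (max 0 (indicator {0..1} t * g t))
        \<le> ennreal (norm (vector_derivative c (at t))) * indicator {0..1} t"
      using AE_completion[OF gd] lipschitz_curve_AE_differentiable[OF c]
    proof eventually_elim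
      case (elim t)
      show ?case
      proof (cases "t \<in> {0<..<1}")
        case True
        then obtain v where v: "(c has_vector_derivative v) (at t)" using elim by blast
        then have "((\<lambda>t. c t \<bullet> \<nu>) has_real_derivative v \<bullet> \<nu>) (at t)"
          unfolding has_vector_derivative_def has_field_derivative_def
          by (auto intro!: derivative_eq_intros simp: mult.commute)
        moreover have "((\<lambda>t. c t \<bullet> \<nu>) has_real_derivative g t) (at t)"
          by (rule has_field_derivative_transform_within_open[OF elim(2) open_greaterThanLessThan True])
            (use F(2) in auto)
        ultimately have "g t = v \<bullet> \<nu>" by (rule DERIV_unique[symmetric])
        also have "\<dots> \<le> norm v * norm \<nu>" by (rule norm_cauchy_schwarz)
        also have "\<dots> \<le> norm v" using \<nu> by (simp add: mult_left_le)
        finally show ?thesis using True vector_derivative_at[OF v] by (simp add: ennreal_leI)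
      next
        case False
        then show ?thesis using elim by auto
      qed
    qed
  qed
  finally show ?thesis using 1 by (rule order_trans[rotated])
qed

context riem_polyhedron
begin

section \<open>The intrinsic distance controls the embedded Euclidean distance\<close>

lemma inner_lin: "s \<in> Mx \<Longrightarrow> lin s x \<bullet> lin s y = x \<bullet> y"
proof -
  assume s: "s \<in> Mx"
  interpret l: linear "lin s" by (rule linear_lin[OF s])
  have "(norm (lin s x + lin s y))\<^sup>2 = (norm (x + y))\<^sup>2" by (simp add: norm_lin[OF s] l.add[symmetric])
  moreover have "(norm (lin s x))\<^sup>2 = (norm x)\<^sup>2" "(norm (lin s y))\<^sup>2 = (norm y)\<^sup>2" by (simp_all add: norm_lin[OF s])
  ultimately show ?thesis
    unfolding power2_norm_eq_inner inner_add_left inner_add_right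
    by (simp add: inner_commute[of "lin s y" "lin s x"] inner_commute[of y x])
qed

text \<open>The adjoint of a linear isometry is a left inverse. Unlike \<open>inv\<close> it is
  linear on the whole Euclidean space, which makes coordinates of a curve differentiable along with
  its embedded image.\<close>

lemma adjoint_lin: "s \<in> Mx \<Longrightarrow> adjoint (lin s) (lin s x) = x"
proof -
  assume s: "s \<in> Mx"
  have "y \<bullet> adjoint (lin s) (lin s x) = y \<bullet> x" for y
    by (simp add: adjoint_works[OF linear_lin[OF s]] inner_lin[OF s])
  then show ?thesis using vector_eq_rdot[of "adjoint (lin s) (lin s x)" x] by (metis inner_commute)
qed

text \<open>Used as the null set \<open>Z\<close> in the definition of the distance, it forces the
  competing curves to be at regular points at almost all times.\<close>

definition singular :: "'x set" where
  "singular = {p. \<not> regular (carr p) (to_coord P (carr p) p)}"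

lemma regular_not_singular: "regular s x \<Longrightarrow> from_coord P s x \<notin> singular"
  using from_coord_dom(3)[of s x] regular_dom[of s x] by (auto simp: singular_def regular_def)

lemma singular_null: "singular \<in> null_sets (volume P)"
  unfolding null_sets_volume_iff
proof
  fix s assume "s \<in> Mx"
  from regular_AE[OF this] show "AE x in lebesgue. x \<in> Dm s \<longrightarrow> from_coord P s x \<notin> singular"
    by eventually_elim (auto simp: regular_not_singular)
qed

lemma not_singular:
  assumes "p \<notin> singular"
  shows "carr p \<in> Mx" "regular (carr p) (to_coord P (carr p) p)" "from_coord P (carr p) (to_coord P (carr p) p) = p"
proof -
  show r: "regular (carr p) (to_coord P (carr p) p)" using assms by (simp add: singular_def)
  then show m: "carr p \<in> Mx" by (simp add: regular_def)
  show "from_coord P (carr p) (to_coord P (carr p) p) = p" by (rule to_coord_carr(3)[OF m order_refl])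
qed

text \<open>Open maximal simplexes are open sets, so near \<open>t\<close> the curve stays in the
  simplex of its carrier, where coordinates and embedded points differ by an affine
  isometry.\<close>

lemma path_coord_derivative:
  assumes \<gamma>: "continuous_on {0..1} \<gamma>" and t: "t \<in> {0<..<1}" and s: "carr (\<gamma> t) = s" "s \<in> Mx"
    and v: "((\<lambda>\<tau>. emb P (\<gamma> \<tau>)) has_vector_derivative v) (at t)"
  obtains w where "((\<lambda>\<tau>. to_coord P s (\<gamma> \<tau>)) has_vector_derivative w) (at t)" "norm w = norm v"
proof -
  have "continuous_on {0<..<1} \<gamma>" by (rule continuous_on_subset[OF \<gamma>]) auto
  then have "open (\<gamma> -` {p. carr p = s} \<inter> {0<..<1})"
    using continuous_on_open_vimage[OF open_greaterThanLessThan[of 0 1], of \<gamma>] open_simplex_open[OF s(2)] by blast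
  moreover have "t \<in> \<gamma> -` {p. carr p = s} \<inter> {0<..<1}" using t s by simp
  ultimately obtain T where T: "open T" "t \<in> T" "\<And>\<tau>. \<tau> \<in> T \<Longrightarrow> carr (\<gamma> \<tau>) = s" by blast
  have ch: "chart P s (to_coord P s (\<gamma> \<tau>)) = emb P (\<gamma> \<tau>)" if "\<tau> \<in> T" for \<tau>
    using to_coord_carr(1)[OF s(2), of "\<gamma> \<tau>"] T(3)[OF that] by simp
  have tc: "to_coord P s (\<gamma> \<tau>) = adjoint (lin s) (emb P (\<gamma> \<tau>) - chart P s 0)" if "\<tau> \<in> T" for \<tau>
    using ch[OF that] adjoint_lin[OF s(2), of "to_coord P s (\<gamma> \<tau>)"] by (simp add: lin_def)
  have la: "bounded_linear (adjoint (lin s))" "bounded_linear (lin s)"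
    using adjoint_linear[OF linear_lin[OF s(2)]] linear_lin[OF s(2)] by (auto simp: linear_linear)
  define w where "w = adjoint (lin s) v"
  have "((\<lambda>\<tau>. adjoint (lin s) (emb P (\<gamma> \<tau>) - chart P s 0)) has_vector_derivative w) (at t)"
    using bounded_linear.has_vector_derivative[OF la(1) has_vector_derivative_diff[OF v has_vector_derivative_const]]
    by (simp add: w_def)
  then have dw: "((\<lambda>\<tau>. to_coord P s (\<gamma> \<tau>)) has_vector_derivative w) (at t)"
    by (rule has_vector_derivative_transform_within_open[OF _ T(1,2)]) (simp add: tc)
  have "((\<lambda>\<tau>. chart P s 0 + lin s (to_coord P s (\<gamma> \<tau>))) has_vector_derivative lin s w) (at t)"
    using has_vector_derivative_add[OF has_vector_derivative_const bounded_linear.has_vector_derivative[OF la(2) dw]]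
    by simp
  then have "((\<lambda>\<tau>. emb P (\<gamma> \<tau>)) has_vector_derivative lin s w) (at t)"
    by (rule has_vector_derivative_transform_within_open[OF _ T(1,2)]) (simp add: lin_def ch)
  then have "v = lin s w" using vector_derivative_at v by metis
  then show ?thesis using that dw norm_lin[OF s(2)] by metis
qed

text \<open>At regular points the speed measured by the metric is at least
  \<open>1 / \<Lambda>\<close> times the Euclidean speed of the embedded curve, and the Euclidean
  length is at least the chord. The choice \<open>Z = singular\<close> in the supremum makes this
  comparison available almost everywhere along each curve.\<close>

theorem emb_dist_le_intrinsic_edist:
  "ennreal (dist (emb P x) (emb P y) / \<Lambda>) \<le> intrinsic_edist P x y"
proof -
  have "ennreal (dist (emb P x) (emb P y) / \<Lambda>) \<le> g_length P \<gamma>" if \<gamma>: "\<gamma> \<in> transversal_paths singular x y" for \<gamma>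
  proof -
    obtain C where C: "C-lipschitz_on {0..1} \<gamma>" and ends: "\<gamma> 0 = x" "\<gamma> 1 = y"
      and neg: "negligible {t\<in>{0..1}. \<gamma> t \<in> singular}"
      using \<gamma> by (auto simp: transversal_paths_def)
    have cont: "continuous_on {0..1} \<gamma>" by (rule lipschitz_on_continuous_on[OF C])
    have "locally_lipschitz {0..1} dist dist \<gamma>"
      unfolding locally_lipschitz_def using lipschitz_onD[OF C] by (intro ballI exI[of _ 1] conjI exI[of _ C]) auto
    from locally_lipschitz_compose[OF this locally_lipschitz_emb]
    have "locally_lipschitz {0..1} dist dist (\<lambda>t. emb P (\<gamma> t))" by simp
    then obtain L where L: "L-lipschitz_on {0..1} (\<lambda>t. emb P (\<gamma> t))"
      by (rule locally_lipschitz_compact_imp_lipschitz) auto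
    let ?c = "\<lambda>t. emb P (\<gamma> t)"
    \<comment> \<open>Scaling the curve puts the factor into the integrand. Thus no constant has to
      be pulled out of an integral whose integrand is not known to be measurable.\<close>
    define c where "c t = (1 / \<Lambda>) *\<^sub>R ?c t" for t
    let ?v = "\<lambda>t. norm (vector_derivative c (at t))"
    let ?S = "{t\<in>{0..1}. carr (\<gamma> t) \<in> Mx}"
    let ?g = "\<lambda>t. g_norm P (\<gamma> t) (vector_derivative (\<lambda>\<tau>. to_coord P (carr (\<gamma> t)) (\<gamma> \<tau>)) (at t))"
    have dc: "dist (c s) (c t) = dist (?c s) (?c t) / \<Lambda>" for s t
      using \<Lambda>(1) by (simp add: c_def dist_norm scaleR_diff_right[symmetric])
    have "(L / \<Lambda>)-lipschitz_on {0..1} c"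
    proof (rule lipschitz_onI)
      fix s t :: real assume "s \<in> {0..1}" "t \<in> {0..1}"
      then show "dist (c s) (c t) \<le> L / \<Lambda> * dist s t"
        using divide_right_mono[OF lipschitz_onD[OF L], of s t \<Lambda>] \<Lambda>(1) by (simp add: dc)
    qed (use lipschitz_on_nonneg[OF L] \<Lambda>(1) in simp)
    from lipschitz_curve_length_ge[OF this]
    have "ennreal (dist (emb P x) (emb P y) / \<Lambda>) \<le> (\<integral>\<^sup>+t\<in>{0..1}. ennreal (?v t) \<partial>lebesgue)"
      by (simp add: dc ends)
    also have "(\<integral>\<^sup>+t\<in>{0..1}. ennreal (?v t) \<partial>lebesgue) \<le> (\<integral>\<^sup>+t\<in>?S. ennreal (?g t) \<partial>lebesgue)"
    proof (rule nn_integral_mono_AE)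
      have "AE t in lebesgue. t \<noteq> (0::real) \<and> t \<noteq> 1"
        by (rule AE_completion) (intro AE_conjI AE_lborel_singleton)
      moreover have "AE t in lebesgue. t \<notin> {t\<in>{0..1}. \<gamma> t \<in> singular}"
        using neg by (intro AE_not_in) (simp add: negligible_iff_null_sets)
      ultimately show "AE t in lebesgue. ennreal (?v t) * indicator {0..1} t \<le> ennreal (?g t) * indicator ?S t"
        using lipschitz_curve_AE_differentiable[OF L]
      proof eventually_elim
        case (elim t)
        show ?case
        proof (cases "t \<in> {0<..<1}")
          case True
          then obtain v where v: "(?c has_vector_derivative v) (at t)" using elim by blast
          have cv: "(c has_vector_derivative (1 / \<Lambda>) *\<^sub>R v) (at t)"
            unfolding c_def by (rule bounded_linear.has_vector_derivative[OF bounded_linear_scaleR_right v])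
          have ns: "\<gamma> t \<notin> singular" using elim True by auto
          note R = not_singular[OF ns]
          obtain w where w: "((\<lambda>\<tau>. to_coord P (carr (\<gamma> t)) (\<gamma> \<tau>)) has_vector_derivative w) (at t)" "norm w = norm v"
            using path_coord_derivative[OF cont True refl R(1) v] by metis
          have "norm w \<le> \<Lambda> * g_norm P (\<gamma> t) w" using g_norm_bounds(1)[OF R(2), of w] R(3) by simp
          then have "?v t \<le> ?g t"
            using \<Lambda>(1) vector_derivative_at[OF cv] vector_derivative_at[OF w(1)] w(2)
            by (simp add: pos_divide_le_eq mult.commute)
          then show ?thesis using True R(1) by (simp add: ennreal_leI)
        next
          case False
          then have "t \<notin> {0..1}" using elim by auto
          then show ?thesis by simp
        qed
      qed
    qed
    finally show ?thesis by (simp add: g_length_def)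
  qed
  then have "ennreal (dist (emb P x) (emb P y) / \<Lambda>) \<le> (INF \<gamma>\<in>transversal_paths singular x y. g_length P \<gamma>)"
    by (rule INF_greatest)
  also have "\<dots> \<le> intrinsic_edist P x y"
    unfolding intrinsic_edist_def by (rule SUP_upper[OF singular_null])
  finally show ?thesis .
qed

end

section \<open>Curves that avoid a given null set\<close>

lemma AE_open_obtain:
  fixes T :: "'a::euclidean_space set"
  assumes ae: "AE z in lebesgue. Q z" and T: "open T" "T \<noteq> {}"
  obtains z where "z \<in> T" "Q z"
proof -
  have "\<exists>z\<in>T. Q z"
  proof (rule ccontr)
    assume no: "\<not> (\<exists>z\<in>T. Q z)"
    from ae have "AE z in lebesgue. z \<notin> T" by eventually_elim (use no in blast)
    then have "negligible T" by (simp add: negligible_iff_null_sets completion.null_sets_iff_AE)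
    then show False using open_not_negligible[OF T] by simp
  qed
  then show ?thesis using that by blast
qed

text \<open>For a fixed time in the open unit interval, the point of the segment is the image of
  \<open>z\<close> under a dilation, so the bad \<open>z\<close> form a null set. Tonelli's theorem
  exchanges the order: almost every \<open>z\<close> has almost no bad times.\<close>

lemma AE_segment_avoids:
  fixes N :: "'a::euclidean_space set"
  assumes N: "negligible N"
  shows "AE z in lebesgue. \<exists>M. negligible M \<and> (\<forall>t\<in>{0<..<1} - M. (1 - t) *\<^sub>R x + t *\<^sub>R z \<notin> N)"
proof -
  \<comment> \<open>A Borel superset makes the integrand measurable on the product space.\<close>
  obtain N' where N': "N \<subseteq> N'" "N' \<in> null_sets lborel"
    using N unfolding negligible_iff_null_sets null_sets_completion_iff2 by blast
  then have Nb: "N' \<in> sets borel" by auto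
  let ?f = "\<lambda>z t. indicator N' ((1 - t) *\<^sub>R x + t *\<^sub>R z) * indicator {0<..<1::real} t :: ennreal"
  have meas: "case_prod ?f \<in> borel_measurable (lborel \<Otimes>\<^sub>M lborel)" using Nb by measurable
  have zero: "(\<integral>\<^sup>+z. ?f z t \<partial>lborel) = 0" for t
  proof (cases "t \<in> {0<..<1}")
    case True
    have "negligible N'" using N'(2) by (simp add: negligible_iff_null_sets null_sets_completionI)
    then have "negligible ((\<lambda>y. (1 / t) *\<^sub>R (y - (1 - t) *\<^sub>R x)) ` N')"
      by (rule negligible_differentiable_image_negligible[OF order_refl]) (auto intro!: derivative_intros)
    then have "AE z in lebesgue. z \<notin> (\<lambda>y. (1 / t) *\<^sub>R (y - (1 - t) *\<^sub>R x)) ` N'"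
      unfolding negligible_iff_null_sets by (rule AE_not_in)
    then have "AE z in lborel. z \<notin> (\<lambda>y. (1 / t) *\<^sub>R (y - (1 - t) *\<^sub>R x)) ` N'" by (simp add: AE_completion_iff)
    then have "AE z in lborel. ?f z t = 0"
    proof eventually_elim
      case (elim z)
      have "(1 - t) *\<^sub>R x + t *\<^sub>R z \<notin> N'"
      proof
        assume "(1 - t) *\<^sub>R x + t *\<^sub>R z \<in> N'"
        moreover have "z = (1 / t) *\<^sub>R (((1 - t) *\<^sub>R x + t *\<^sub>R z) - (1 - t) *\<^sub>R x)" using True by simp
        ultimately show False using elim by blast
      qed
      then show ?case by simp
    qed
    then have "(\<integral>\<^sup>+z. ?f z t \<partial>lborel) = (\<integral>\<^sup>+z. 0 \<partial>(lborel :: 'a measure))" by (rule nn_integral_cong_AE)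
    then show ?thesis by simp
  qed simp
  have "(\<integral>\<^sup>+z. \<integral>\<^sup>+t. ?f z t \<partial>lborel \<partial>lborel) = 0"
    using lborel_pair.Fubini'[OF meas] zero by simp
  moreover have "(\<lambda>z. \<integral>\<^sup>+t. ?f z t \<partial>lborel) \<in> borel_measurable lborel"
    using Nb by measurable
  ultimately have "AE z in lborel. (\<integral>\<^sup>+t. ?f z t \<partial>lborel) = 0" by (simp add: nn_integral_0_iff_AE)
  then have "AE z in lebesgue. (\<integral>\<^sup>+t. ?f z t \<partial>lborel) = 0" by (rule AE_completion)
  then show ?thesis
  proof eventually_elim
    case (elim z)
    have "(\<lambda>t. ?f z t) \<in> borel_measurable lborel" using Nb by measurable
    then have "AE t in lborel. ?f z t = 0" using elim by (simp add: nn_integral_0_iff_AE)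
    then have "AE t in lebesgue. ?f z t = 0" by (rule AE_completion)
    then have "AE t in lebesgue. t \<notin> {t\<in>{0<..<1}. (1 - t) *\<^sub>R x + t *\<^sub>R z \<in> N'}"
      by eventually_elim (auto simp: indicator_def)
    then have "negligible {t\<in>{0<..<1}. (1 - t) *\<^sub>R x + t *\<^sub>R z \<in> N'}"
      by (simp add: negligible_iff_null_sets completion.null_sets_iff_AE)
    then show ?case using N'(1) by (intro exI[of _ "{t\<in>{0<..<1}. (1 - t) *\<^sub>R x + t *\<^sub>R z \<in> N'}"]) auto
  qed
qed

lemma negligible_affine_image_real: "negligible N \<Longrightarrow> negligible ((\<lambda>t::real. a + b * t) ` N)"
  by (rule negligible_differentiable_image_negligible[OF order_refl]) (auto intro!: derivative_intros)

context riem_polyhedron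
begin

text \<open>Speed bounds are propagated along concatenations in place of lengths: \<open>g_length\<close> integrates
  a function that need not be measurable, and such a (lower) integral is not subadditive.\<close>

definition fast :: "'x set \<Rightarrow> (real \<Rightarrow> 'x) \<Rightarrow> 'x \<Rightarrow> 'x \<Rightarrow> real \<Rightarrow> bool" where
  "fast Z \<gamma> x y C \<longleftrightarrow> (\<exists>L. L-lipschitz_on {0..1} \<gamma>) \<and> \<gamma> 0 = x \<and> \<gamma> 1 = y \<and>
     (\<exists>N. negligible N \<and> (\<forall>t\<in>{0<..<1} - N. \<gamma> t \<notin> Z \<union> singular \<and>
        (\<exists>v. ((\<lambda>\<tau>. to_coord P (carr (\<gamma> t)) (\<gamma> \<tau>)) has_vector_derivative v) (at t) \<and> norm v \<le> C)))"

lemma fast_mono: "fast Z \<gamma> x y C \<Longrightarrow> C \<le> C' \<Longrightarrow> fast Z \<gamma> x y C'"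
  unfolding fast_def by (meson order_trans)

lemma fast_affine_piece:
  assumes \<gamma>: "((\<lambda>\<tau>. to_coord P s (\<gamma> \<tau>)) has_vector_derivative v) (at (a + b * t))" and v: "norm v \<le> C"
    and T: "open T" "t \<in> T" and \<delta>: "\<And>\<tau>. \<tau> \<in> T \<Longrightarrow> \<delta> \<tau> = \<gamma> (a + b * \<tau>)"
  shows "\<exists>v. ((\<lambda>\<tau>. to_coord P s (\<delta> \<tau>)) has_vector_derivative v) (at t) \<and> norm v \<le> \<bar>b\<bar> * C"
proof (intro exI conjI)
  have "((\<lambda>\<tau>. a + b * \<tau>) has_real_derivative b) (at t)" by (auto intro!: derivative_eq_intros)
  then have "((\<lambda>\<tau>. a + b * \<tau>) has_vector_derivative b) (at t)"
    by (simp add: has_real_derivative_iff_has_vector_derivative)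
  from vector_diff_chain_at[OF this \<gamma>]
  have "((\<lambda>\<tau>. to_coord P s (\<gamma> (a + b * \<tau>))) has_vector_derivative b *\<^sub>R v) (at t)" by (simp add: o_def)
  then show "((\<lambda>\<tau>. to_coord P s (\<delta> \<tau>)) has_vector_derivative b *\<^sub>R v) (at t)"
    by (rule has_vector_derivative_transform_within_open[OF _ T]) (simp add: \<delta>)
  show "norm (b *\<^sub>R v) \<le> \<bar>b\<bar> * C" using v by (simp add: mult_left_mono)
qed

lemma lipschitz_on_affine_reparam:
  fixes \<gamma> :: "real \<Rightarrow> 'x"
  assumes \<gamma>: "L-lipschitz_on {0..1} \<gamma>" and S: "\<And>t. t \<in> S \<Longrightarrow> a + b * t \<in> {0..1}"
  shows "(L * \<bar>b\<bar>)-lipschitz_on S (\<lambda>t. \<gamma> (a + b * t))"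
proof (rule lipschitz_onI)
  fix s t assume "s \<in> S" "t \<in> S"
  then have "dist (\<gamma> (a + b * s)) (\<gamma> (a + b * t)) \<le> L * dist (a + b * s) (a + b * t)"
    by (intro lipschitz_onD[OF \<gamma>] S)
  also have "dist (a + b * s) (a + b * t) = \<bar>b\<bar> * dist s t"
    by (simp add: dist_real_def abs_mult[symmetric] right_diff_distrib)
  finally show "dist (\<gamma> (a + b * s)) (\<gamma> (a + b * t)) \<le> L * \<bar>b\<bar> * dist s t" by (simp add: mult.assoc)
qed (use lipschitz_on_nonneg[OF \<gamma>] in simp)

lemma fast_reverse:
  assumes "fast Z \<gamma> x y C"
  shows "fast Z (\<lambda>t. \<gamma> (1 - t)) y x C"
proof -
  obtain L N where L: "L-lipschitz_on {0..1} \<gamma>" and ends: "\<gamma> 0 = x" "\<gamma> 1 = y" and N: "negligible N"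
    "\<And>t. t \<in> {0<..<1} - N \<Longrightarrow> \<gamma> t \<notin> Z \<union> singular \<and>
        (\<exists>v. ((\<lambda>\<tau>. to_coord P (carr (\<gamma> t)) (\<gamma> \<tau>)) has_vector_derivative v) (at t) \<and> norm v \<le> C)"
    using assms unfolding fast_def by blast
  define M where "M = (\<lambda>t::real. 1 + (-1) * t) ` N"
  have M: "negligible M" unfolding M_def by (rule negligible_affine_image_real[OF N(1)])
  have mem: "t \<in> M" if "1 - t \<in> N" for t
    unfolding M_def using that by (intro image_eqI[of _ _ "1 - t"]) auto
  have "\<gamma> (1 - t) \<notin> Z \<union> singular \<and>
        (\<exists>v. ((\<lambda>\<tau>. to_coord P (carr (\<gamma> (1 - t))) (\<gamma> (1 - \<tau>))) has_vector_derivative v) (at t) \<and> norm v \<le> C)"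
    if t: "t \<in> {0<..<1} - M" for t
  proof -
    have t': "1 - t \<in> {0<..<1} - N" using t mem by auto
    obtain v where v: "((\<lambda>\<tau>. to_coord P (carr (\<gamma> (1 - t))) (\<gamma> \<tau>)) has_vector_derivative v) (at (1 + (-1) * t))" "norm v \<le> C"
      using N(2)[OF t'] by auto
    show ?thesis using fast_affine_piece[OF v open_UNIV, of "\<lambda>t. \<gamma> (1 - t)"] N(2)[OF t'] by simp
  qed
  moreover have "(L * \<bar>-1\<bar>)-lipschitz_on {0..1} (\<lambda>t. \<gamma> (1 + (-1) * t))"
    by (rule lipschitz_on_affine_reparam[OF L]) auto
  ultimately show ?thesis unfolding fast_def using M ends by (auto intro!: exI[of _ L])
qed

text \<open>Each curve is traversed in half the time, which doubles its speed; it is the speed that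
  the constant bounds.\<close>

lemma fast_join:
  assumes 1: "fast Z \<gamma>1 x y C" and 2: "fast Z \<gamma>2 y z C"
  obtains \<gamma> where "fast Z \<gamma> x z (2 * C)"
proof -
  obtain L1 N1 where L1: "L1-lipschitz_on {0..1} \<gamma>1" and ends1: "\<gamma>1 0 = x" "\<gamma>1 1 = y" and N1: "negligible N1"
    "\<And>t. t \<in> {0<..<1} - N1 \<Longrightarrow> \<gamma>1 t \<notin> Z \<union> singular \<and>
        (\<exists>v. ((\<lambda>\<tau>. to_coord P (carr (\<gamma>1 t)) (\<gamma>1 \<tau>)) has_vector_derivative v) (at t) \<and> norm v \<le> C)"
    using 1 unfolding fast_def by blast
  obtain L2 N2 where L2: "L2-lipschitz_on {0..1} \<gamma>2" and ends2: "\<gamma>2 0 = y" "\<gamma>2 1 = z" and N2: "negligible N2"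
    "\<And>t. t \<in> {0<..<1} - N2 \<Longrightarrow> \<gamma>2 t \<notin> Z \<union> singular \<and>
        (\<exists>v. ((\<lambda>\<tau>. to_coord P (carr (\<gamma>2 t)) (\<gamma>2 \<tau>)) has_vector_derivative v) (at t) \<and> norm v \<le> C)"
    using 2 unfolding fast_def by blast
  define \<gamma> where "\<gamma> t = (if t \<le> 1/2 then \<gamma>1 (0 + 2 * t) else \<gamma>2 (-1 + 2 * t))" for t
  \<comment> \<open>The exceptional times of both curves in the new parametrization, and the time of
    gluing, at which a derivative need not exist.\<close>
  define M where "M = (\<lambda>t::real. 0 + (1/2) * t) ` N1 \<union> ((\<lambda>t::real. 1/2 + (1/2) * t) ` N2 \<union> {1/2})"
  have M: "negligible M"
    unfolding M_def by (intro negligible_Un negligible_affine_image_real N1 N2 negligible_sing)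
  have mem1: "t \<in> M" if "2 * t \<in> N1" for t
    unfolding M_def using that by (intro UnI1 image_eqI[of _ _ "2 * t"]) auto
  have mem2: "t \<in> M" if "2 * t - 1 \<in> N2" for t
  proof -
    have "t = 1/2 + (1/2) * (2 * t - 1)" by (simp add: field_simps)
    then have "t \<in> (\<lambda>t::real. 1/2 + (1/2) * t) ` N2" using that by (rule image_eqI)
    then show ?thesis unfolding M_def by blast
  qed
  have mem3: "1/2 \<in> M" by (simp add: M_def)
  have lip: "(max (L1 * \<bar>2\<bar>) (L2 * \<bar>2\<bar>))-lipschitz_on {0..1} \<gamma>"
    unfolding \<gamma>_def[abs_def]
  proof (rule lipschitz_on_concat_max)
    show "(L1 * \<bar>2\<bar>)-lipschitz_on {0..1/2} (\<lambda>t. \<gamma>1 (0 + 2 * t))" by (rule lipschitz_on_affine_reparam[OF L1]) auto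
    show "(L2 * \<bar>2\<bar>)-lipschitz_on {1/2..1} (\<lambda>t. \<gamma>2 (-1 + 2 * t))" by (rule lipschitz_on_affine_reparam[OF L2]) auto
    show "\<gamma>1 (0 + 2 * (1/2)) = \<gamma>2 (-1 + 2 * (1/2))" using ends1 ends2 by simp
  qed
  have key: "\<gamma> t \<notin> Z \<union> singular \<and>
        (\<exists>v. ((\<lambda>\<tau>. to_coord P (carr (\<gamma> t)) (\<gamma> \<tau>)) has_vector_derivative v) (at t) \<and> norm v \<le> 2 * C)"
    if t: "t \<in> {0<..<1} - M" for t
  proof (cases "t < 1/2")
    case True
    have t': "0 + 2 * t \<in> {0<..<1} - N1" using t True mem1 by auto
    obtain v where v: "((\<lambda>\<tau>. to_coord P (carr (\<gamma>1 (0 + 2 * t))) (\<gamma>1 \<tau>)) has_vector_derivative v) (at (0 + 2 * t))" "norm v \<le> C"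
      using N1(2)[OF t'] by blast
    have e: "\<gamma> t = \<gamma>1 (0 + 2 * t)" using True by (simp add: \<gamma>_def)
    show ?thesis using fast_affine_piece[OF v open_lessThan[of "1/2"], of \<gamma>] True N1(2)[OF t'] unfolding e
      by (simp add: \<gamma>_def)
  next
    case False
    then have T: "t > 1/2" using t mem3 by (cases "t = 1/2") auto
    have t': "-1 + 2 * t \<in> {0<..<1} - N2" using t T mem2[of t] by auto
    obtain v where v: "((\<lambda>\<tau>. to_coord P (carr (\<gamma>2 (-1 + 2 * t))) (\<gamma>2 \<tau>)) has_vector_derivative v) (at (-1 + 2 * t))" "norm v \<le> C"
      using N2(2)[OF t'] by blast
    have e: "\<gamma> t = \<gamma>2 (-1 + 2 * t)" using T by (simp add: \<gamma>_def)
    show ?thesis using fast_affine_piece[OF v open_greaterThan[of "1/2"], of \<gamma>] T N2(2)[OF t'] unfolding e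
      by (simp add: \<gamma>_def)
  qed
  have "\<gamma> 0 = x" "\<gamma> 1 = z" using ends1 ends2 by (auto simp: \<gamma>_def)
  with key lip M have "fast Z \<gamma> x z (2 * C)" unfolding fast_def by blast
  then show ?thesis by (rule that)
qed

text \<open>The bound on the speed gives a constant majorant of the length integrand, so
  monotonicity of the possibly lower integral is the only property of it that enters.\<close>

lemma fast_length:
  assumes f: "fast Z \<gamma> x y C" and C: "C \<ge> 0"
  shows "\<gamma> \<in> transversal_paths Z x y" "g_length P \<gamma> \<le> ennreal (\<Lambda> * C)"
proof -
  obtain L N where L: "L-lipschitz_on {0..1} \<gamma>" and ends: "\<gamma> 0 = x" "\<gamma> 1 = y" and N: "negligible N"
    "\<And>t. t \<in> {0<..<1} - N \<Longrightarrow> \<gamma> t \<notin> Z \<union> singular \<and>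
        (\<exists>v. ((\<lambda>\<tau>. to_coord P (carr (\<gamma> t)) (\<gamma> \<tau>)) has_vector_derivative v) (at t) \<and> norm v \<le> C)"
    using f unfolding fast_def by blast
  have "negligible (N \<union> {0, 1})" using N(1) by (intro negligible_Un) auto
  then have "negligible {t\<in>{0..1}. \<gamma> t \<in> Z}"
  proof (rule negligible_subset)
    show "{t\<in>{0..1}. \<gamma> t \<in> Z} \<subseteq> N \<union> {0, 1}"
    proof (rule subsetI, rule ccontr)
      fix t assume t: "t \<in> {t\<in>{0..1}. \<gamma> t \<in> Z}" and "t \<notin> N \<union> {0, 1}"
      then have "t \<in> {0<..<1} - N" by auto
      then have "\<gamma> t \<notin> Z" using N(2) by blast
      then show False using t by blast
    qed
  qed
  then show "\<gamma> \<in> transversal_paths Z x y" using L ends by (auto simp: transversal_paths_def)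
  have "g_length P \<gamma> \<le> (\<integral>\<^sup>+t\<in>{0..1::real}. ennreal (\<Lambda> * C) \<partial>lebesgue)"
    unfolding g_length_def
  proof (rule nn_integral_mono_AE)
    have "AE t in lebesgue. t \<notin> N \<union> {0, 1}"
      using \<open>negligible (N \<union> {0, 1})\<close> unfolding negligible_iff_null_sets by (rule AE_not_in)
    then show "AE t in lebesgue. ennreal (g_norm P (\<gamma> t) (vector_derivative (\<lambda>\<tau>. to_coord P (carr (\<gamma> t)) (\<gamma> \<tau>)) (at t))) *
         indicator {t \<in> {0..1}. carr (\<gamma> t) \<in> Mx} t \<le> ennreal (\<Lambda> * C) * indicator {0..1} t"
    proof eventually_elim
      case (elim t)
      show ?case
      proof (cases "t \<in> {0..1}")
        case True
        then have t: "t \<in> {0<..<1} - N" using elim by auto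
        obtain v where v: "((\<lambda>\<tau>. to_coord P (carr (\<gamma> t)) (\<gamma> \<tau>)) has_vector_derivative v) (at t)" "norm v \<le> C"
          using N(2)[OF t] by blast
        have ns: "\<gamma> t \<notin> singular" using N(2)[OF t] by blast
        note R = not_singular[OF ns]
        have "g_norm P (\<gamma> t) v \<le> \<Lambda> * norm v" using g_norm_bounds(2)[OF R(2), of v] R(3) by simp
        also have "\<dots> \<le> \<Lambda> * C" using v(2) \<Lambda>(1) by (intro mult_left_mono) auto
        finally show ?thesis using True vector_derivative_at[OF v(1)] by (auto simp: indicator_def intro: ennreal_leI)
      qed (auto simp: indicator_def)
    qed
  qed
  also have "\<dots> = ennreal (\<Lambda> * C)" by (simp add: nn_integral_cmult_indicator)
  finally show "g_length P \<gamma> \<le> ennreal (\<Lambda> * C)" .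
qed

text \<open>A straight segment in coordinates, run at constant velocity \<open>z - x\<close>; for
  almost every end \<open>z\<close> it meets the bad set at almost no time.\<close>

lemma fast_segment:
  assumes s: "s \<in> Mx" and x: "x \<in> Dm s" and Z: "Z \<in> null_sets (volume P)"
  shows "AE z in lebesgue. z \<in> Dm s \<longrightarrow>
     fast Z (\<lambda>t. from_coord P s ((1 - t) *\<^sub>R x + t *\<^sub>R z)) (from_coord P s x) (from_coord P s z) (norm (z - x))"
proof -
  let ?N = "{y\<in>Dm s. from_coord P s y \<in> Z \<union> singular}"
  have "Z \<union> singular \<in> null_sets (volume P)" using Z singular_null by blast
  then have "AE y in lebesgue. y \<notin> ?N" using s by (auto simp: null_sets_volume_iff)
  then have "negligible ?N" by (simp add: negligible_iff_null_sets completion.null_sets_iff_AE)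
  from AE_segment_avoids[OF this, of x] show ?thesis
  proof eventually_elim
    case (elim z)
    show ?case
    proof
      assume z: "z \<in> Dm s"
      let ?l = "\<lambda>t. (1 - t) *\<^sub>R x + t *\<^sub>R z"
      let ?\<gamma> = "\<lambda>t. from_coord P s (?l t)"
      obtain M where M: "negligible M" "\<And>t. t \<in> {0<..<1} - M \<Longrightarrow> ?l t \<notin> ?N" using elim by blast
      have l: "?l t \<in> Dm s" if "t \<in> {0..1}" for t
        using convexD[OF dom_convex[OF s] x z, of "1 - t" t] that by simp
      have dl: "dist (?l t) (?l t') = norm (z - x) * dist t t'" for t t'
      proof -
        have "?l t - ?l t' = (t - t') *\<^sub>R (z - x)" by (simp add: algebra_simps)
        then show ?thesis by (simp add: dist_norm)
      qed
      have "locally_lipschitz {0..1} dist dist ?l"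
        unfolding locally_lipschitz_def by (intro ballI exI[of _ 1] conjI exI[of _ "norm (z - x)"] impI) (simp_all add: dl)
      then have "locally_lipschitz {0..1} dist dist (\<lambda>t. from_coord P s (?l t))"
        by (rule locally_lipschitz_compose[OF _ locally_lipschitz_from_coord[OF s]]) (use l in auto)
      then obtain L where L: "L-lipschitz_on {0..1} ?\<gamma>"
        by (rule locally_lipschitz_compact_imp_lipschitz) auto
      have "?\<gamma> t \<notin> Z \<union> singular \<and>
        (\<exists>v. ((\<lambda>\<tau>. to_coord P (carr (?\<gamma> t)) (?\<gamma> \<tau>)) has_vector_derivative v) (at t) \<and> norm v \<le> norm (z - x))"
        if t: "t \<in> {0<..<1} - M" for t
      proof
        show ns: "?\<gamma> t \<notin> Z \<union> singular" using M(2)[OF t] l[of t] t by auto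
        then have c: "carr (?\<gamma> t) \<in> Mx" using not_singular(1) by blast
        \<comment> \<open>A nonsingular point has a maximal carrier, and a maximal simplex contained
          in \<open>s\<close> is \<open>s\<close>.\<close>
        have cs: "carr (?\<gamma> t) = s"
          using maximal_subset[OF c from_coord_dom(2)[OF s l] maximal_in[OF s]] t by simp
        have "(?l has_vector_derivative z - x) (at t)" by (auto intro!: derivative_eq_intros simp: algebra_simps)
        then have "((\<lambda>\<tau>. to_coord P s (?\<gamma> \<tau>)) has_vector_derivative z - x) (at t)"
          by (rule has_vector_derivative_transform_within_open[OF _ open_greaterThanLessThan[of 0 1]])
             (use t l from_coord_dom(3)[OF s] in auto)
        then show "\<exists>v. ((\<lambda>\<tau>. to_coord P (carr (?\<gamma> t)) (?\<gamma> \<tau>)) has_vector_derivative v) (at t) \<and> norm v \<le> norm (z - x)"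
          unfolding cs by blast
      qed
      then show "fast Z ?\<gamma> (from_coord P s x) (from_coord P s z) (norm (z - x))"
        unfolding fast_def using L M(1) by auto
    qed
  qed
qed

text \<open>The segment from \<open>x\<close> to \<open>y\<close> may run inside the null set, so
  the curve goes through a generic interior point within distance \<open>r\<close> of
  \<open>x\<close>. Genericity concerns the far end of a segment, hence both legs are built towards
  that point and the second is reversed. Each leg has speed at most \<open>r + norm (x - y)\<close>,
  and joining doubles it.\<close>

lemma fast_in_simplex:
  assumes s: "s \<in> Mx" and xy: "x \<in> Dm s" "y \<in> Dm s" and Z: "Z \<in> null_sets (volume P)" and r: "r > 0"
  obtains \<gamma> where "fast Z \<gamma> (from_coord P s x) (from_coord P s y) (2 * (r + norm (x - y)))"
proof -
  let ?T = "interior (Dm s) \<inter> ball x r"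
  have "closure (interior (Dm s)) = closure (Dm s)"
    by (rule convex_closure_interior[OF dom_convex[OF s] interior_dom_nonempty[OF s]])
  then have "x \<in> closure (interior (Dm s))" using xy(1) closure_subset by blast
  then obtain z0 where "z0 \<in> interior (Dm s)" "dist z0 x < r" unfolding closure_approachable using r by blast
  then have "z0 \<in> ?T" by (simp add: dist_commute)
  then have ne: "?T \<noteq> {}" by blast
  have op: "open ?T" by (intro open_Int open_ball open_interior)
  have ae: "AE z in lebesgue. z \<in> Dm s \<longrightarrow>
      (\<exists>\<gamma>. fast Z \<gamma> (from_coord P s x) (from_coord P s z) (norm (z - x))) \<and>
      (\<exists>\<gamma>. fast Z \<gamma> (from_coord P s y) (from_coord P s z) (norm (z - y)))"
    using fast_segment[OF s xy(1) Z] fast_segment[OF s xy(2) Z] by eventually_elim blast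
  obtain z where z: "z \<in> ?T" "z \<in> Dm s \<longrightarrow>
      (\<exists>\<gamma>. fast Z \<gamma> (from_coord P s x) (from_coord P s z) (norm (z - x))) \<and>
      (\<exists>\<gamma>. fast Z \<gamma> (from_coord P s y) (from_coord P s z) (norm (z - y)))"
    by (rule AE_open_obtain[OF ae op ne])
  then have "z \<in> Dm s" using interior_subset by blast
  then obtain \<gamma>1 \<gamma>2 where "fast Z \<gamma>1 (from_coord P s x) (from_coord P s z) (norm (z - x))"
      "fast Z \<gamma>2 (from_coord P s y) (from_coord P s z) (norm (z - y))" using z(2) by blast
  moreover have "norm (z - x) \<le> r + norm (x - y)" "norm (z - y) \<le> r + norm (x - y)"
    using z(1) norm_triangle_ineq[of "z - x" "x - y"] norm_ge_zero[of "x - y"]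
    by (auto simp: dist_norm norm_minus_commute intro: add_increasing2)
  ultimately have "fast Z \<gamma>1 (from_coord P s x) (from_coord P s z) (r + norm (x - y))"
      "fast Z (\<lambda>t. \<gamma>2 (1 - t)) (from_coord P s z) (from_coord P s y) (r + norm (x - y))"
    using fast_mono fast_reverse by blast+
  from fast_join[OF this] show ?thesis using that by blast
qed

lemma intrinsic_edist_le:
  assumes "\<And>Z. Z \<in> null_sets (volume P) \<Longrightarrow> \<exists>\<gamma>. fast Z \<gamma> x y C" and C: "C \<ge> 0"
  shows "intrinsic_edist P x y \<le> ennreal (\<Lambda> * C)"
  unfolding intrinsic_edist_def
proof (rule SUP_least)
  fix Z assume "Z \<in> null_sets (volume P)"
  then obtain \<gamma> where "fast Z \<gamma> x y C" using assms by blast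
  note fl = fast_length[OF this C]
  show "(INF \<gamma>\<in>transversal_paths Z x y. g_length P \<gamma>) \<le> ennreal (\<Lambda> * C)"
    using INF_lower[OF fl(1), of "g_length P"] fl(2) by (rule order_trans)
qed

text \<open>The bound has to be chosen before the null set, because the distance is a supremum over
  all null sets.\<close>

definition reach :: "'x \<Rightarrow> 'x \<Rightarrow> bool" where
  "reach x y \<longleftrightarrow> (\<exists>C\<ge>0. \<forall>Z\<in>null_sets (volume P). \<exists>\<gamma>. fast Z \<gamma> x y C)"

lemma reach_trans: assumes "reach x y" "reach y z" shows "reach x z"
proof -
  obtain C1 C2 where C: "C1 \<ge> 0" "C2 \<ge> 0" "\<forall>Z\<in>null_sets (volume P). \<exists>\<gamma>. fast Z \<gamma> x y C1"
      "\<forall>Z\<in>null_sets (volume P). \<exists>\<gamma>. fast Z \<gamma> y z C2" using assms by (auto simp: reach_def)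
  have "\<exists>\<gamma>. fast Z \<gamma> x z (2 * max C1 C2)" if Z: "Z \<in> null_sets (volume P)" for Z
  proof -
    obtain \<gamma>1 \<gamma>2 where "fast Z \<gamma>1 x y C1" "fast Z \<gamma>2 y z C2" using C Z by blast
    then have "fast Z \<gamma>1 x y (max C1 C2)" "fast Z \<gamma>2 y z (max C1 C2)" using fast_mono max.cobounded1 max.cobounded2 by blast+
    then show ?thesis using fast_join by metis
  qed
  then show ?thesis unfolding reach_def using C by (intro exI[of _ "2 * max C1 C2"]) (auto simp: le_max_iff_disj)
qed

lemma reach_simplex:
  assumes s: "s \<in> Mx" and p: "carr p \<subseteq> s" "carr q \<subseteq> s"
  shows "reach p q"
proof -
  have "\<exists>\<gamma>. fast Z \<gamma> p q (2 * (1 + norm (to_coord P s p - to_coord P s q)))" if Z: "Z \<in> null_sets (volume P)" for Z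
    using fast_in_simplex[OF s to_coord_carr(2)[OF s p(1)] to_coord_carr(2)[OF s p(2)] Z zero_less_one]
      to_coord_carr(3)[OF s p(1)] to_coord_carr(3)[OF s p(2)] by metis
  then show ?thesis unfolding reach_def by (intro exI[of _ "2 * (1 + norm (to_coord P s p - to_coord P s q))"]) auto
qed

lemma reach_near: assumes "carr p \<subseteq> carr q" shows "reach p q" "reach q p"
proof -
  obtain s where "s \<in> Mx" "carr q \<subseteq> s" using simplex_subset_maximal[OF carr_in] by metis
  then show "reach p q" "reach q p" using reach_simplex assms by (meson order_trans)+
qed

text \<open>The points whose carrier contains that of \<open>p\<close> form an open neighbourhood of
  \<open>p\<close> and are joined to \<open>p\<close> in both directions. So the points reachable
  from \<open>x\<close> and the remaining points both form open sets, and the space is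
  connected.\<close>

lemma reach_all: "reach x y"
proof -
  have open_star': "open {q. carr p \<subseteq> carr q}" for p
    by (rule open_star[OF simplex_finite[OF carr_in]])
  let ?S = "{y. reach x y}"
  have "open ?S"
    unfolding open_subopen[of ?S]
  proof (intro ballI exI conjI)
    fix p assume p: "p \<in> ?S"
    show "open {q. carr p \<subseteq> carr q}" by (rule open_star')
    show "{q. carr p \<subseteq> carr q} \<subseteq> ?S" using p reach_trans reach_near(1) by blast
  qed simp
  moreover have "open (- ?S)"
    unfolding open_subopen[of "- ?S"]
  proof (intro ballI exI conjI)
    fix p assume p: "p \<in> - ?S"
    show "open {q. carr p \<subseteq> carr q}" by (rule open_star')
    show "{q. carr p \<subseteq> carr q} \<subseteq> - ?S" using p reach_trans reach_near(2) by blast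
  qed simp
  moreover have "x \<in> ?S" using reach_near(1)[of x x] by simp
  moreover have "connected (UNIV :: 'x set)" using lip_poly by (simp add: lipschitz_polyhedron_def)
  ultimately have "- ?S = {}" unfolding connected_def by (metis Compl_disjoint Compl_partition2 Int_UNIV_right UNIV_I Un_Int_eq(1) disjoint_iff inf.idem subset_UNIV sup_commute)
  then show ?thesis by blast
qed

lemma intrinsic_edist_finite: "intrinsic_edist P x y < \<infinity>"
proof -
  obtain C where "C \<ge> 0" "\<forall>Z\<in>null_sets (volume P). \<exists>\<gamma>. fast Z \<gamma> x y C"
    using reach_all unfolding reach_def by blast
  then have "intrinsic_edist P x y \<le> ennreal (\<Lambda> * C)" by (intro intrinsic_edist_le) auto
  then show ?thesis using le_less_trans by fastforce
qed

lemma intrinsic_dist_lower: "dist (emb P x) (emb P y) \<le> \<Lambda> * intrinsic_dist P x y"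
proof -
  have "enn2real (ennreal (dist (emb P x) (emb P y) / \<Lambda>)) \<le> intrinsic_dist P x y"
    unfolding intrinsic_dist_def
    by (rule enn2real_mono[OF emb_dist_le_intrinsic_edist]) (use intrinsic_edist_finite in simp)
  then show ?thesis using \<Lambda>(1) by (simp add: pos_divide_le_eq mult.commute)
qed

lemma intrinsic_dist_nonneg: "0 \<le> intrinsic_dist P x y"
  by (simp add: intrinsic_dist_def)

text \<open>The factor 2 is the price of passing through a third point. That point may be taken
  arbitrarily close to \<open>x\<close>; with \<open>r = e / (2 * \<Lambda>)\<close> the detour
  costs exactly \<open>e\<close>.\<close>

lemma intrinsic_dist_upper:
  assumes s: "s \<in> Mx" and xy: "x \<in> Dm s" "y \<in> Dm s"
  shows "intrinsic_dist P (from_coord P s x) (from_coord P s y) \<le> 2 * \<Lambda> * norm (x - y)"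
proof (rule field_le_epsilon)
  fix e :: real assume e: "e > 0"
  define r where "r = e / (2 * \<Lambda>)"
  have r: "r > 0" using e \<Lambda>(1) by (simp add: r_def)
  have "intrinsic_edist P (from_coord P s x) (from_coord P s y) \<le> ennreal (\<Lambda> * (2 * (r + norm (x - y))))"
    using fast_in_simplex[OF s xy _ r] r by (intro intrinsic_edist_le) (metis, simp)
  then have "intrinsic_dist P (from_coord P s x) (from_coord P s y) \<le> \<Lambda> * (2 * (r + norm (x - y)))"
    unfolding intrinsic_dist_def using r \<Lambda>(1) enn2real_mono[of _ "ennreal (\<Lambda> * (2 * (r + norm (x - y))))"] by fastforce
  also have "\<dots> = 2 * \<Lambda> * norm (x - y) + e" using \<Lambda>(1) by (simp add: r_def field_simps)
  finally show "intrinsic_dist P (from_coord P s x) (from_coord P s y) \<le> 2 * \<Lambda> * norm (x - y) + e" .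
qed

end

section \<open>Sobolev gradients\<close>

text \<open>The quadratic form is nonnegative at \<open>\<eta> + t *\<^sub>R (A *v \<eta>)\<close>
  for all \<open>t\<close>; the choice \<open>t = - (1 / M)\<close> gives the bound.\<close>

lemma symmetric_psd_bound:
  fixes A :: "real^'n^'n"
  assumes sym: "transpose A = A" and psd: "\<And>\<xi>. 0 \<le> \<xi> \<bullet> (A *v \<xi>)" and up: "\<And>\<xi>. \<xi> \<bullet> (A *v \<xi>) \<le> M * (norm \<xi>)\<^sup>2"
  shows "(norm (A *v \<eta>))\<^sup>2 \<le> M * (\<eta> \<bullet> (A *v \<eta>))"
proof (cases "A *v \<eta> = 0")
  case False
  define \<zeta> where "\<zeta> = A *v \<eta>"
  have \<zeta>: "(norm \<zeta>)\<^sup>2 > 0" using False by (simp add: \<zeta>_def)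
  have s: "\<zeta> \<bullet> (A *v \<eta>) = (norm \<zeta>)\<^sup>2" by (simp add: \<zeta>_def power2_norm_eq_inner)
  have s': "\<eta> \<bullet> (A *v \<zeta>) = (norm \<zeta>)\<^sup>2"
    using dot_lmul_matrix[of \<eta> A \<zeta>] sym by (simp add: \<zeta>_def power2_norm_eq_inner vector_transpose_matrix[symmetric])
  have ex: "(\<eta> + t *\<^sub>R \<zeta>) \<bullet> (A *v (\<eta> + t *\<^sub>R \<zeta>)) = \<eta> \<bullet> (A *v \<eta>) + 2 * t * (norm \<zeta>)\<^sup>2 + t\<^sup>2 * (\<zeta> \<bullet> (A *v \<zeta>))" for t
    using s s' by (simp add: matrix_vector_right_distrib matrix_vector_mult_scaleR inner_add_left inner_add_right power2_eq_square algebra_simps)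
  have q: "0 \<le> \<eta> \<bullet> (A *v \<eta>) + 2 * t * (norm \<zeta>)\<^sup>2 + t\<^sup>2 * (\<zeta> \<bullet> (A *v \<zeta>))" for t
    using psd[of "\<eta> + t *\<^sub>R \<zeta>"] unfolding ex .
  \<comment> \<open>Otherwise the form vanishes identically, and the quadratic inequality
    \<open>q\<close> degenerates to a linear one that fails at \<open>t = -1\<close>.\<close>
  have M: "M > 0"
  proof (rule ccontr)
    assume nM: "\<not> M > 0"
    have "M * (norm \<xi>)\<^sup>2 \<le> 0" for \<xi> :: "real^'n" using nM by (intro mult_nonpos_nonneg) auto
    then have "\<xi> \<bullet> (A *v \<xi>) = 0" for \<xi> using psd[of \<xi>] up[of \<xi>] by (meson order_antisym order_trans)
    then show False using q[of "-1"] \<zeta> by simp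
  qed
  define t where "t = - (1 / M)"
  have "0 \<le> \<eta> \<bullet> (A *v \<eta>) + 2 * t * (norm \<zeta>)\<^sup>2 + t\<^sup>2 * (\<zeta> \<bullet> (A *v \<zeta>))" by (rule q)
  also have "\<dots> \<le> \<eta> \<bullet> (A *v \<eta>) + 2 * t * (norm \<zeta>)\<^sup>2 + t\<^sup>2 * (M * (norm \<zeta>)\<^sup>2)"
    by (intro add_left_mono mult_left_mono up) simp
  also have "\<dots> = \<eta> \<bullet> (A *v \<eta>) - (norm \<zeta>)\<^sup>2 / M" using M by (simp add: t_def power2_eq_square field_simps)
  finally show ?thesis using M by (simp add: \<zeta>_def pos_divide_le_eq mult.commute)
next
  case True then show ?thesis by simp
qed

lemma continuous_on_matrix_vector: "continuous_on UNIV (\<lambda>z. (fst z :: real^'n^'n) *v (snd z :: real^'n))"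
  unfolding matrix_vector_mult_def by (intro continuous_intros)

context riem_polyhedron
begin

section \<open>Lipschitz functions and their gradients in coordinates\<close>

definition piece :: "'v set \<Rightarrow> 'x set \<Rightarrow> (real^'n) set" where
  "piece s U = interior (Dm s) \<inter> from_coord P s -` U"

lemma piece_open: assumes s: "s \<in> Mx" and U: "open U" shows "open (piece s U)"
proof -
  have "continuous_on (interior (Dm s)) (from_coord P s)"
    by (rule continuous_on_subset[OF continuous_from_coord[OF s] interior_subset])
  then show ?thesis unfolding piece_def
    using continuous_on_open_vimage[OF open_interior] U by (metis Int_commute)
qed

lemma piece_dom: "piece s U \<subseteq> Dm s"
  unfolding piece_def using interior_subset by blast

lemma piece_lebesgue: "s \<in> Mx \<Longrightarrow> open U \<Longrightarrow> piece s U \<in> sets lebesgue"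
  using piece_open by auto

lemma regular_piece: "regular s x \<Longrightarrow> from_coord P s x \<in> U \<Longrightarrow> x \<in> piece s U"
  by (simp add: regular_def piece_def)

text \<open>In coordinates the intrinsic distance is at most \<open>2 * \<Lambda>\<close> times the
  Euclidean one. Extending the function to the whole coordinate space brings it within reach of
  Rademacher's theorem.\<close>

lemma chart_extension:
  assumes s: "s \<in> Mx" and u: "\<And>p q. p \<in> U \<Longrightarrow> q \<in> U \<Longrightarrow> \<bar>u p - u q\<bar> \<le> C * intrinsic_dist P p q" and C: "C \<ge> 0"
  obtains F where "(2 * \<Lambda> * C)-lipschitz_on UNIV F" "\<And>x. x \<in> Dm s \<Longrightarrow> from_coord P s x \<in> U \<Longrightarrow> F x = u (from_coord P s x)"
proof -
  have "(2 * \<Lambda> * C)-lipschitz_on {x \<in> Dm s. from_coord P s x \<in> U} (\<lambda>x. u (from_coord P s x))"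
  proof (rule lipschitz_onI)
    fix x y assume xy: "x \<in> {x \<in> Dm s. from_coord P s x \<in> U}" "y \<in> {x \<in> Dm s. from_coord P s x \<in> U}"
    have "\<bar>u (from_coord P s x) - u (from_coord P s y)\<bar> \<le> C * intrinsic_dist P (from_coord P s x) (from_coord P s y)"
      using xy by (intro u) auto
    also have "\<dots> \<le> C * (2 * \<Lambda> * norm (x - y))"
      using xy by (intro mult_left_mono intrinsic_dist_upper s C) auto
    finally show "dist (u (from_coord P s x)) (u (from_coord P s y)) \<le> 2 * \<Lambda> * C * dist x y"
      by (simp add: dist_real_def dist_norm algebra_simps)
  qed (use C \<Lambda>(1) in simp)
  then obtain F where F: "(2 * \<Lambda> * C)-lipschitz_on UNIV F"
      "\<And>x. x \<in> {x \<in> Dm s. from_coord P s x \<in> U} \<Longrightarrow> F x = u (from_coord P s x)"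
    by (rule lipschitz_extension_real) blast
  show ?thesis by (rule that[OF F(1)]) (rule F(2), blast)
qed

lemma extension_derivative:
  assumes s: "s \<in> Mx" and U: "open U" and F: "L-lipschitz_on UNIV F"
    and Fu: "\<And>x. x \<in> Dm s \<Longrightarrow> from_coord P s x \<in> U \<Longrightarrow> F x = u (from_coord P s x)"
  shows "AE x in lebesgue. x \<in> piece s U \<longrightarrow> ((\<lambda>x. u (from_coord P s x)) has_derivative (\<lambda>v. v \<bullet> lip_gradient F x)) (at x)"
  using AE_completion[OF Rademacher[OF F]]
proof eventually_elim
  case (elim x)
  show ?case
  proof
    assume x: "x \<in> piece s U"
    show "((\<lambda>x. u (from_coord P s x)) has_derivative (\<lambda>v. v \<bullet> lip_gradient F x)) (at x)"
      by (rule has_derivative_transform_within_open[OF elim piece_open[OF s U] x])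
         (use Fu piece_dom in \<open>auto simp: piece_def dest: subsetD[OF interior_subset]\<close>)
  qed
qed

text \<open>The metric matrix cancels the inverse matrix that raises the index in
  \<open>gradient\<close>. Hence the pairing of any field with a gradient is the plain Euclidean
  inner product with the partial derivatives.\<close>

lemma gradient_from_coord:
  assumes r: "regular s x" and d: "((\<lambda>x. u (from_coord P s x)) has_derivative (\<lambda>v. v \<bullet> D)) (at x)"
  shows "metric_coeff P s x *v gradient P u (from_coord P s x) = D"
    and "g_inner P (from_coord P s x) \<xi> (gradient P u (from_coord P s x)) = \<xi> \<bullet> D"
proof -
  have s: "s \<in> Mx" "carr (from_coord P s x) = s" using r by (auto simp: regular_def)
  have tc: "to_coord P s (from_coord P s x) = x" by (rule from_coord_dom(3)[OF s(1) regular_dom[OF r]])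
  have fd: "frechet_derivative (\<lambda>x. u (from_coord P s x)) (at x) = (\<lambda>v. v \<bullet> D)"
    using frechet_derivative_at[OF d] by simp
  have "(\<lambda>x. u (from_coord P s x)) differentiable (at x)" using d by (auto simp: differentiable_def)
  then have "gradient P u (from_coord P s x) = matrix_inv (metric_coeff P s x) *v (\<chi> i. axis i 1 \<bullet> D)"
    using s by (simp add: gradient_def Let_def tc fd)
  also have "(\<chi> i. axis i 1 \<bullet> D) = D" by (simp add: vec_eq_iff inner_axis')
  finally have g: "gradient P u (from_coord P s x) = matrix_inv (metric_coeff P s x) *v D" .
  show 1: "metric_coeff P s x *v gradient P u (from_coord P s x) = D"
    unfolding g using matrix_inv_both(1)[OF regular_metric(3)[OF r]] by (simp add: matrix_vector_mul_assoc)
  show "g_inner P (from_coord P s x) \<xi> (gradient P u (from_coord P s x)) = \<xi> \<bullet> D"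
    by (simp add: g_inner_def metric_at_from_coord[OF r] 1)
qed

lemma metric_vector_bound:
  assumes r: "regular s x" and sym: "transpose (metric_coeff P s x) = metric_coeff P s x"
  shows "(norm (metric_coeff P s x *v \<eta>))\<^sup>2 \<le> \<Lambda>\<^sup>2 * (g_norm P (from_coord P s x) \<eta>)\<^sup>2"
proof -
  have psd: "0 \<le> \<xi> \<bullet> (metric_coeff P s x *v \<xi>)" for \<xi>
    using regular_metric(1)[OF r, of \<xi>] by (rule order_trans[rotated]) simp
  have "(g_norm P (from_coord P s x) \<eta>)\<^sup>2 = \<eta> \<bullet> (metric_coeff P s x *v \<eta>)"
    using psd[of \<eta>] by (simp add: g_norm_def g_inner_def metric_at_from_coord[OF r])
  then show ?thesis using symmetric_psd_bound[OF sym psd regular_metric(2)[OF r], of \<eta>] by simp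
qed

lemma measurable_dom_AE:
  fixes f g :: "real^'n \<Rightarrow> 'b::topological_space"
  assumes s: "s \<in> Mx" and f: "f \<in> borel_measurable (lebesgue_on (Dm s))"
    and ae: "AE x in lebesgue. x \<in> Dm s \<longrightarrow> f x = g x"
  shows "g \<in> borel_measurable (lebesgue_on (Dm s))"
proof (rule measurableI)
  fix A assume A: "A \<in> sets (borel :: 'b measure)"
  have 1: "f -` A \<inter> Dm s \<in> sets lebesgue"
    using measurable_sets[OF f A] sets_lebesgue_on_dom[OF s, of "f -` A \<inter> Dm s"] by simp
  have "g -` A \<inter> Dm s \<in> sets lebesgue"
  proof (rule completion.in_sets_AE[OF _ 1])
    show "AE x in lebesgue. (x \<in> f -` A \<inter> Dm s) = (x \<in> g -` A \<inter> Dm s)"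
      using ae by eventually_elim auto
  qed simp
  then show "g -` A \<inter> space (lebesgue_on (Dm s)) \<in> sets (lebesgue_on (Dm s))"
    using sets_lebesgue_on_dom[OF s, of "g -` A \<inter> Dm s"] by simp
qed simp

text \<open>The function \<open>h\<close> need not be measurable: \<open>nn_integral\<close> is then a lower integral.\<close>

lemma chart_integral_le:
  assumes s: "s \<in> Mx" and \<phi>: "\<phi> \<in> borel_measurable (lebesgue_on (Dm s))"
    and le: "AE x in lebesgue. x \<in> Dm s \<longrightarrow> \<phi> x \<le> h (from_coord P s x)"
  shows "ennreal (sqrt detmin) * (\<integral>\<^sup>+x\<in>Dm s. \<phi> x \<partial>lebesgue) \<le> integral\<^sup>N (volume P) h"
proof -
  \<comment> \<open>This function is \<phi> carried to the polyhedron and 0 off the open simplex of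
    \<open>s\<close>: a measurable minorant of \<open>h\<close> almost everywhere.\<close>
  define h' where "h' p = (if carr p = s then \<phi> (to_coord P s p) else 0)" for p
  have reg: "AE x in lebesgue. x \<in> Dm s \<longrightarrow> h' (from_coord P s x) = \<phi> x"
    using regular_AE[OF s] by eventually_elim (auto simp: h'_def regular_def from_coord_dom(3)[OF s])
  have other: "AE x in lebesgue. x \<in> Dm s' \<longrightarrow> h' (from_coord P s' x) = 0" if "s' \<in> Mx" "s' \<noteq> s" for s'
    using regular_AE[OF that(1)] by eventually_elim (use that in \<open>auto simp: h'_def regular_def\<close>)
  have h'm: "h' \<in> borel_measurable (volume P)"
    unfolding measurable_volume_iff
  proof
    fix s' assume s': "s' \<in> Mx"
    show "(\<lambda>x. h' (from_coord P s' x)) \<in> borel_measurable (lebesgue_on (Dm s'))"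
    proof (cases "s' = s")
      case True
      have "AE x in lebesgue. x \<in> Dm s \<longrightarrow> \<phi> x = h' (from_coord P s x)" using reg by eventually_elim simp
      then show ?thesis unfolding True by (rule measurable_dom_AE[OF s \<phi>])
    next
      case False
      have "AE x in lebesgue. x \<in> Dm s' \<longrightarrow> 0 = h' (from_coord P s' x)" using other[OF s' False] by eventually_elim simp
      then show ?thesis by (rule measurable_dom_AE[OF s' borel_measurable_const])
    qed
  qed
  have "ennreal (sqrt detmin) * (\<integral>\<^sup>+x\<in>Dm s. \<phi> x \<partial>lebesgue) = ennreal (sqrt detmin) * (\<integral>\<^sup>+x\<in>Dm s. h' (from_coord P s x) \<partial>lebesgue)"
    by (intro arg_cong2[where f="(*)"] refl nn_integral_cong_AE) (use reg in eventually_elim, auto simp: indicator_def)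
  also have "\<dots> \<le> integral\<^sup>N (volume P) h'" by (rule nn_integral_volume_ge[OF h'm s])
  also have "\<dots> \<le> integral\<^sup>N (volume P) h"
  proof (rule nn_integral_mono_AE)
    show "AE p in volume P. h' p \<le> h p"
      unfolding AE_volume_iff
    proof
      fix s' assume s': "s' \<in> Mx"
      show "AE x in lebesgue. x \<in> Dm s' \<longrightarrow> h' (from_coord P s' x) \<le> h (from_coord P s' x)"
      proof (cases "s' = s")
        case True
        show ?thesis unfolding True using reg le by eventually_elim simp
      next
        case False
        show ?thesis using other[OF s' False] by eventually_elim simp
      qed
    qed
  qed
  finally show ?thesis .
qed

lemma measurable_dom_restrict:
  fixes h :: "real^'n \<Rightarrow> 'b::real_normed_vector"
  assumes "s \<in> Mx"
  shows "h \<in> borel_measurable (lebesgue_on (Dm s)) \<longleftrightarrow> (\<lambda>x. indicator (Dm s) x *\<^sub>R h x) \<in> borel_measurable lebesgue"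
  using dom_lebesgue[OF assms] by (subst borel_measurable_restrict_space_iff) auto

lemma metric_vector_measurable:
  assumes s: "s \<in> Mx" and h: "h \<in> borel_measurable (lebesgue_on (Dm s))"
  shows "(\<lambda>x. metric_coeff P s x *v h x) \<in> borel_measurable (lebesgue_on (Dm s))"
  by (rule borel_measurable_continuous_Pair[OF metric_measurable[OF s] h continuous_on_matrix_vector])

lemma lipschitz_measurable_dom:
  assumes "L-lipschitz_on UNIV F"
  shows "F \<in> borel_measurable (lebesgue_on (Dm s))" "lip_gradient F \<in> borel_measurable (lebesgue_on (Dm s))"
proof -
  have [measurable]: "F \<in> borel_measurable borel" by (rule lipschitz_on_UNIV_measurable[OF assms])
  have "F \<in> borel_measurable lebesgue" by (rule measurable_completion) simp
  then show "F \<in> borel_measurable (lebesgue_on (Dm s))" by (rule measurable_restrict_space1)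
  have "lip_gradient F \<in> borel_measurable lebesgue" by (rule measurable_completion) simp
  then show "lip_gradient F \<in> borel_measurable (lebesgue_on (Dm s))" by (rule measurable_restrict_space1)
qed

lemma lipschitz_fun_obtain:
  assumes "lipschitz_fun P U u"
  obtains C where "C \<ge> 0" "\<And>p q. p \<in> U \<Longrightarrow> q \<in> U \<Longrightarrow> \<bar>u p - u q\<bar> \<le> C * intrinsic_dist P p q"
proof -
  obtain C where C: "\<And>p q. p \<in> U \<Longrightarrow> q \<in> U \<Longrightarrow> \<bar>u p - u q\<bar> \<le> C * intrinsic_dist P p q"
    using assms unfolding lipschitz_fun_def by blast
  have "\<bar>u p - u q\<bar> \<le> max C 0 * intrinsic_dist P p q" if "p \<in> U" "q \<in> U" for p q
    using C[OF that] mult_right_mono[OF max.cobounded1[of C 0] intrinsic_dist_nonneg[of p q]] by linarith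
  then show ?thesis using that[of "max C 0"] by simp
qed

lemma piece_measurable:
  fixes G :: "'x \<Rightarrow> 'b::{real_normed_vector, second_countable_topology}"
  assumes s: "s \<in> Mx" and G: "set_borel_measurable (volume P) U G"
  shows "(\<lambda>x. indicator U (from_coord P s x) *\<^sub>R G (from_coord P s x)) \<in> borel_measurable (lebesgue_on (Dm s))"
  using G s unfolding set_borel_measurable_def measurable_volume_iff by blast

text \<open>The approximating functions are Lipschitz in coordinates and are extended there.
  Multiplication by the metric matrix turns the gradient field \<open>G\<close> into the limit of
  their Euclidean gradients; ellipticity and the lower bound of the density compare the
  norms.\<close>

lemma sobolev_gradient_chart:
  assumes s: "s \<in> Mx" and U: "open U" and G: "sobolev_gradient_on P U f G"
  obtains F L where "\<And>k::nat. (L k)-lipschitz_on UNIV (F k)"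
    "\<And>k. (\<lambda>x. ennreal ((F k x - f (from_coord P s x))\<^sup>2 + (norm (lip_gradient (F k) x - metric_coeff P s x *v G (from_coord P s x)))\<^sup>2)
        * indicator (piece s U) x) \<in> borel_measurable lebesgue"
    "(\<lambda>k. \<integral>\<^sup>+x\<in>piece s U. ennreal ((F k x - f (from_coord P s x))\<^sup>2 +
        (norm (lip_gradient (F k) x - metric_coeff P s x *v G (from_coord P s x)))\<^sup>2) \<partial>lebesgue) \<longlonglongrightarrow> 0"
proof -
  obtain u where u: "\<And>k. lipschitz_fun P U (u k)"
      and lim: "(\<lambda>k. sobolev_norm_sq P U (\<lambda>p. u k p - f p) (\<lambda>p. gradient P (u k) p - G p)) \<longlonglongrightarrow> 0"
    and fm: "set_borel_measurable (volume P) U f" and Gm: "set_borel_measurable (volume P) U G"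
    using G unfolding sobolev_gradient_on_def by blast
  have "\<exists>F L. L-lipschitz_on UNIV F \<and> (\<forall>x. x \<in> Dm s \<longrightarrow> from_coord P s x \<in> U \<longrightarrow> F x = u k (from_coord P s x))" for k
  proof -
    obtain C where C: "C \<ge> 0" "\<And>p q. p \<in> U \<Longrightarrow> q \<in> U \<Longrightarrow> \<bar>u k p - u k q\<bar> \<le> C * intrinsic_dist P p q"
      using lipschitz_fun_obtain[OF u] by blast
    from chart_extension[OF s C(2,1)] show ?thesis by metis
  qed
  then obtain F L where F: "\<And>k. (L k)-lipschitz_on UNIV (F k)"
    and Fu: "\<And>k x. x \<in> Dm s \<Longrightarrow> from_coord P s x \<in> U \<Longrightarrow> F k x = u k (from_coord P s x)" by metis
  let ?O = "piece s U"
  let ?q = "\<lambda>k x. (F k x - f (from_coord P s x))\<^sup>2 + (norm (lip_gradient (F k) x - metric_coeff P s x *v G (from_coord P s x)))\<^sup>2"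
  define \<phi> where "\<phi> k x = ennreal (?q k x) * indicator ?O x" for k x
  have Oi: "(indicator ?O :: real^'n \<Rightarrow> real) \<in> borel_measurable (lebesgue_on (Dm s))"
    using piece_lebesgue[OF s U] by (intro measurable_restrict_space1 borel_measurable_indicator)
  have \<phi>m: "\<phi> k \<in> borel_measurable (lebesgue_on (Dm s))" for k
  proof -
    \<comment> \<open>\<open>f\<close> and \<open>G\<close> are known to be measurable only after
      multiplication by the indicator of \<open>U\<close>; on the piece the factor is 1.\<close>
    let ?f = "\<lambda>x. indicator U (from_coord P s x) *\<^sub>R f (from_coord P s x)"
    let ?G = "\<lambda>x. indicator U (from_coord P s x) *\<^sub>R G (from_coord P s x)"
    have m1: "(\<lambda>x. F k x - ?f x) \<in> borel_measurable (lebesgue_on (Dm s))"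
      by (intro borel_measurable_diff lipschitz_measurable_dom(1)[OF F] piece_measurable[OF s fm])
    have m2: "(\<lambda>x. norm (lip_gradient (F k) x - metric_coeff P s x *v ?G x)) \<in> borel_measurable (lebesgue_on (Dm s))"
      using borel_measurable_diff[OF lipschitz_measurable_dom(2)[OF F, of k s] metric_vector_measurable[OF s piece_measurable[OF s Gm]]]
      by measurable
    have "(\<lambda>x. ennreal (((F k x - ?f x)\<^sup>2 + (norm (lip_gradient (F k) x - metric_coeff P s x *v ?G x))\<^sup>2) * indicator ?O x))
        \<in> borel_measurable (lebesgue_on (Dm s))"
      by (intro measurable_compose[OF _ measurable_ennreal] borel_measurable_times borel_measurable_add borel_measurable_power m1 m2 Oi)
    also have "(\<lambda>x. ennreal (((F k x - ?f x)\<^sup>2 + (norm (lip_gradient (F k) x - metric_coeff P s x *v ?G x))\<^sup>2) * indicator ?O x)) = \<phi> k"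
      by (auto simp: \<phi>_def fun_eq_iff indicator_def piece_def)
    finally show ?thesis .
  qed
  have \<phi>l: "\<phi> k \<in> borel_measurable lebesgue" for k
  proof -
    have "(\<lambda>x. \<phi> k x * indicator (Dm s) x) \<in> borel_measurable lebesgue"
      using \<phi>m[of k] dom_lebesgue[OF s] by (subst (asm) borel_measurable_restrict_space_iff_ennreal) auto
    also have "(\<lambda>x. \<phi> k x * indicator (Dm s) x) = \<phi> k"
      using piece_dom[of s U] by (auto simp: \<phi>_def indicator_def fun_eq_iff)
    finally show ?thesis .
  qed
  define N where "N k = sobolev_norm_sq P U (\<lambda>p. u k p - f p) (\<lambda>p. gradient P (u k) p - G p)" for k
  \<comment> \<open>The term with the function values is compared with factor 1 and the gradient
    term with factor \<open>\<Lambda>\<^sup>2\<close>; their sum serves both. In \<open>d\<close>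
    this is combined with the lower bound of the volume density.\<close>
  define c where "c = 1 + \<Lambda>\<^sup>2"
  have c: "c > 0" unfolding c_def by (simp add: add_pos_nonneg)
  define d where "d = sqrt detmin / c"
  have d: "d > 0" using detmin_pos c by (simp add: d_def)
  have est: "ennreal d * integral\<^sup>N lebesgue (\<phi> k) \<le> N k" for k
  proof -
    have ed: "AE x in lebesgue. x \<in> ?O \<longrightarrow> ((\<lambda>x. u k (from_coord P s x)) has_derivative (\<lambda>v. v \<bullet> lip_gradient (F k) x)) (at x)"
      by (rule extension_derivative[OF s U F]) (rule Fu)
    have sym: "AE x in lebesgue. x \<in> Dm s \<longrightarrow> transpose (metric_coeff P s x) = metric_coeff P s x"
      by (rule iffD1[OF AE_dom[OF s] metric_symmetric[OF s]])
    have "AE x in lebesgue. x \<in> Dm s \<longrightarrow> ennreal (1 / c) * \<phi> k x \<le>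
       ennreal ((u k (from_coord P s x) - f (from_coord P s x))\<^sup>2 +
         (g_norm P (from_coord P s x) (gradient P (u k) (from_coord P s x) - G (from_coord P s x)))\<^sup>2) * indicator U (from_coord P s x)"
      using ed regular_AE[OF s] sym
    proof eventually_elim
      case (elim x)
      show ?case
      proof (intro impI, cases "x \<in> ?O")
        case True
        assume x: "x \<in> Dm s"
        let ?p = "from_coord P s x" and ?A = "metric_coeff P s x"
        have pU: "?p \<in> U" using True by (simp add: piece_def)
        have r: "regular s x" using elim(2) x by blast
        have sy: "transpose ?A = ?A" using elim(3) x by blast
        have "lip_gradient (F k) x - ?A *v G ?p = ?A *v (gradient P (u k) ?p - G ?p)"
          using gradient_from_coord(1)[OF r elim(1)[rule_format, OF True]]
          by (simp add: matrix_vector_mult_diff_distrib)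
        then have b: "(norm (lip_gradient (F k) x - ?A *v G ?p))\<^sup>2 \<le> \<Lambda>\<^sup>2 * (g_norm P ?p (gradient P (u k) ?p - G ?p))\<^sup>2"
          using metric_vector_bound[OF r sy, of "gradient P (u k) ?p - G ?p"] by simp
        let ?a = "(u k ?p - f ?p)\<^sup>2" and ?b = "(g_norm P ?p (gradient P (u k) ?p - G ?p))\<^sup>2"
        have "?q k x \<le> ?a + \<Lambda>\<^sup>2 * ?b" using b Fu[OF x pU, of k] by simp
        also have "\<dots> \<le> c * (?a + ?b)" using mult_nonneg_nonneg[of "\<Lambda>\<^sup>2" ?a] by (simp add: c_def algebra_simps)
        finally have "1 / c * ?q k x \<le> ?a + ?b" using c by (simp add: pos_divide_le_eq mult.commute)
        then show "ennreal (1 / c) * \<phi> k x \<le> ennreal (?a + ?b) * indicator U ?p"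
          using True pU c by (simp add: \<phi>_def ennreal_mult[symmetric] ennreal_leI del: ennreal_plus)
      next
        case False
        then show "ennreal (1 / c) * \<phi> k x \<le>
       ennreal ((u k (from_coord P s x) - f (from_coord P s x))\<^sup>2 +
         (g_norm P (from_coord P s x) (gradient P (u k) (from_coord P s x) - G (from_coord P s x)))\<^sup>2) * indicator U (from_coord P s x)"
          by (simp add: \<phi>_def)
      qed
    qed
    then have "ennreal (sqrt detmin) * (\<integral>\<^sup>+x\<in>Dm s. ennreal (1 / c) * \<phi> k x \<partial>lebesgue) \<le> N k"
      unfolding N_def sobolev_norm_sq_def
      by (intro chart_integral_le[OF s] borel_measurable_times_ennreal borel_measurable_const \<phi>m)
    also have "(\<integral>\<^sup>+x\<in>Dm s. ennreal (1 / c) * \<phi> k x \<partial>lebesgue) = (\<integral>\<^sup>+x. ennreal (1 / c) * \<phi> k x \<partial>lebesgue)"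
      using piece_dom[of s U] by (intro nn_integral_cong) (auto simp: \<phi>_def indicator_def)
    also have "\<dots> = ennreal (1 / c) * integral\<^sup>N lebesgue (\<phi> k)" by (rule nn_integral_cmult[OF \<phi>l])
    finally show ?thesis using c detmin_pos by (simp add: d_def mult.assoc[symmetric] ennreal_mult[symmetric])
  qed
  have "(\<lambda>k. integral\<^sup>N lebesgue (\<phi> k)) \<longlonglongrightarrow> 0"
  proof (rule tendsto_sandwich[OF _ _ tendsto_const])
    have "(\<lambda>k. ennreal (1 / d) * N k) \<longlonglongrightarrow> ennreal (1 / d) * 0"
      using lim by (intro tendsto_mult_ennreal tendsto_const) (auto simp: N_def[abs_def])
    then show "(\<lambda>k. ennreal (1 / d) * N k) \<longlonglongrightarrow> 0" by simp
    have "integral\<^sup>N lebesgue (\<phi> k) \<le> ennreal (1 / d) * N k" for k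
    proof -
      have "integral\<^sup>N lebesgue (\<phi> k) = ennreal (1 / d) * (ennreal d * integral\<^sup>N lebesgue (\<phi> k))"
        using d by (simp add: mult.assoc[symmetric] ennreal_mult[symmetric])
      also have "\<dots> \<le> ennreal (1 / d) * N k" by (intro mult_left_mono est) simp
      finally show ?thesis .
    qed
    then show "\<forall>\<^sub>F k in sequentially. integral\<^sup>N lebesgue (\<phi> k) \<le> ennreal (1 / d) * N k" by simp
  qed simp
  then have "(\<lambda>k. \<integral>\<^sup>+x\<in>piece s U. ennreal (?q k x) \<partial>lebesgue) \<longlonglongrightarrow> 0"
    by (simp only: \<phi>_def[abs_def])
  moreover have "(\<lambda>x. ennreal (?q k x) * indicator (piece s U) x) \<in> borel_measurable lebesgue" for k
    using \<phi>l[of k] by (simp only: \<phi>_def[abs_def])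
  ultimately show ?thesis using that F by blast
qed

end

section \<open>Uniqueness and gluing of weak gradients\<close>

lemma lip_gradient_diff:
  fixes f g :: "'a::euclidean_space \<Rightarrow> real"
  assumes f: "L-lipschitz_on UNIV f" and g: "M-lipschitz_on UNIV g"
  shows "AE x in lborel. lip_gradient (\<lambda>x. f x - g x) x = lip_gradient f x - lip_gradient g x"
proof -
  have "AE x in lborel. \<forall>b\<in>Basis. dir_deriv (\<lambda>x. f x - g x) b x = dir_deriv f b x - dir_deriv g b x"
  proof (subst AE_ball_countable, rule countable_finite[OF finite_Basis], rule ballI)
    fix b :: 'a
    show "AE x in lborel. dir_deriv (\<lambda>x. f x - g x) b x = dir_deriv f b x - dir_deriv g b x"
      using lipschitz_AE_directional[OF f, of b] lipschitz_AE_directional[OF g, of b]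
    proof eventually_elim
      case (elim x)
      show ?case by (rule dir_deriv_eq[OF DERIV_diff[OF elim]])
    qed
  qed
  then show ?thesis
    by eventually_elim (simp add: lip_gradient_def scaleR_left_diff_distrib sum_subtractf)
qed

context riem_polyhedron
begin

text \<open>In each chart the difference of the two approximating sequences tends to 0 while its
  gradients tend to the metric matrix applied to \<open>G - G'\<close>. Closability makes this limit
  0, and coercivity of the matrix makes the difference 0.\<close>

theorem sobolev_gradient_unique:
  assumes U: "open U" and G: "sobolev_gradient_on P U f G" and G': "sobolev_gradient_on P U f G'"
  shows "AE p in volume P. p \<in> U \<longrightarrow> G p = G' p"
  unfolding AE_volume_iff
proof
  fix s assume s: "s \<in> Mx"
  let ?O = "piece s U" and ?A = "metric_coeff P s"
  let ?q = "\<lambda>F G x. (F x - f (from_coord P s x))\<^sup>2 + (norm (lip_gradient F x - ?A x *v G (from_coord P s x)))\<^sup>2"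
  obtain F L where F: "\<And>k::nat. (L k)-lipschitz_on UNIV (F k)"
    "\<And>k. (\<lambda>x. ennreal (?q (F k) G x) * indicator ?O x) \<in> borel_measurable lebesgue"
    "(\<lambda>k. \<integral>\<^sup>+x\<in>?O. ennreal (?q (F k) G x) \<partial>lebesgue) \<longlonglongrightarrow> 0"
    by (rule sobolev_gradient_chart[OF s U G]) blast
  obtain F' L' where F': "\<And>k::nat. (L' k)-lipschitz_on UNIV (F' k)"
    "\<And>k. (\<lambda>x. ennreal (?q (F' k) G' x) * indicator ?O x) \<in> borel_measurable lebesgue"
    "(\<lambda>k. \<integral>\<^sup>+x\<in>?O. ennreal (?q (F' k) G' x) \<partial>lebesgue) \<longlonglongrightarrow> 0"
    by (rule sobolev_gradient_chart[OF s U G']) blast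
  define w where "w k x = F k x - F' k x" for k x
  have w: "(L k + L' k)-lipschitz_on UNIV (w k)" for k
    unfolding w_def by (rule lipschitz_on_diff[OF F(1) F'(1)])
  define H where "H x = ?A x *v (G (from_coord P s x) - G' (from_coord P s x))" for x
  have "AE x in lebesgue. x \<in> ?O \<longrightarrow> H x = 0"
  proof (rule weak_gradient_closable[OF piece_open[OF s U] w])
    let ?i = "\<lambda>x. indicator U (from_coord P s x) :: real"
    have Gm: "set_borel_measurable (volume P) U G" "set_borel_measurable (volume P) U G'"
      using G G' by (auto simp: sobolev_gradient_on_def)
    have "(\<lambda>x. ?A x *v (?i x *\<^sub>R G (from_coord P s x) - ?i x *\<^sub>R G' (from_coord P s x))) \<in> borel_measurable (lebesgue_on (Dm s))"
      by (rule metric_vector_measurable[OF s borel_measurable_diff[OF piece_measurable[OF s Gm(1)] piece_measurable[OF s Gm(2)]]])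
    then have "(\<lambda>x. indicator (Dm s) x *\<^sub>R (?A x *v (?i x *\<^sub>R G (from_coord P s x) - ?i x *\<^sub>R G' (from_coord P s x)))) \<in> borel_measurable lebesgue"
      by (simp only: measurable_dom_restrict[OF s])
    then have "(\<lambda>x. indicator ?O x *\<^sub>R (indicator (Dm s) x *\<^sub>R (?A x *v (?i x *\<^sub>R G (from_coord P s x) - ?i x *\<^sub>R G' (from_coord P s x))))) \<in> borel_measurable lebesgue"
      by (rule borel_measurable_scaleR[OF borel_measurable_indicator[OF piece_lebesgue[OF s U]]])
    also have "(\<lambda>x. indicator ?O x *\<^sub>R (indicator (Dm s) x *\<^sub>R (?A x *v (?i x *\<^sub>R G (from_coord P s x) - ?i x *\<^sub>R G' (from_coord P s x)))))
        = (\<lambda>x. indicator ?O x *\<^sub>R H x)"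
    proof
      fix x
      show "indicator ?O x *\<^sub>R (indicator (Dm s) x *\<^sub>R (?A x *v (?i x *\<^sub>R G (from_coord P s x) - ?i x *\<^sub>R G' (from_coord P s x))))
          = indicator ?O x *\<^sub>R H x"
      proof (cases "x \<in> ?O")
        case True
        then have "x \<in> Dm s" "from_coord P s x \<in> U" using piece_dom[of s U] by (auto simp: piece_def)
        then show ?thesis by (simp add: H_def)
      qed simp
    qed
    finally show "(\<lambda>x. indicator ?O x *\<^sub>R H x) \<in> borel_measurable lebesgue" .
    have le: "(\<integral>\<^sup>+x\<in>?O. ennreal ((w k x)\<^sup>2 + (norm (lip_gradient (w k) x - H x))\<^sup>2) \<partial>lebesgue)
        \<le> 2 * (\<integral>\<^sup>+x\<in>?O. ennreal (?q (F k) G x) \<partial>lebesgue) + 2 * (\<integral>\<^sup>+x\<in>?O. ennreal (?q (F' k) G' x) \<partial>lebesgue)" for k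
    proof -
      have "(\<integral>\<^sup>+x\<in>?O. ennreal ((w k x)\<^sup>2 + (norm (lip_gradient (w k) x - H x))\<^sup>2) \<partial>lebesgue)
        \<le> (\<integral>\<^sup>+x. 2 * (ennreal (?q (F k) G x) * indicator ?O x) + 2 * (ennreal (?q (F' k) G' x) * indicator ?O x) \<partial>lebesgue)"
      proof (rule nn_integral_mono_AE)
        show "AE x in lebesgue. ennreal ((w k x)\<^sup>2 + (norm (lip_gradient (w k) x - H x))\<^sup>2) * indicator ?O x
           \<le> 2 * (ennreal (?q (F k) G x) * indicator ?O x) + 2 * (ennreal (?q (F' k) G' x) * indicator ?O x)"
          using AE_completion[OF lip_gradient_diff[OF F(1) F'(1), of k k]]
        proof eventually_elim
          case (elim x)
          let ?p = "from_coord P s x"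
          have sq: "(norm (a - b))\<^sup>2 \<le> 2 * (norm a)\<^sup>2 + 2 * (norm b)\<^sup>2" for a b :: "'c::real_inner"
          proof -
            have "(norm (a - b))\<^sup>2 + (norm (a + b))\<^sup>2 = 2 * (norm a)\<^sup>2 + 2 * (norm b)\<^sup>2"
              by (simp add: power2_norm_eq_inner inner_diff_left inner_diff_right inner_add_left inner_add_right inner_commute)
            then show ?thesis using zero_le_power2[of "norm (a + b)"] by linarith
          qed
          have "lip_gradient (w k) x - H x = (lip_gradient (F k) x - ?A x *v G ?p) - (lip_gradient (F' k) x - ?A x *v G' ?p)"
            using elim by (simp add: w_def[abs_def] H_def matrix_vector_mult_diff_distrib)
          then have 1: "(norm (lip_gradient (w k) x - H x))\<^sup>2
              \<le> 2 * (norm (lip_gradient (F k) x - ?A x *v G ?p))\<^sup>2 + 2 * (norm (lip_gradient (F' k) x - ?A x *v G' ?p))\<^sup>2"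
            by (simp only: sq)
          have "w k x = (F k x - f ?p) - (F' k x - f ?p)" by (simp add: w_def)
          then have 2: "(w k x)\<^sup>2 \<le> 2 * (F k x - f ?p)\<^sup>2 + 2 * (F' k x - f ?p)\<^sup>2"
            using sq[of "F k x - f ?p" "F' k x - f ?p"] by simp
          have "(w k x)\<^sup>2 + (norm (lip_gradient (w k) x - H x))\<^sup>2 \<le> 2 * ?q (F k) G x + 2 * ?q (F' k) G' x"
          proof -
            have "a + b \<le> 2 * (c + c') + 2 * (d + d')" if "b \<le> 2 * c' + 2 * d'" "a \<le> 2 * c + 2 * d" for a b c c' d d' :: real
              using that by simp
            from this[OF 1 2] show ?thesis .
          qed
          then have "ennreal ((w k x)\<^sup>2 + (norm (lip_gradient (w k) x - H x))\<^sup>2) \<le> ennreal (2 * ?q (F k) G x + 2 * ?q (F' k) G' x)"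
            by (rule ennreal_leI)
          also have "\<dots> = 2 * ennreal (?q (F k) G x) + 2 * ennreal (?q (F' k) G' x)"
          proof -
            have "ennreal (2 * a + 2 * b) = 2 * ennreal a + 2 * ennreal b" if "0 \<le> a" "0 \<le> b" for a b :: real
              using that by (simp add: ennreal_plus ennreal_mult)
            moreover have "0 \<le> ?q (F k) G x" "0 \<le> ?q (F' k) G' x" by auto
            ultimately show ?thesis by blast
          qed
          finally show ?case by (simp add: indicator_def del: ennreal_plus)
        qed
      qed
      also have "\<dots> = 2 * (\<integral>\<^sup>+x\<in>?O. ennreal (?q (F k) G x) \<partial>lebesgue) + 2 * (\<integral>\<^sup>+x\<in>?O. ennreal (?q (F' k) G' x) \<partial>lebesgue)"
        using F(2)[of k] F'(2)[of k]
        by (subst nn_integral_add) (auto simp: nn_integral_cmult simp del: ennreal_plus intro!: borel_measurable_times_ennreal)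
      finally show ?thesis .
    qed
    have "(\<lambda>k. 2 * (\<integral>\<^sup>+x\<in>?O. ennreal (?q (F k) G x) \<partial>lebesgue) + 2 * (\<integral>\<^sup>+x\<in>?O. ennreal (?q (F' k) G' x) \<partial>lebesgue))
        \<longlonglongrightarrow> 2 * 0 + 2 * (0::ennreal)"
      by (intro tendsto_add ennreal_tendsto_cmult F(3) F'(3)) auto
    then have up: "(\<lambda>k. 2 * (\<integral>\<^sup>+x\<in>?O. ennreal (?q (F k) G x) \<partial>lebesgue) + 2 * (\<integral>\<^sup>+x\<in>?O. ennreal (?q (F' k) G' x) \<partial>lebesgue))
        \<longlonglongrightarrow> 0" by (simp only: mult_zero_right add_0)
    show "(\<lambda>k. \<integral>\<^sup>+x\<in>?O. ennreal ((w k x)\<^sup>2 + (norm (lip_gradient (w k) x - H x))\<^sup>2) \<partial>lebesgue) \<longlonglongrightarrow> 0"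
      by (rule tendsto_sandwich[OF _ _ tendsto_const up]) (rule always_eventually, rule allI, rule zero_le le)+
  qed
  then show "AE x in lebesgue. x \<in> Dm s \<longrightarrow> from_coord P s x \<in> U \<longrightarrow> G (from_coord P s x) = G' (from_coord P s x)"
    using regular_AE[OF s]
  proof eventually_elim
    case (elim x)
    show ?case
    proof (intro impI)
      assume x: "x \<in> Dm s" "from_coord P s x \<in> U"
      have r: "regular s x" using elim x by blast
      let ?d = "G (from_coord P s x) - G' (from_coord P s x)"
      have "?A x *v ?d = 0" using elim(1) regular_piece[OF r x(2)] by (simp add: H_def)
      then have "(norm ?d)\<^sup>2 / \<Lambda>\<^sup>2 \<le> 0" using regular_metric(1)[OF r, of ?d] by simp
      then have "norm ?d = 0" using \<Lambda>(1) by (simp add: divide_le_0_iff)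
      then show "G (from_coord P s x) = G' (from_coord P s x)" by simp
    qed
  qed
qed

lemma sobolev_gradient_on_subset:
  assumes G: "sobolev_gradient_on P U f G" and V: "V \<subseteq> U" "open V"
  shows "sobolev_gradient_on P V f G"
proof -
  have m: "set_borel_measurable (volume P) V h" if "set_borel_measurable (volume P) U h" 
    for h :: "'x \<Rightarrow> 'b::{real_normed_vector, second_countable_topology}"
  proof -
    have "(\<lambda>p. indicator V p *\<^sub>R (indicator U p *\<^sub>R h p)) \<in> borel_measurable (volume P)"
      using that unfolding set_borel_measurable_def
      by (rule borel_measurable_scaleR[OF borel_measurable_indicator[OF open_sets_volume[OF V(2)]]])
    also have "(\<lambda>p. indicator V p *\<^sub>R (indicator U p *\<^sub>R h p)) = (\<lambda>p. indicator V p *\<^sub>R h p)"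
      using V(1) by (auto simp: indicator_def fun_eq_iff)
    finally show ?thesis by (simp add: set_borel_measurable_def)
  qed
  have n: "sobolev_norm_sq P V a b \<le> sobolev_norm_sq P U a b" for a b
    unfolding sobolev_norm_sq_def using V(1) by (intro nn_integral_mono) (auto simp: indicator_def)
  obtain u where u: "\<And>k. lipschitz_fun P U (u k)" "\<And>k. sobolev_norm_sq P U (u k) (gradient P (u k)) < \<infinity>"
    and lim: "(\<lambda>k. sobolev_norm_sq P U (\<lambda>p. u k p - f p) (\<lambda>p. gradient P (u k) p - G p)) \<longlonglongrightarrow> 0"
    using G unfolding sobolev_gradient_on_def by blast
  have "lipschitz_fun P V (u k)" for k using u(1)[of k] V(1) unfolding lipschitz_fun_def by blast
  moreover have "sobolev_norm_sq P V (u k) (gradient P (u k)) < \<infinity>" for k using n u(2) le_less_trans by blast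
  moreover have "(\<lambda>k. sobolev_norm_sq P V (\<lambda>p. u k p - f p) (\<lambda>p. gradient P (u k) p - G p)) \<longlonglongrightarrow> 0"
    using n by (intro tendsto_sandwich[OF _ _ tendsto_const lim]) auto
  moreover have "set_borel_measurable (volume P) V f" "set_borel_measurable (volume P) V G"
    using G by (auto simp: sobolev_gradient_on_def intro: m)
  ultimately show ?thesis
    unfolding sobolev_gradient_on_def by (intro conjI exI[of _ u] allI)
qed

lemma sobolev_gradient_on_cong_AE:
  assumes G: "sobolev_gradient_on P U f G" and ae: "AE p in volume P. p \<in> U \<longrightarrow> G p = G' p"
    and m: "set_borel_measurable (volume P) U G'"
  shows "sobolev_gradient_on P U f G'"
proof -
  have "sobolev_norm_sq P U a (\<lambda>p. b p - G p) = sobolev_norm_sq P U a (\<lambda>p. b p - G' p)" for a b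
    unfolding sobolev_norm_sq_def
    by (rule nn_integral_cong_AE) (use ae in eventually_elim, auto simp: indicator_def)
  then show ?thesis using G m unfolding sobolev_gradient_on_def by simp
qed

text \<open>The open stars of the vertices form a countable cover by relatively compact subdomains,
  on which local gradients exist and from which the global one is assembled.\<close>

definition vstar :: "'v \<Rightarrow> 'x set" where
  "vstar v = {p. v \<in> carr p}"

lemma vstar_open: "open (vstar v)"
  using open_star[of "{v}"] by (simp add: vstar_def)

lemma closed_simplex_compact: "s \<in> Mx \<Longrightarrow> compact {p. carr p \<subseteq> s}"
  unfolding closed_simplex_image by (rule compact_continuous_image[OF continuous_from_coord dom_compact])

lemma finite_maximal_star: "finite {s \<in> Mx. v \<in> s}"
  by (rule finite_subset[OF _ star_finite[of v]]) (auto dest: maximal_in)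

lemma vstar_subset: "vstar v \<subseteq> (\<Union>s\<in>{s \<in> Mx. v \<in> s}. {p. carr p \<subseteq> s})"
proof
  fix p assume p: "p \<in> vstar v"
  obtain s where "s \<in> Mx" "carr p \<subseteq> s" using simplex_subset_maximal[OF carr_in] by metis
  then show "p \<in> (\<Union>s\<in>{s \<in> Mx. v \<in> s}. {p. carr p \<subseteq> s})" using p by (auto simp: vstar_def)
qed

text \<open>Charts and embedding are affine on a simplex, so barycentric coordinates are affine
  along the segment. That of \<open>v\<close> becomes \<open>1 - t\<close> times its old value plus
  \<open>t\<close>, which stays positive.\<close>

lemma bary_segment:
  assumes s: "s \<in> Mx" and x: "x \<in> Dm s" and v: "v \<in> s" and t: "0 \<le> t" "t \<le> 1" and c: "v \<in> carr (from_coord P s x)"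
  shows "v \<in> carr (from_coord P s ((1 - t) *\<^sub>R x + t *\<^sub>R corner s v))"
    and "(1 - t) *\<^sub>R x + t *\<^sub>R corner s v \<in> Dm s"
proof -
  let ?\<delta> = "\<lambda>w. if w = v then 1 else (0::real)"
  let ?p = "from_coord P s x" and ?z = "(1 - t) *\<^sub>R x + t *\<^sub>R corner s v"
  have fin: "finite s" using simplex_finite maximal_in s by blast
  define \<alpha> where "\<alpha> w = (1 - t) * bary P ?p w + t * ?\<delta> w" for w
  have cv: "corner s v \<in> Dm s" using v by (simp add: dom_hull[OF s] hull_inc)
  show z: "?z \<in> Dm s" using convexD[OF dom_convex[OF s] x cv, of "1 - t" t] t by simp
  have cs: "carr ?p \<subseteq> s" by (rule from_coord_dom(2)[OF s x])
  have b0: "bary P ?p w = 0" if "w \<notin> s" for w using that cs by (auto simp: carrier_simplex_bary support_def)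
  have \<alpha>0: "\<alpha> w = 0" if "w \<notin> s" for w using that b0 v by (auto simp: \<alpha>_def)
  then have sup: "support \<alpha> \<subseteq> s" by (auto simp: support_def)
  have nn: "0 \<le> \<alpha> w" for w using t bary_nonneg[of ?p w] by (simp add: \<alpha>_def)
  have "sum (bary P ?p) s = sum (bary P ?p) (support (bary P ?p))"
    using cs by (intro sum.mono_neutral_right fin) (auto simp: carrier_simplex_bary support_def)
  then have sb: "sum (bary P ?p) s = 1" using bary_in[of ?p] by (simp add: realization_def)
  have "sum \<alpha> s = (1 - t) * sum (bary P ?p) s + t * sum ?\<delta> s"
    by (simp add: \<alpha>_def sum.distrib sum_distrib_left)
  then have "sum \<alpha> s = 1" using sb v fin by simp
  then have s1: "sum \<alpha> (support \<alpha>) = 1"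
    using sum.mono_neutral_left[OF fin sup, of \<alpha>] by (auto simp: support_def)
  then have "support \<alpha> \<noteq> {}" by force
  then have \<alpha>R: "\<alpha> \<in> R" using face_in[OF maximal_in[OF s] sup] s1 nn by (simp add: realization_def)
  have "embedding P \<alpha> = (\<Sum>w\<in>s. \<alpha> w *\<^sub>R position P w)" by (rule embedding_superset[OF fin sup])
  also have "\<dots> = (1 - t) *\<^sub>R (\<Sum>w\<in>s. bary P ?p w *\<^sub>R position P w) + t *\<^sub>R (\<Sum>w\<in>s. ?\<delta> w *\<^sub>R position P w)"
    by (simp add: \<alpha>_def scaleR_add_left sum.distrib scaleR_sum_right)
  also have "(\<Sum>w\<in>s. bary P ?p w *\<^sub>R position P w) = emb P ?p"
    unfolding emb_def using cs by (intro embedding_superset[symmetric] fin) (simp add: carrier_simplex_bary)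
  also have "(\<Sum>w\<in>s. ?\<delta> w *\<^sub>R position P w) = position P v"
    using v fin by (simp add: if_distrib[of "\<lambda>a. a *\<^sub>R _"] cong: if_cong)
  also have "(1 - t) *\<^sub>R emb P ?p + t *\<^sub>R position P v = chart P s ?z"
    by (simp add: chart_affine_comb[OF s] from_coord_dom(1)[OF s x] chart_corner[OF s v])
  finally have "embedding P \<alpha> = emb P (from_coord P s ?z)" by (simp add: from_coord_dom(1)[OF s z])
  then have "\<alpha> = bary P (from_coord P s ?z)" unfolding emb_def by (rule embedding_eqD[OF _ \<alpha>R bary_in])
  moreover have "\<alpha> v > 0"
  proof (cases "t = 0")
    case True then show ?thesis using c by (simp add: \<alpha>_def bary_pos_iff)
  next
    case False then show ?thesis using t bary_nonneg[of ?p v] by (simp add: \<alpha>_def add_nonneg_pos)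
  qed
  ultimately show "v \<in> carr (from_coord P s ?z)" by (simp add: bary_pos_iff)
qed

text \<open>The star is star-shaped about its vertex: every point is joined to it by a segment
  inside one maximal simplex.\<close>

lemma vstar_connected: "connected (vstar v)"
proof -
  let ?c = "unemb (position P v)"
  let ?T = "\<lambda>s p. (\<lambda>t. from_coord P s ((1 - t) *\<^sub>R to_coord P s p + t *\<^sub>R corner s v)) ` {0..1::real}"
  have ex: "\<exists>T. connected T \<and> T \<subseteq> vstar v \<and> p \<in> T \<and> ?c \<in> T" if p: "p \<in> vstar v" for p
  proof -
    obtain s where s: "s \<in> Mx" "carr p \<subseteq> s" using simplex_subset_maximal[OF carr_in] by metis
    have v: "v \<in> s" "v \<in> carr p" using p s(2) by (auto simp: vstar_def)
    let ?x = "to_coord P s p"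
    have x: "?x \<in> Dm s" "from_coord P s ?x = p" using to_coord_carr[OF s] by auto
    note seg = bary_segment[OF s(1) x(1) v(1), unfolded x(2), OF _ _ v(2)]
    have "continuous_on {0..1} (\<lambda>t. from_coord P s ((1 - t) *\<^sub>R ?x + t *\<^sub>R corner s v))"
      by (rule continuous_on_compose2[OF continuous_from_coord[OF s(1)]]) (use seg(2) in \<open>auto intro!: continuous_intros\<close>)
    then have "connected (?T s p)" by (rule connected_continuous_image) simp
    moreover have "?T s p \<subseteq> vstar v" using seg(1) by (auto simp: vstar_def)
    moreover have "p \<in> ?T s p" by (rule image_eqI[of _ _ 0]) (use x(2) in auto)
    moreover have "?c \<in> ?T s p"
      by (rule image_eqI[of _ _ 1]) (auto simp: from_coord_unemb chart_corner[OF s(1) v(1)])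
    ultimately show ?thesis by blast
  qed
  \<comment> \<open>If \<open>v\<close> is not a vertex of the complex, its star is empty and
    \<open>?c\<close> has no meaning. Then this family is empty, and so is its union.\<close>
  define \<T> where "\<T> = {T. connected T \<and> T \<subseteq> vstar v \<and> ?c \<in> T}"
  have "vstar v = \<Union>\<T>"
  proof
    show "vstar v \<subseteq> \<Union>\<T>"
    proof
      fix p assume "p \<in> vstar v"
      from ex[OF this] obtain T where "T \<in> \<T>" "p \<in> T" unfolding \<T>_def by blast
      then show "p \<in> \<Union>\<T>" by (rule UnionI)
    qed
  qed (auto simp: \<T>_def)
  moreover have "connected (\<Union>\<T>)"
  proof (rule connected_Union)
    have "?c \<in> \<Inter>\<T>" by (simp add: \<T>_def)
    then show "\<Inter>\<T> \<noteq> {}" by (metis empty_iff)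
  qed (simp add: \<T>_def)
  ultimately show ?thesis by simp
qed

lemma vstar_subdomain: "relatively_compact_subdomain (vstar v)"
proof -
  have c: "compact (\<Union>s\<in>{s \<in> Mx. v \<in> s}. {p. carr p \<subseteq> s})"
    using finite_maximal_star closed_simplex_compact by (intro compact_UN) auto
  have "closure (vstar v) \<subseteq> (\<Union>s\<in>{s \<in> Mx. v \<in> s}. {p. carr p \<subseteq> s})"
    by (rule closure_minimal[OF vstar_subset compact_imp_closed[OF c]])
  then have "compact (closure (vstar v))"
    using compact_Int_closed[OF c closed_closure[of "vstar v"]] by (simp only: Int_absorb1)
  then show ?thesis using vstar_open vstar_connected by (simp add: relatively_compact_subdomain_def)
qed

lemma vertices_enumeration:
  obtains e :: "nat \<Rightarrow> 'v" where "\<And>p. \<exists>n. p \<in> vstar (e n)"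
proof -
  have "countable (\<Union>s\<in>K. s)" by (rule countable_UN[OF countable_K]) (simp add: simplex_finite countable_finite)
  then have "countable (\<Union>K)" by simp
  moreover obtain p :: 'x where True by simp
  then have "\<Union>K \<noteq> {}" using carr_in[of p] simplex_nonempty[OF carr_in[of p]] by blast
  ultimately have r: "range (from_nat_into (\<Union>K)) = \<Union>K" by (rule range_from_nat_into[rotated])
  have "\<exists>n. p \<in> vstar (from_nat_into (\<Union>K) n)" for p
  proof -
    obtain v where v: "v \<in> carr p" using simplex_nonempty[OF carr_in[of p]] by blast
    then have "v \<in> range (from_nat_into (\<Union>K))" unfolding r using carr_in[of p] by blast
    then show ?thesis using v by (auto simp: vstar_def)
  qed
  then show ?thesis by (rule that)
qed

text \<open>Intended for \<open>sobolev_gradient\<close>, whose measurability is at first known on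
  relatively compact subdomains only.\<close>

lemma measurable_if_on_vstars:
  fixes G :: "'x \<Rightarrow> 'b::real_normed_vector"
  assumes "\<And>v. set_borel_measurable (volume P) (vstar v) G"
  shows "G \<in> borel_measurable (volume P)"
proof -
  obtain e :: "nat \<Rightarrow> 'v" where e: "\<And>p. \<exists>n. p \<in> vstar (e n)" by (rule vertices_enumeration) blast
  define idx where "idx p = (LEAST n. p \<in> vstar (e n))" for p
  have i: "p \<in> vstar (e (idx p))" for p unfolding idx_def using e[of p] by (rule LeastI_ex)
  have idxm: "idx \<in> measurable (volume P) (count_space UNIV)"
    unfolding idx_def by (rule measurable_Least) (simp add: pred_def open_sets_volume[OF vstar_open])
  have "(\<lambda>p. indicator (vstar (e n)) p *\<^sub>R G p) \<in> borel_measurable (volume P)" for n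
    using assms unfolding set_borel_measurable_def .
  then have "(\<lambda>p. indicator (vstar (e (idx p))) p *\<^sub>R G p) \<in> borel_measurable (volume P)"
    by (rule measurable_compose_countable[where f="\<lambda>n p. indicator (vstar (e n)) p *\<^sub>R G p", OF _ idxm])
  then show ?thesis using i by simp
qed

text \<open>At each point the gradient chosen for the first star containing it is taken. Uniqueness
  makes it agree almost everywhere with the gradient chosen for any other subdomain, and countably
  many stars add up to one null set.\<close>

theorem ex_global_gradient:
  assumes f: "f \<in> W12_loc P"
  obtains G where "\<And>U. relatively_compact_subdomain U \<Longrightarrow> sobolev_gradient_on P U f G"
proof -
  have "\<forall>U. \<exists>G. relatively_compact_subdomain U \<longrightarrow> sobolev_gradient_on P U f G"
    using f by (auto simp: W12_loc_def W12_def)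
  then obtain g where g: "\<And>U. relatively_compact_subdomain U \<Longrightarrow> sobolev_gradient_on P U f (g U)" by metis
  obtain e :: "nat \<Rightarrow> 'v" where e: "\<And>p. \<exists>n. p \<in> vstar (e n)" by (rule vertices_enumeration) blast
  define idx where "idx p = (LEAST n. p \<in> vstar (e n))" for p
  have i: "p \<in> vstar (e (idx p))" for p unfolding idx_def using e[of p] by (rule LeastI_ex)
  define G where "G p = g (vstar (e (idx p))) p" for p
  have idxm: "idx \<in> measurable (volume P) (count_space UNIV)"
    unfolding idx_def by (rule measurable_Least) (simp add: pred_def open_sets_volume[OF vstar_open])
  have gm: "set_borel_measurable (volume P) (vstar v) (g (vstar v))" for v
    using g[OF vstar_subdomain] by (simp add: sobolev_gradient_on_def)
  have "(\<lambda>p. indicator (vstar (e n)) p *\<^sub>R g (vstar (e n)) p) \<in> borel_measurable (volume P)" for n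
    using gm unfolding set_borel_measurable_def .
  then have "(\<lambda>p. indicator (vstar (e (idx p))) p *\<^sub>R g (vstar (e (idx p))) p) \<in> borel_measurable (volume P)"
    by (rule measurable_compose_countable[where f="\<lambda>n p. indicator (vstar (e n)) p *\<^sub>R g (vstar (e n)) p", OF _ idxm])
  then have Gm: "G \<in> borel_measurable (volume P)" using i by (simp add: G_def[abs_def])
  have "sobolev_gradient_on P U f G" if U: "relatively_compact_subdomain U" for U
  proof (rule sobolev_gradient_on_cong_AE[OF g[OF U]])
    have Uo: "open U" using U by (simp add: relatively_compact_subdomain_def)
    show "set_borel_measurable (volume P) U G"
      unfolding set_borel_measurable_def
      by (intro borel_measurable_scaleR borel_measurable_indicator Gm open_sets_volume Uo)
    \<comment> \<open>The intersection may be disconnected; uniqueness of the gradient holds on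
      every open set.\<close>
    have "AE p in volume P. p \<in> U \<inter> vstar (e n) \<longrightarrow> g U p = g (vstar (e n)) p" for n
      by (rule sobolev_gradient_unique[of _ f])
        (auto intro!: open_Int Uo vstar_open sobolev_gradient_on_subset[OF g[OF U]] sobolev_gradient_on_subset[OF g[OF vstar_subdomain]])
    then have "AE p in volume P. \<forall>n. p \<in> U \<inter> vstar (e n) \<longrightarrow> g U p = g (vstar (e n)) p" by (simp add: AE_all_countable)
    then show "AE p in volume P. p \<in> U \<longrightarrow> g U p = G p"
      by eventually_elim (use i in \<open>auto simp: G_def\<close>)
  qed
  then show ?thesis by (rule that)
qed

end

section \<open>Subharmonic functions with integrable gradient\<close>

context riem_polyhedron
begin

lemma compact_finite_simplexes:
  assumes C: "compact C"
  obtains T where "finite T" "T \<subseteq> Mx" "C \<subseteq> (\<Union>s\<in>T. {p. carr p \<subseteq> s})"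
proof -
  have cov: "C \<subseteq> (\<Union>v\<in>UNIV. vstar v)"
  proof
    fix p
    obtain v where "v \<in> carr p" using simplex_nonempty[OF carr_in[of p]] by blast
    then show "p \<in> (\<Union>v\<in>UNIV. vstar v)" by (auto simp: vstar_def)
  qed
  obtain V where V: "finite V" "C \<subseteq> (\<Union>v\<in>V. vstar v)"
    by (rule compactE_image[OF C _ cov]) (use vstar_open in auto)
  show ?thesis
  proof (rule that)
    show "finite (\<Union>v\<in>V. {s \<in> Mx. v \<in> s})" using V(1) finite_maximal_star by blast
    show "C \<subseteq> (\<Union>s\<in>(\<Union>v\<in>V. {s \<in> Mx. v \<in> s}). {p. carr p \<subseteq> s})"
    proof
      fix p assume "p \<in> C"
      then obtain v where v: "v \<in> V" "p \<in> vstar v" using V(2) by (meson UN_E subsetD)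
      then obtain s where "s \<in> Mx" "v \<in> s" "carr p \<subseteq> s" using subsetD[OF vstar_subset v(2)] by (elim UN_E CollectE conjE)
      then show "p \<in> (\<Union>s\<in>(\<Union>v\<in>V. {s \<in> Mx. v \<in> s}). {p. carr p \<subseteq> s})" using v(1) by auto
    qed
  qed blast
qed

lemma chart_extension_UNIV:
  assumes s: "s \<in> Mx" and u: "\<And>p q. \<bar>u p - u q\<bar> \<le> C * intrinsic_dist P p q" and C: "C \<ge> 0"
  obtains F where "(2 * \<Lambda> * C)-lipschitz_on UNIV F" "\<And>x. x \<in> Dm s \<Longrightarrow> F x = u (from_coord P s x)"
proof (rule chart_extension[where U=UNIV, OF s u C])
  fix F assume "(2 * \<Lambda> * C)-lipschitz_on UNIV F" "\<And>x. x \<in> Dm s \<Longrightarrow> from_coord P s x \<in> UNIV \<Longrightarrow> F x = u (from_coord P s x)"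
  then show thesis by (intro that[of F]) simp_all
qed

text \<open>The function is Lipschitz for the intrinsic distance, while compactness refers to the
  topology of the given metric. The passage goes through charts: finitely many closed simplexes
  cover the compact set, and on each the function is continuous in coordinates.\<close>

lemma lipschitz_bounded_on_compact:
  assumes \<rho>: "lipschitz_fun P UNIV \<rho>" and K': "compact K'"
  shows "bounded (\<rho> ` K')"
proof -
  obtain C where C: "C \<ge> 0" and "\<And>p q. p \<in> UNIV \<Longrightarrow> q \<in> UNIV \<Longrightarrow> \<bar>\<rho> p - \<rho> q\<bar> \<le> C * intrinsic_dist P p q"
    by (rule lipschitz_fun_obtain[OF \<rho>]) blast
  then have \<rho>C: "\<bar>\<rho> p - \<rho> q\<bar> \<le> C * intrinsic_dist P p q" for p q by simp
  obtain T where T: "finite T" "T \<subseteq> Mx" "K' \<subseteq> (\<Union>s\<in>T. {p. carr p \<subseteq> s})"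
    by (rule compact_finite_simplexes[OF K']) blast
  have "bounded (\<rho> ` {p. carr p \<subseteq> s})" if s: "s \<in> Mx" for s
  proof -
    obtain F where F: "(2 * \<Lambda> * C)-lipschitz_on UNIV F"
        "\<And>x. x \<in> Dm s \<Longrightarrow> F x = \<rho> (from_coord P s x)"
      by (rule chart_extension_UNIV[OF s \<rho>C C]) blast
    have "\<rho> ` {p. carr p \<subseteq> s} = F ` Dm s"
      unfolding closed_simplex_image[OF s] using F(2) by (simp add: image_image)
    moreover have "compact (F ` Dm s)"
      by (intro compact_continuous_image dom_compact[OF s] continuous_on_subset[OF lipschitz_on_continuous_on[OF F(1)]]) simp
    ultimately show ?thesis by (simp add: compact_imp_bounded)
  qed
  then have "bounded (\<Union>s\<in>T. \<rho> ` {p. carr p \<subseteq> s})" using T(1,2) by (intro bounded_UN) auto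
  then show ?thesis by (rule bounded_subset) (use T(3) in blast)
qed

section \<open>Pairing a vector field with gradients of Lipschitz functions\<close>

lemma lipschitz_chart_derivative:
  assumes s: "s \<in> Mx" and u: "\<And>p q. \<bar>u p - u q\<bar> \<le> C * intrinsic_dist P p q" and C: "C \<ge> 0"
  obtains F where "(2 * \<Lambda> * C)-lipschitz_on UNIV F"
    "AE x in lebesgue. x \<in> Dm s \<longrightarrow> regular s x \<and> norm (lip_gradient F x) \<le> 2 * \<Lambda> * C \<and>
       ((\<lambda>x. u (from_coord P s x)) has_derivative (\<lambda>v. v \<bullet> lip_gradient F x)) (at x)"
proof -
  obtain F where F: "(2 * \<Lambda> * C)-lipschitz_on UNIV F"
      "\<And>x. x \<in> Dm s \<Longrightarrow> F x = u (from_coord P s x)"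
    by (rule chart_extension_UNIV[OF s u C]) blast
  have ed: "AE x in lebesgue. x \<in> piece s UNIV \<longrightarrow> ((\<lambda>x. u (from_coord P s x)) has_derivative (\<lambda>v. v \<bullet> lip_gradient F x)) (at x)"
    by (rule extension_derivative[OF s open_UNIV F(1)]) (rule F(2))
  have "AE x in lebesgue. x \<in> Dm s \<longrightarrow> regular s x \<and> norm (lip_gradient F x) \<le> 2 * \<Lambda> * C \<and>
       ((\<lambda>x. u (from_coord P s x)) has_derivative (\<lambda>v. v \<bullet> lip_gradient F x)) (at x)"
    using ed regular_AE[OF s] AE_completion[OF lipschitz_AE_norm_gradient_le[OF F(1)]]
    by eventually_elim (auto intro: regular_piece)
  with F(1) show ?thesis by (rule that)
qed

text \<open>The Euclidean gradient in coordinates is at most \<open>2 * \<Lambda> * C\<close> by the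
  extension to the chart; a further factor \<Lambda> compares the Euclidean norm of \<open>G\<close>
  with its norm in the metric.\<close>

lemma pairing_bound:
  assumes u: "\<And>p q. \<bar>u p - u q\<bar> \<le> C * intrinsic_dist P p q" and C: "C \<ge> 0"
  shows "AE p in volume P. \<bar>g_inner P p (G p) (gradient P u p)\<bar> \<le> 2 * \<Lambda>\<^sup>2 * C * g_norm P p (G p)"
  unfolding AE_volume_iff
proof
  fix s assume s: "s \<in> Mx"
  obtain F where F: "(2 * \<Lambda> * C)-lipschitz_on UNIV F"
    "AE x in lebesgue. x \<in> Dm s \<longrightarrow> regular s x \<and> norm (lip_gradient F x) \<le> 2 * \<Lambda> * C \<and>
       ((\<lambda>x. u (from_coord P s x)) has_derivative (\<lambda>v. v \<bullet> lip_gradient F x)) (at x)"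
    by (rule lipschitz_chart_derivative[OF s u C]) blast
  from F(2) show "AE x in lebesgue. x \<in> Dm s \<longrightarrow>
     \<bar>g_inner P (from_coord P s x) (G (from_coord P s x)) (gradient P u (from_coord P s x))\<bar>
       \<le> 2 * \<Lambda>\<^sup>2 * C * g_norm P (from_coord P s x) (G (from_coord P s x))"
  proof eventually_elim
    case (elim x)
    show ?case
    proof
      assume "x \<in> Dm s"
      then have r: "regular s x" and n: "norm (lip_gradient F x) \<le> 2 * \<Lambda> * C"
        and d: "((\<lambda>x. u (from_coord P s x)) has_derivative (\<lambda>v. v \<bullet> lip_gradient F x)) (at x)" using elim by auto
      let ?p = "from_coord P s x"
      have "\<bar>g_inner P ?p (G ?p) (gradient P u ?p)\<bar> \<le> norm (G ?p) * norm (lip_gradient F x)"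
        unfolding gradient_from_coord(2)[OF r d] by (rule Cauchy_Schwarz_ineq2)
      also have "\<dots> \<le> (\<Lambda> * g_norm P ?p (G ?p)) * (2 * \<Lambda> * C)"
        using g_norm_bounds(1)[OF r, of "G ?p"] n by (intro mult_mono) (auto intro: order_trans[OF norm_ge_zero])
      finally show "\<bar>g_inner P ?p (G ?p) (gradient P u ?p)\<bar> \<le> 2 * \<Lambda>\<^sup>2 * C * g_norm P ?p (G ?p)"
        by (simp add: power2_eq_square algebra_simps)
    qed
  qed
qed

lemma pairing_measurable:
  assumes u: "\<And>p q. \<bar>u p - u q\<bar> \<le> C * intrinsic_dist P p q" and C: "C \<ge> 0" and G: "G \<in> borel_measurable (volume P)"
  shows "(\<lambda>p. g_inner P p (G p) (gradient P u p)) \<in> borel_measurable (volume P)"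
  unfolding measurable_volume_iff
proof
  fix s assume s: "s \<in> Mx"
  obtain F where F: "(2 * \<Lambda> * C)-lipschitz_on UNIV F"
    "AE x in lebesgue. x \<in> Dm s \<longrightarrow> regular s x \<and> norm (lip_gradient F x) \<le> 2 * \<Lambda> * C \<and>
       ((\<lambda>x. u (from_coord P s x)) has_derivative (\<lambda>v. v \<bullet> lip_gradient F x)) (at x)"
    by (rule lipschitz_chart_derivative[OF s u C]) blast
  have Gs: "(\<lambda>x. G (from_coord P s x)) \<in> borel_measurable (lebesgue_on (Dm s))" using G s by (simp add: measurable_volume_iff)
  show "(\<lambda>x. g_inner P (from_coord P s x) (G (from_coord P s x)) (gradient P u (from_coord P s x))) \<in> borel_measurable (lebesgue_on (Dm s))"
  proof (rule measurable_dom_AE[OF s borel_measurable_inner[OF Gs lipschitz_measurable_dom(2)[OF F(1)]]])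
    from F(2) show "AE x in lebesgue. x \<in> Dm s \<longrightarrow> G (from_coord P s x) \<bullet> lip_gradient F x
       = g_inner P (from_coord P s x) (G (from_coord P s x)) (gradient P u (from_coord P s x))"
      by eventually_elim (use gradient_from_coord(2) in metis)
  qed
qed

lemma g_norm_measurable:
  assumes G: "G \<in> borel_measurable (volume P)"
  shows "(\<lambda>p. g_norm P p (G p)) \<in> borel_measurable (volume P)"
  unfolding measurable_volume_iff
proof
  fix s assume s: "s \<in> Mx"
  have Gs: "(\<lambda>x. G (from_coord P s x)) \<in> borel_measurable (lebesgue_on (Dm s))" using G s by (simp add: measurable_volume_iff)
  have m: "(\<lambda>x. sqrt (G (from_coord P s x) \<bullet> (metric_coeff P s x *v G (from_coord P s x)))) \<in> borel_measurable (lebesgue_on (Dm s))"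
    using borel_measurable_inner[OF Gs metric_vector_measurable[OF s Gs]] by measurable
  show "(\<lambda>x. g_norm P (from_coord P s x) (G (from_coord P s x))) \<in> borel_measurable (lebesgue_on (Dm s))"
    by (rule measurable_dom_AE[OF s m])
       (use regular_AE[OF s] in eventually_elim, auto simp: g_norm_def g_inner_def metric_at_from_coord)
qed

text \<open>This is where the finite L1 norm enters. Integrability has to be established before any
  linearity is used, since the integral of a function that is not integrable is 0 by
  default.\<close>

lemma pairing_integrable:
  assumes u: "\<And>p q. \<bar>u p - u q\<bar> \<le> C * intrinsic_dist P p q" and C: "C \<ge> 0" and G: "G \<in> borel_measurable (volume P)"
    and fin: "(\<integral>\<^sup>+p. ennreal (g_norm P p (G p)) \<partial>volume P) < \<infinity>"
  shows "integrable (volume P) (\<lambda>p. g_inner P p (G p) (gradient P u p))"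
    and "\<bar>\<integral>p. g_inner P p (G p) (gradient P u p) \<partial>volume P\<bar>
      \<le> 2 * \<Lambda>\<^sup>2 * C * enn2real (\<integral>\<^sup>+p. ennreal (g_norm P p (G p)) \<partial>volume P)"
proof -
  let ?B = "\<lambda>p. g_inner P p (G p) (gradient P u p)"
  let ?I = "\<integral>\<^sup>+p. ennreal (g_norm P p (G p)) \<partial>volume P"
  have c: "2 * \<Lambda>\<^sup>2 * C \<ge> 0" using C by simp
  have "(\<integral>\<^sup>+p. ennreal \<bar>?B p\<bar> \<partial>volume P) \<le> (\<integral>\<^sup>+p. ennreal (2 * \<Lambda>\<^sup>2 * C) * ennreal (g_norm P p (G p)) \<partial>volume P)"
  proof (rule nn_integral_mono_AE)
    from pairing_bound[OF u C, of G]
    show "AE p in volume P. ennreal \<bar>?B p\<bar> \<le> ennreal (2 * \<Lambda>\<^sup>2 * C) * ennreal (g_norm P p (G p))"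
      by eventually_elim (use c in \<open>simp add: ennreal_mult'[symmetric] ennreal_leI\<close>)
  qed
  also have "\<dots> = ennreal (2 * \<Lambda>\<^sup>2 * C) * ?I"
    using g_norm_measurable[OF G] by (intro nn_integral_cmult) measurable
  also have "\<dots> = ennreal (2 * \<Lambda>\<^sup>2 * C * enn2real ?I)"
    using fin c by (simp add: ennreal_mult)
  finally have b: "(\<integral>\<^sup>+p. ennreal \<bar>?B p\<bar> \<partial>volume P) \<le> ennreal (2 * \<Lambda>\<^sup>2 * C * enn2real ?I)" .
  show i: "integrable (volume P) ?B"
  proof (rule integrableI_bounded[OF pairing_measurable[OF u C G]])
    have "(\<integral>\<^sup>+p. ennreal \<bar>?B p\<bar> \<partial>volume P) < \<infinity>" using b by (rule le_less_trans) simp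
    then show "(\<integral>\<^sup>+p. ennreal (norm (?B p)) \<partial>volume P) < \<infinity>" by simp
  qed
  have "ennreal (\<integral>p. \<bar>?B p\<bar> \<partial>volume P) = (\<integral>\<^sup>+p. ennreal \<bar>?B p\<bar> \<partial>volume P)"
    using i by (intro nn_integral_eq_integral[symmetric] integrable_abs) auto
  with b have "ennreal (\<integral>p. \<bar>?B p\<bar> \<partial>volume P) \<le> ennreal (2 * \<Lambda>\<^sup>2 * C * enn2real ?I)" by simp
  then have "(\<integral>p. \<bar>?B p\<bar> \<partial>volume P) \<le> 2 * \<Lambda>\<^sup>2 * C * enn2real ?I"
    by (subst (asm) ennreal_le_iff) (use c in auto)
  then show "\<bar>\<integral>p. ?B p \<partial>volume P\<bar> \<le> 2 * \<Lambda>\<^sup>2 * C * enn2real ?I"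
    using integral_abs_bound[of "volume P" ?B] by linarith
qed

text \<open>Where \<open>u\<close> or \<open>v\<close> fails to be differentiable,
  \<open>gradient\<close> is 0 by default although the combination may have a derivative. Linearity
  therefore holds off a null set, by Rademacher's theorem in each chart.\<close>

lemma pairing_linear:
  assumes u: "\<And>p q. \<bar>u p - u q\<bar> \<le> C * intrinsic_dist P p q" and C: "C \<ge> 0"
    and v: "\<And>p q. \<bar>v p - v q\<bar> \<le> C' * intrinsic_dist P p q" and C': "C' \<ge> 0"
  shows "AE p in volume P. g_inner P p (G p) (gradient P (\<lambda>p. a * u p + b * v p) p)
      = a * g_inner P p (G p) (gradient P u p) + b * g_inner P p (G p) (gradient P v p)"
  unfolding AE_volume_iff
proof
  fix s assume s: "s \<in> Mx"
  obtain F where F: "(2 * \<Lambda> * C)-lipschitz_on UNIV F"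
    "AE x in lebesgue. x \<in> Dm s \<longrightarrow> regular s x \<and> norm (lip_gradient F x) \<le> 2 * \<Lambda> * C \<and>
       ((\<lambda>x. u (from_coord P s x)) has_derivative (\<lambda>v. v \<bullet> lip_gradient F x)) (at x)"
    by (rule lipschitz_chart_derivative[OF s u C]) blast
  obtain F' where F': "(2 * \<Lambda> * C')-lipschitz_on UNIV F'"
    "AE x in lebesgue. x \<in> Dm s \<longrightarrow> regular s x \<and> norm (lip_gradient F' x) \<le> 2 * \<Lambda> * C' \<and>
       ((\<lambda>x. v (from_coord P s x)) has_derivative (\<lambda>v. v \<bullet> lip_gradient F' x)) (at x)"
    by (rule lipschitz_chart_derivative[OF s v C']) blast
  from F(2) F'(2) show "AE x in lebesgue. x \<in> Dm s \<longrightarrow>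
      g_inner P (from_coord P s x) (G (from_coord P s x)) (gradient P (\<lambda>p. a * u p + b * v p) (from_coord P s x))
      = a * g_inner P (from_coord P s x) (G (from_coord P s x)) (gradient P u (from_coord P s x))
        + b * g_inner P (from_coord P s x) (G (from_coord P s x)) (gradient P v (from_coord P s x))"
  proof eventually_elim
    case (elim x)
    show ?case
    proof
      assume x: "x \<in> Dm s"
      have r: "regular s x" and d: "((\<lambda>x. u (from_coord P s x)) has_derivative (\<lambda>v. v \<bullet> lip_gradient F x)) (at x)"
        and d': "((\<lambda>x. v (from_coord P s x)) has_derivative (\<lambda>v. v \<bullet> lip_gradient F' x)) (at x)"
        using elim x by auto
      have "((\<lambda>x. a * u (from_coord P s x) + b * v (from_coord P s x)) has_derivative
          (\<lambda>h. a * (h \<bullet> lip_gradient F x) + b * (h \<bullet> lip_gradient F' x))) (at x)"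
        by (intro has_derivative_add has_derivative_mult_right d d')
      then have dd: "((\<lambda>x. (\<lambda>p. a * u p + b * v p) (from_coord P s x)) has_derivative
          (\<lambda>h. h \<bullet> (a *\<^sub>R lip_gradient F x + b *\<^sub>R lip_gradient F' x))) (at x)"
        by (simp add: inner_add_right)
      show "g_inner P (from_coord P s x) (G (from_coord P s x)) (gradient P (\<lambda>p. a * u p + b * v p) (from_coord P s x))
      = a * g_inner P (from_coord P s x) (G (from_coord P s x)) (gradient P u (from_coord P s x))
        + b * g_inner P (from_coord P s x) (G (from_coord P s x)) (gradient P v (from_coord P s x))"
        unfolding gradient_from_coord(2)[OF r d] gradient_from_coord(2)[OF r d'] gradient_from_coord(2)[OF r dd]
        by (simp add: inner_add_right)
    qed
  qed
qed

text \<open>The truncation makes it 1 up to embedded distance \<open>r\<close> from the centre and 0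
  from distance \<open>2 * r\<close> on, with slope \<open>1 / r\<close> in between.\<close>

definition cutoff :: "'x \<Rightarrow> real \<Rightarrow> 'x \<Rightarrow> real" where
  "cutoff o' r p = max 0 (min 1 (2 - dist (emb P p) (emb P o') / r))"

lemma cutoff_lipschitz:
  assumes r: "r > 0"
  shows "\<bar>cutoff o' r p - cutoff o' r q\<bar> \<le> \<Lambda> / r * intrinsic_dist P p q"
proof -
  have "\<bar>dist (emb P p) (emb P o') / r - dist (emb P q) (emb P o') / r\<bar> = \<bar>dist (emb P p) (emb P o') - dist (emb P q) (emb P o')\<bar> / r"
    using r by (simp add: diff_divide_distrib[symmetric])
  also have "\<dots> \<le> dist (emb P p) (emb P q) / r"
    using r dist_triangle[of "emb P p" "emb P o'" "emb P q"] dist_triangle[of "emb P q" "emb P o'" "emb P p"]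
    by (intro divide_right_mono) (auto simp: dist_commute abs_le_iff)
  also have "\<dots> \<le> (\<Lambda> * intrinsic_dist P p q) / r"
    using r by (intro divide_right_mono intrinsic_dist_lower) auto
  finally show ?thesis unfolding cutoff_def by (auto simp: max_def min_def abs_if split: if_splits)
qed

text \<open>A closed subset of a Euclidean ball is compact and is carried back by the continuous
  inverse \<open>unemb\<close>.\<close>

lemma emb_ball_compact: "compact {p. dist (emb P p) e \<le> r}"
proof -
  have "compact (range (emb P) \<inter> cball e r)"
    using closed_range_emb by (simp add: closed_Int_compact)
  then have "compact (unemb ` (range (emb P) \<inter> cball e r))"
    by (rule compact_continuous_image[OF continuous_on_subset[OF continuous_unemb], rotated]) simp
  also have "unemb ` (range (emb P) \<inter> cball e r) = {p. dist (emb P p) e \<le> r}"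
    by (force simp: image_iff dist_commute)
  finally show ?thesis .
qed

lemma cutoff_support: assumes r: "r > 0" shows "cutoff o' r p \<noteq> 0 \<Longrightarrow> p \<in> {p. dist (emb P p) (emb P o') \<le> 2 * r}"
proof -
  assume "cutoff o' r p \<noteq> 0"
  then have "dist (emb P p) (emb P o') / r < 2" by (auto simp: cutoff_def max_def min_def split: if_splits)
  then show ?thesis using r by (simp add: pos_divide_less_eq)
qed

theorem subharmonic_integrable_gradient_imp_harmonic:
  assumes f: "f \<in> W12_loc P" and sub: "weakly_subharmonic P f" and L1: "grad_L1_norm P f < \<infinity>"
  shows "weakly_harmonic P f"
proof -
  define G where "G = sobolev_gradient P f"
  obtain G0 where "\<And>U. relatively_compact_subdomain U \<Longrightarrow> sobolev_gradient_on P U f G0"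
    by (rule ex_global_gradient[OF f]) blast
  \<comment> \<open>The choice that defines \<open>sobolev_gradient\<close> is thereby known to
    succeed, so the chosen field has the property asked for and is measurable.\<close>
  then have "\<exists>G. \<forall>U. relatively_compact_subdomain U \<longrightarrow> sobolev_gradient_on P U f G" by blast
  then have "\<forall>U. relatively_compact_subdomain U \<longrightarrow> sobolev_gradient_on P U f G"
    unfolding G_def sobolev_gradient_def by (rule someI_ex)
  then have Gm: "G \<in> borel_measurable (volume P)"
    using vstar_subdomain by (intro measurable_if_on_vstars) (auto simp: sobolev_gradient_on_def)
  have fin: "(\<integral>\<^sup>+p. ennreal (g_norm P p (G p)) \<partial>volume P) < \<infinity>"
    using L1 by (simp add: grad_L1_norm_def G_def)
  define I where "I = enn2real (\<integral>\<^sup>+p. ennreal (g_norm P p (G p)) \<partial>volume P)"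
  define E where "E u = (\<integral>p. g_inner P p (G p) (gradient P u p) \<partial>volume P)" for u
  have nonpos: "E \<rho> \<le> 0" if \<rho>: "\<rho> \<in> lipschitz_compact P" for \<rho>
  proof -
    have \<rho>l: "lipschitz_fun P UNIV \<rho>" and \<rho>c: "compact (closure {p. \<rho> p \<noteq> 0})"
      using \<rho> by (auto simp: lipschitz_compact_def)
    let ?S = "closure {p. \<rho> p \<noteq> 0}"
    obtain C where C: "C \<ge> 0" and "\<And>p q. p \<in> UNIV \<Longrightarrow> q \<in> UNIV \<Longrightarrow> \<bar>\<rho> p - \<rho> q\<bar> \<le> C * intrinsic_dist P p q"
      by (rule lipschitz_fun_obtain[OF \<rho>l]) blast
    then have \<rho>C: "\<bar>\<rho> p - \<rho> q\<bar> \<le> C * intrinsic_dist P p q" for p q by simp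
    obtain M0 where M0: "\<And>p. p \<in> ?S \<Longrightarrow> \<bar>\<rho> p\<bar> \<le> M0"
      using lipschitz_bounded_on_compact[OF \<rho>l \<rho>c] unfolding bounded_iff by auto
    define M where "M = max M0 0"
    have M: "M \<ge> 0" "\<And>p. p \<in> ?S \<Longrightarrow> \<bar>\<rho> p\<bar> \<le> M" using M0 unfolding M_def by (auto intro: max.coboundedI1)
    obtain o' :: 'x where True by simp
    have "bounded (emb P ` ?S)"
      by (intro compact_imp_bounded compact_continuous_image continuous_emb \<rho>c)
    \<comment> \<open>For \<open>r\<close> at least \<open>r0\<close> the cutoff is 1 on the support
      of \<rho>, so the sum of \<open>M\<close> times the cutoff and \<rho> is nonnegative there;
      off the support \<rho> vanishes.\<close>
    then obtain r0 where r0: "\<And>p. p \<in> ?S \<Longrightarrow> dist (emb P p) (emb P o') \<le> r0"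
      unfolding bounded_any_center[of _ "emb P o'"] by (auto simp: dist_commute)
    \<comment> \<open>The right-hand side is \<open>M\<close> times the bound of
      \<open>pairing_integrable\<close> for a function with Lipschitz constant
      \<open>\<Lambda> / r\<close>.\<close>
    have est: "E \<rho> \<le> M * (2 * \<Lambda>\<^sup>2 * (\<Lambda> / r) * I)" if r: "r > 0" "r \<ge> r0" for r
    proof -
      let ?\<phi> = "cutoff o' r"
      let ?t = "\<lambda>p. M * ?\<phi> p + 1 * \<rho> p"
      have \<phi>C: "\<bar>?\<phi> p - ?\<phi> q\<bar> \<le> (\<Lambda> / r) * intrinsic_dist P p q" for p q by (rule cutoff_lipschitz[OF r(1)])
      have \<Lambda>r: "\<Lambda> / r \<ge> 0" using \<Lambda>(1) r by simp
      have tC: "\<bar>?t p - ?t q\<bar> \<le> (M * (\<Lambda> / r) + C) * intrinsic_dist P p q" for p q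
      proof -
        have "?t p - ?t q = M * (?\<phi> p - ?\<phi> q) + (\<rho> p - \<rho> q)" by (simp add: algebra_simps)
        then have "\<bar>?t p - ?t q\<bar> \<le> M * \<bar>?\<phi> p - ?\<phi> q\<bar> + \<bar>\<rho> p - \<rho> q\<bar>"
          using abs_triangle_ineq[of "M * (?\<phi> p - ?\<phi> q)" "\<rho> p - \<rho> q"] M(1) by (simp add: abs_mult)
        also have "\<dots> \<le> M * ((\<Lambda> / r) * intrinsic_dist P p q) + C * intrinsic_dist P p q"
          by (intro add_mono mult_left_mono \<phi>C \<rho>C M(1))
        finally show ?thesis by (simp add: algebra_simps)
      qed
      have "{p. ?t p \<noteq> 0} \<subseteq> {p. dist (emb P p) (emb P o') \<le> 2 * r} \<union> ?S"
      proof
        fix p assume "p \<in> {p. ?t p \<noteq> 0}"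
        then have "?\<phi> p \<noteq> 0 \<or> \<rho> p \<noteq> 0" by auto
        then show "p \<in> {p. dist (emb P p) (emb P o') \<le> 2 * r} \<union> ?S"
          using cutoff_support[OF r(1), of o' p] closure_subset[of "{p. \<rho> p \<noteq> 0}"] by blast
      qed
      moreover have cc: "compact ({p. dist (emb P p) (emb P o') \<le> 2 * r} \<union> ?S)"
        by (intro compact_Un emb_ball_compact \<rho>c)
      ultimately have sub': "closure {p. ?t p \<noteq> 0} \<subseteq> {p. dist (emb P p) (emb P o') \<le> 2 * r} \<union> ?S"
        using closure_minimal compact_imp_closed by blast
      have "compact (closure {p. ?t p \<noteq> 0})"
        using compact_Int_closed[OF cc closed_closure[of "{p. ?t p \<noteq> 0}"]] sub' by (simp only: Int_absorb1)
      then have tl: "?t \<in> lipschitz_compact P"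
        using tC unfolding lipschitz_compact_def lipschitz_fun_def by blast
      have tn: "0 \<le> ?t p" for p
      proof (cases "p \<in> ?S")
        case True
        have "dist (emb P p) (emb P o') / r \<le> 1" using r0[OF True] r by simp
        then have "?\<phi> p = 1" by (simp add: cutoff_def)
        then show ?thesis using M(2)[OF True] by simp
      next
        case False
        then have "\<rho> p = 0" using closure_subset[of "{p. \<rho> p \<noteq> 0}"] by blast
        then show ?thesis using M(1) by (simp add: cutoff_def)
      qed
      have "E ?t \<le> 0"
        unfolding E_def G_def by (rule sub[unfolded weakly_subharmonic_def, THEN conjunct2, rule_format, OF tl tn])
      note i\<phi> = pairing_integrable[OF \<phi>C \<Lambda>r Gm fin] and i\<rho> = pairing_integrable[OF \<rho>C C Gm fin]
      have "E ?t = (\<integral>p. M * g_inner P p (G p) (gradient P ?\<phi> p) + 1 * g_inner P p (G p) (gradient P \<rho> p) \<partial>volume P)"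
        unfolding E_def
      proof (rule integral_cong_AE)
        show "(\<lambda>p. g_inner P p (G p) (gradient P ?t p)) \<in> borel_measurable (volume P)"
          by (rule pairing_measurable[OF tC add_nonneg_nonneg[OF mult_nonneg_nonneg[OF M(1) \<Lambda>r] C] Gm])
        show "(\<lambda>p. M * g_inner P p (G p) (gradient P ?\<phi> p) + 1 * g_inner P p (G p) (gradient P \<rho> p)) \<in> borel_measurable (volume P)"
          using i\<phi>(1) i\<rho>(1) by measurable
      qed (rule pairing_linear[OF \<phi>C \<Lambda>r \<rho>C C])
      also have "\<dots> = M * E ?\<phi> + E \<rho>" using i\<phi>(1) i\<rho>(1) by (simp add: E_def)
      finally have "E \<rho> \<le> - (M * E ?\<phi>)" using \<open>E ?t \<le> 0\<close> by simp
      also have "\<dots> = M * (- E ?\<phi>)" by simp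
      also have "\<dots> \<le> M * (2 * \<Lambda>\<^sup>2 * (\<Lambda> / r) * I)"
        using i\<phi>(2) M(1) unfolding E_def I_def by (intro mult_left_mono) auto
      finally show ?thesis .
    qed
    define A where "A = M * (2 * \<Lambda>\<^sup>2 * \<Lambda> * I)"
    have ev: "\<forall>\<^sub>F r in at_top. E \<rho> \<le> A / r"
      using eventually_gt_at_top[of 0] eventually_ge_at_top[of r0]
    proof eventually_elim
      case (elim r)
      from est[OF this] show ?case by (simp add: A_def)
    qed
    have "((\<lambda>r. A / r) \<longlongrightarrow> 0) at_top" by (intro tendsto_divide_0[OF tendsto_const] filterlim_at_top_imp_at_infinity filterlim_ident)
    then show "E \<rho> \<le> 0" by (rule tendsto_lowerbound[OF _ ev]) simp
  qed
  have "E \<rho> = 0" if \<rho>: "\<rho> \<in> lipschitz_compact P" for \<rho>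
  proof -
    obtain C where C: "C \<ge> 0" and "\<And>p q. p \<in> UNIV \<Longrightarrow> q \<in> UNIV \<Longrightarrow> \<bar>\<rho> p - \<rho> q\<bar> \<le> C * intrinsic_dist P p q"
      using \<rho> lipschitz_fun_obtain[of UNIV \<rho>] unfolding lipschitz_compact_def by blast
    then have \<rho>C: "\<bar>\<rho> p - \<rho> q\<bar> \<le> C * intrinsic_dist P p q" for p q by simp
    \<comment> \<open>The negative of \<rho>, written as a combination of two functions to fit
      \<open>pairing_linear\<close>.\<close>
    let ?n = "\<lambda>p. (-1) * \<rho> p + 0 * \<rho> p"
    have nC: "\<bar>?n p - ?n q\<bar> \<le> C * intrinsic_dist P p q" for p q using \<rho>C[of q p] \<rho>C[of p q] by (simp add: abs_minus_commute)
    have "?n \<in> lipschitz_compact P"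
      using \<rho> nC unfolding lipschitz_compact_def lipschitz_fun_def by auto
    then have "E ?n \<le> 0" by (rule nonpos)
    moreover have "E ?n = (\<integral>p. (-1) * g_inner P p (G p) (gradient P \<rho> p) + 0 * g_inner P p (G p) (gradient P \<rho> p) \<partial>volume P)"
      unfolding E_def
    proof (rule integral_cong_AE)
      show "(\<lambda>p. g_inner P p (G p) (gradient P ?n p)) \<in> borel_measurable (volume P)"
        by (rule pairing_measurable[OF nC C Gm])
      show "(\<lambda>p. (-1) * g_inner P p (G p) (gradient P \<rho> p) + 0 * g_inner P p (G p) (gradient P \<rho> p)) \<in> borel_measurable (volume P)"
        using pairing_measurable[OF \<rho>C C Gm] by measurable
    qed (rule pairing_linear[OF \<rho>C C \<rho>C C])
    ultimately have "0 \<le> E \<rho>" by (simp add: E_def)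
    then show ?thesis using nonpos[OF \<rho>] by simp
  qed
  then show ?thesis using f unfolding weakly_harmonic_def E_def G_def by blast
qed

end

theorem theorem4p2:
  fixes P :: "('v, 'x::metric_space, 'e::euclidean_space, 'n::finite) triangulated"
    and f :: "'x \<Rightarrow> real"
  assumes "riemannian_polyhedron P"
    and "pseudomanifold P"
    and "boundary P = {}"
    and "complete_polyhedron P"
    and "\<not> compact (UNIV :: 'x set)"
    and "f \<in> W12_loc P"
    and "continuous_on UNIV f"
    and "weakly_subharmonic P f"
    and "grad_L1_norm P f < \<infinity>"
  shows "harmonic P f"
proof -
  interpret riem_polyhedron P
    using assms(1,2) by unfold_locales (simp_all add: pseudomanifold_def circuit_def)
  show ?thesis
    using subharmonic_integrable_gradient_imp_harmonic[OF assms(6,8,9)] assms(7)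
    by (simp add: harmonic_def)
qed

end
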